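(* Let $\mathbb{K}$ be a field. Let ${\sf P}\colon \mathtt{g}{\sf SkBrcd}\to {}_{\mathbb{K}}\overline{{\sf HBrcd}}$ be the functor $(G,\cdot,N,\ast,\odot)\mapsto(\mathbb{K}[G],\mathbb{K}[N],\varphi_{\odot})$, $(f,g)\mapsto(\mathbb{K}[f],\mathbb{K}[g])$, and let ${\sf R}\colon {}_{\mathbb{K}}\overline{{\sf HBrcd}}\to\mathtt{g}{\sf SkBrcd}$ be the functor $(H,B,\varphi_B)\mapsto({\sf G}(H),{\sf G}(B),\circledast)$, $(f,g)\mapsto (f|_{{\sf G}(H)},g|_{{\sf G}(B)})$, where ${\sf P}$ is left adjoint to ${\sf R}$ via the bijections $$\operatorname{Hom}({\sf P}(G,\cdot,N,\ast,\odot),(H,B,\varphi_B))\to\operatorname{Hom}((G,\cdot,N,\ast,\odot),{\sf R}(H,B,\varphi_B)),\quad (p,q)\mapsto (p|_G,q|_N).$$ Then the adjunction ${\sf P}\dashv{\sf R}$ induces a categorical equivalence between the category $\mathtt{g}{\sf SkBrcd}$ of generalized skew bracoids and the full subcategory of ${}_{\mathbb{K}}\overline{{\sf HBrcd}}$ consisting of all pointed and cosemisimple Hopf bracoids.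
   Context: Generalized skew bracoids. A generalized skew bracoid is a 5-tuple $(G,\cdot,N,\ast,\odot)$ where $(G,\cdot)$ and $(N,\ast)$ are groups and $\odot\colon G\times N\to N$ is a (not necessarily transitive) left action of the group $G$ on the set $N$ such that $g\odot(n\ast n')=(g\odot n)\ast(g\odot e_N)^{-1}\ast(g\odot n')$ for all $g\in G$, $n,n'\in N$, where $e_N$ is the unit of $(N,\ast)$. A morphism $(G,\cdot,N,\ast,\odot)\to(G',\cdot',N',\ast',\odot')$ is a pair $(f,g)$ of group morphisms $f\colon G\to G'$, $g\colon N\to N'$ with $g(x\odot n)=f(x)\odot' g(n)$ for all $x\in G$, $n\in N$. This category is denoted $\mathtt{g}{\sf SkBrcd}$. Hopf bracoids over a field. For Hopf algebras $H,B$ over $\mathbb{K}$ (with unit $\eta$, product $\mu$, counit $\varepsilon$, coproduct $\delta$, antipode $\lambda$), a Hopf bracoid $(H,B,\varphi_B)$ in ${}_{\mathbb{K}}{\sf Vect}$ consists of a left $H$-module structure $\varphi_B\colon H\otimes B\to B$ such that $$\varphi_{B}\circ(H\otimes\mu_{B})=\mu_{B}\circ (\varphi_{B}\otimes\Phi_{B})\circ(H\otimes c_{H,B}\otimes B)\circ(\delta_{H}\otimes B\otimes B),$$ where $c$ is the usual flip, $\Phi_{B}=\mu_{B}\circ((\lambda_{B}\circ u_{\varphi_{B}})\otimes\varphi_{B})\circ(\delta_{H}\otimes B)$, $u_{\varphi_{B}}=\varphi_{B}\circ(H\otimes\eta_{B})$, and an object name inside a tensor product of maps denotes its identity map. A morphism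 $(H,B,\varphi_B)\to(H',B',\varphi_{B'})$ is a pair $(f,g)$ of Hopf algebra morphisms $f\colon H\to H'$, $g\colon B\to B'$ with $g\circ\varphi_B=\varphi_{B'}\circ(f\otimes g)$. ${}_{\mathbb{K}}\overline{{\sf HBrcd}}$ is the category of those Hopf bracoids in ${}_{\mathbb{K}}{\sf Vect}$ for which $\varphi_B$ is a coalgebra morphism (with $H\otimes B$ carrying the tensor coalgebra structure), with all morphisms of Hopf bracoids between them. Notation. $\mathbb{K}[G]$ is the group Hopf algebra of a group $G$ (elements of $G$ group-like), $\mathbb{K}[f]$ is the linear extension of a group morphism $f$, and $\varphi_\odot\colon\mathbb{K}[G]\otimes\mathbb{K}[N]\to\mathbb{K}[N]$ is the linear extension of $\odot$. ${\sf G}(X)$ is the group of group-like elements of a Hopf algebra $X$ (elements $x$ with $\delta_X(x)=x\otimes x$, $\varepsilon_X(x)=1$), with the product of $X$; $h\circledast b=\varphi_B(h\otimes b)$ for $h\in{\sf G}(H)$, $b\in{\sf G}(B)$. A coalgebra is pointed if its simple subcoalgebras are one-dimensional, and cosemisimple if it equals its coradical (the sum of its simple subcoalgebras); it is pointed and cosemisimple if and only if it is spanned by its group-like elements. A Hopf bracoid $(H,B,\varphi_B)$ is pointed and cosemisimple if the coalgebras underlying $H$ and $B$ are both pointed and cosemisimple. *)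

theory Defs
  imports "HOL-Algebra.Module" "HOL-Algebra.AbelCoset" "HOL-Algebra.Group_Action" "HOL-Library.FSet"
begin

section \<open>Categories, functors, adjunctions, equivalences\<close>

text \<open>Hom-sets of different pairs of objects may overlap, so the composition and the arrow maps of
  functors take source and target objects as explicit arguments.
  \<open>Comp C X Y Z g f\<close> is the composite of \<open>f : X \<rightarrow> Y\<close> and \<open>g : Y \<rightarrow> Z\<close>.\<close>

record ('o, 'm) cat =
  Obj  :: "'o set"
  Hom  :: "'o \<Rightarrow> 'o \<Rightarrow> 'm set"
  Idn  :: "'o \<Rightarrow> 'm"
  Comp :: "'o \<Rightarrow> 'o \<Rightarrow> 'o \<Rightarrow> 'm \<Rightarrow> 'm \<Rightarrow> 'm"

definition category :: "('o, 'm) cat \<Rightarrow> bool" where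
  "category C \<longleftrightarrow>
     (\<forall>X\<in>Obj C. Idn C X \<in> Hom C X X) \<and>
     (\<forall>X\<in>Obj C. \<forall>Y\<in>Obj C. \<forall>Z\<in>Obj C. \<forall>f\<in>Hom C X Y. \<forall>g\<in>Hom C Y Z.
        Comp C X Y Z g f \<in> Hom C X Z) \<and>
     (\<forall>X\<in>Obj C. \<forall>Y\<in>Obj C. \<forall>f\<in>Hom C X Y.
        Comp C X X Y f (Idn C X) = f \<and> Comp C X Y Y (Idn C Y) f = f) \<and>
     (\<forall>W\<in>Obj C. \<forall>X\<in>Obj C. \<forall>Y\<in>Obj C. \<forall>Z\<in>Obj C.
        \<forall>f\<in>Hom C W X. \<forall>g\<in>Hom C X Y. \<forall>h\<in>Hom C Y Z.
        Comp C W Y Z h (Comp C W X Y g f) = Comp C W X Z (Comp C X Y Z h g) f)"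

definition full_subcat :: "('o, 'm) cat \<Rightarrow> ('o \<Rightarrow> bool) \<Rightarrow> ('o, 'm) cat" where
  "full_subcat C P = C\<lparr>Obj := {X \<in> Obj C. P X}\<rparr>"

record ('o, 'm, 'p, 'n) func =
  FObj :: "'o \<Rightarrow> 'p"
  FMap :: "'o \<Rightarrow> 'o \<Rightarrow> 'm \<Rightarrow> 'n"

definition is_functor :: "('o, 'm) cat \<Rightarrow> ('p, 'n) cat \<Rightarrow> ('o, 'm, 'p, 'n) func \<Rightarrow> bool" where
  "is_functor C D F \<longleftrightarrow> category C \<and> category D \<and>
     (\<forall>X\<in>Obj C. FObj F X \<in> Obj D) \<and>
     (\<forall>X\<in>Obj C. \<forall>Y\<in>Obj C. \<forall>f\<in>Hom C X Y. FMap F X Y f \<in> Hom D (FObj F X) (FObj F Y)) \<and>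
     (\<forall>X\<in>Obj C. FMap F X X (Idn C X) = Idn D (FObj F X)) \<and>
     (\<forall>X\<in>Obj C. \<forall>Y\<in>Obj C. \<forall>Z\<in>Obj C. \<forall>f\<in>Hom C X Y. \<forall>g\<in>Hom C Y Z.
        FMap F X Z (Comp C X Y Z g f) =
          Comp D (FObj F X) (FObj F Y) (FObj F Z) (FMap F Y Z g) (FMap F X Y f))"

definition id_func :: "('o, 'm, 'o, 'm) func" where
  "id_func = \<lparr>FObj = (\<lambda>X. X), FMap = (\<lambda>X Y f. f)\<rparr>"

definition comp_func ::
  "('p, 'n, 'q, 'r) func \<Rightarrow> ('o, 'm, 'p, 'n) func \<Rightarrow> ('o, 'm, 'q, 'r) func" where
  "comp_func G F = \<lparr>FObj = (\<lambda>X. FObj G (FObj F X)),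
                    FMap = (\<lambda>X Y f. FMap G (FObj F X) (FObj F Y) (FMap F X Y f))\<rparr>"

definition is_iso :: "('o, 'm) cat \<Rightarrow> 'o \<Rightarrow> 'o \<Rightarrow> 'm \<Rightarrow> bool" where
  "is_iso C X Y f \<longleftrightarrow> f \<in> Hom C X Y \<and>
     (\<exists>g\<in>Hom C Y X. Comp C X Y X g f = Idn C X \<and> Comp C Y X Y f g = Idn C Y)"

definition natural_iso ::
  "('o, 'm) cat \<Rightarrow> ('p, 'n) cat \<Rightarrow> ('o, 'm, 'p, 'n) func \<Rightarrow> ('o, 'm, 'p, 'n) func
     \<Rightarrow> ('o \<Rightarrow> 'n) \<Rightarrow> bool" where
  "natural_iso C D F G \<tau> \<longleftrightarrow> is_functor C D F \<and> is_functor C D G \<and>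
     (\<forall>X\<in>Obj C. is_iso D (FObj F X) (FObj G X) (\<tau> X)) \<and>
     (\<forall>X\<in>Obj C. \<forall>Y\<in>Obj C. \<forall>f\<in>Hom C X Y.
        Comp D (FObj F X) (FObj G X) (FObj G Y) (FMap G X Y f) (\<tau> X) =
        Comp D (FObj F X) (FObj F Y) (FObj G Y) (\<tau> Y) (FMap F X Y f))"

text \<open>\<open>F\<close> is left adjoint to \<open>G\<close> via the bijections \<open>\<Phi> A X : Hom (F A) X \<rightarrow> Hom A (G X)\<close>,
  natural in both arguments.\<close>

definition adjunction ::
  "('o, 'm) cat \<Rightarrow> ('p, 'n) cat \<Rightarrow> ('o, 'm, 'p, 'n) func \<Rightarrow> ('p, 'n, 'o, 'm) func
     \<Rightarrow> ('o \<Rightarrow> 'p \<Rightarrow> 'n \<Rightarrow> 'm) \<Rightarrow> bool" where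
  "adjunction C D F G \<Phi> \<longleftrightarrow> is_functor C D F \<and> is_functor D C G \<and>
     (\<forall>A\<in>Obj C. \<forall>X\<in>Obj D. bij_betw (\<Phi> A X) (Hom D (FObj F A) X) (Hom C A (FObj G X))) \<and>
     (\<forall>A\<in>Obj C. \<forall>A'\<in>Obj C. \<forall>X\<in>Obj D. \<forall>a\<in>Hom C A' A. \<forall>h\<in>Hom D (FObj F A) X.
        \<Phi> A' X (Comp D (FObj F A') (FObj F A) X h (FMap F A' A a)) =
        Comp C A' A (FObj G X) (\<Phi> A X h) a) \<and>
     (\<forall>A\<in>Obj C. \<forall>X\<in>Obj D. \<forall>X'\<in>Obj D. \<forall>h\<in>Hom D (FObj F A) X. \<forall>k\<in>Hom D X X'.
        \<Phi> A X' (Comp D (FObj F A) X X' k h) =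
        Comp C A (FObj G X) (FObj G X') (FMap G X X' k) (\<Phi> A X h))"

definition adj_unit ::
  "('p, 'n) cat \<Rightarrow> ('o, 'm, 'p, 'n) func \<Rightarrow> ('o \<Rightarrow> 'p \<Rightarrow> 'n \<Rightarrow> 'm) \<Rightarrow> 'o \<Rightarrow> 'm" where
  "adj_unit D F \<Phi> A = \<Phi> A (FObj F A) (Idn D (FObj F A))"

definition adj_counit ::
  "('o, 'm) cat \<Rightarrow> ('p, 'n) cat \<Rightarrow> ('o, 'm, 'p, 'n) func \<Rightarrow> ('p, 'n, 'o, 'm) func
     \<Rightarrow> ('o \<Rightarrow> 'p \<Rightarrow> 'n \<Rightarrow> 'm) \<Rightarrow> 'p \<Rightarrow> 'n" where
  "adj_counit C D F G \<Phi> X =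
     inv_into (Hom D (FObj F (FObj G X)) X) (\<Phi> (FObj G X) X) (Idn C (FObj G X))"

definition cat_equivalence ::
  "('o, 'm) cat \<Rightarrow> ('p, 'n) cat \<Rightarrow> ('o, 'm, 'p, 'n) func \<Rightarrow> ('p, 'n, 'o, 'm) func
     \<Rightarrow> ('o \<Rightarrow> 'm) \<Rightarrow> ('p \<Rightarrow> 'n) \<Rightarrow> bool" where
  "cat_equivalence C D F G \<eta> \<epsilon> \<longleftrightarrow> is_functor C D F \<and> is_functor D C G \<and>
     natural_iso C C id_func (comp_func G F) \<eta> \<and>
     natural_iso D D (comp_func F G) id_func \<epsilon>"


section \<open>Linear algebra over a field\<close>

text \<open>A vector space over \<open>K\<close> is a record \<open>V\<close> with \<open>module K V\<close>; in records that only serve as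
  vector spaces the fields \<open>mult\<close> and \<open>one\<close> are irrelevant.\<close>

definition lin_hom ::
  "('k, 'm) ring_scheme \<Rightarrow> ('k, 'a, 'c) module_scheme \<Rightarrow> ('k, 'b, 'd) module_scheme
     \<Rightarrow> ('a \<Rightarrow> 'b) set" where
  "lin_hom K V W = {f. f \<in> carrier V \<rightarrow> carrier W \<and>
     (\<forall>x\<in>carrier V. \<forall>y\<in>carrier V. f (x \<oplus>\<^bsub>V\<^esub> y) = f x \<oplus>\<^bsub>W\<^esub> f y) \<and>
     (\<forall>k\<in>carrier K. \<forall>x\<in>carrier V. f (k \<odot>\<^bsub>V\<^esub> x) = k \<odot>\<^bsub>W\<^esub> f x)}"

definition lin_span ::
  "('k, 'm) ring_scheme \<Rightarrow> ('k, 'a, 'c) module_scheme \<Rightarrow> 'a set \<Rightarrow> 'a set" where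
  "lin_span K V S = \<Inter>{W. submodule W K V \<and> S \<subseteq> W}"

definition ground :: "('k, 'm) ring_scheme \<Rightarrow> ('k, 'k) module" where
  "ground K = \<lparr>carrier = carrier K, mult = mult K, one = one K, zero = zero K, add = add K,
               smult = mult K\<rparr>"

definition fin_supp :: "('k, 'm) ring_scheme \<Rightarrow> ('a \<Rightarrow> 'k) set" where
  "fin_supp K = {c. range c \<subseteq> carrier K \<and> finite {x. c x \<noteq> \<zero>\<^bsub>K\<^esub>}}"

definition bvec :: "('k, 'm) ring_scheme \<Rightarrow> 'a \<Rightarrow> 'a \<Rightarrow> 'k" where
  "bvec K x = (\<lambda>y. if y = x then \<one>\<^bsub>K\<^esub> else \<zero>\<^bsub>K\<^esub>)"

text \<open>The vector space with basis \<open>S\<close>; a formal combination is its coefficient function.\<close>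

definition free_mod :: "('k, 'm) ring_scheme \<Rightarrow> 'a set \<Rightarrow> ('k, 'a \<Rightarrow> 'k) module" where
  "free_mod K S = \<lparr>carrier = {c \<in> fin_supp K. \<forall>x. x \<notin> S \<longrightarrow> c x = \<zero>\<^bsub>K\<^esub>},
     mult = undefined, one = undefined,
     zero = (\<lambda>x. \<zero>\<^bsub>K\<^esub>), add = (\<lambda>c d x. c x \<oplus>\<^bsub>K\<^esub> d x), smult = (\<lambda>k c x. k \<otimes>\<^bsub>K\<^esub> c x)\<rparr>"

definition lin_ext ::
  "('k, 'm) ring_scheme \<Rightarrow> ('k, 'b, 'c) module_scheme \<Rightarrow> ('a \<Rightarrow> 'b) \<Rightarrow> ('a \<Rightarrow> 'k) \<Rightarrow> 'b" where
  "lin_ext K V f c = finsum V (\<lambda>x. c x \<odot>\<^bsub>V\<^esub> f x) {x. c x \<noteq> \<zero>\<^bsub>K\<^esub>}"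


subsection \<open>Tensor products\<close>

text \<open>\<open>A \<otimes> B\<close> is the free vector space on \<open>carrier A \<times> carrier B\<close> modulo the subspace spanned by the
  bilinearity relations; its elements are cosets.\<close>

definition tensor_rel ::
  "('k, 'm) ring_scheme \<Rightarrow> ('k, 'a, 'c) module_scheme \<Rightarrow> ('k, 'b, 'd) module_scheme
     \<Rightarrow> ('a \<times> 'b \<Rightarrow> 'k) set" where
  "tensor_rel K A B = (let F = free_mod K (carrier A \<times> carrier B); e = bvec K in
     {e (x \<oplus>\<^bsub>A\<^esub> x', y) \<ominus>\<^bsub>F\<^esub> (e (x, y) \<oplus>\<^bsub>F\<^esub> e (x', y)) | x x' y.
        x \<in> carrier A \<and> x' \<in> carrier A \<and> y \<in> carrier B} \<union>
     {e (x, y \<oplus>\<^bsub>B\<^esub> y') \<ominus>\<^bsub>F\<^esub> (e (x, y) \<oplus>\<^bsub>F\<^esub> e (x, y')) | x y y'.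
        x \<in> carrier A \<and> y \<in> carrier B \<and> y' \<in> carrier B} \<union>
     {e (k \<odot>\<^bsub>A\<^esub> x, y) \<ominus>\<^bsub>F\<^esub> k \<odot>\<^bsub>F\<^esub> e (x, y) | k x y.
        k \<in> carrier K \<and> x \<in> carrier A \<and> y \<in> carrier B} \<union>
     {e (x, k \<odot>\<^bsub>B\<^esub> y) \<ominus>\<^bsub>F\<^esub> k \<odot>\<^bsub>F\<^esub> e (x, y) | k x y.
        k \<in> carrier K \<and> x \<in> carrier A \<and> y \<in> carrier B})"

definition tensor_ker ::
  "('k, 'm) ring_scheme \<Rightarrow> ('k, 'a, 'c) module_scheme \<Rightarrow> ('k, 'b, 'd) module_scheme
     \<Rightarrow> ('a \<times> 'b \<Rightarrow> 'k) set" where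
  "tensor_ker K A B = lin_span K (free_mod K (carrier A \<times> carrier B)) (tensor_rel K A B)"

definition rep :: "'a set \<Rightarrow> 'a" where
  "rep X = (SOME c. c \<in> X)"

text \<open>The fields \<open>mult\<close> and \<open>one\<close> give the tensor product algebra
  \<open>(a \<otimes> b)(a' \<otimes> b') = aa' \<otimes> bb'\<close> when \<open>A\<close> and \<open>B\<close> are algebras.\<close>

definition tensor ::
  "('k, 'm) ring_scheme \<Rightarrow> ('k, 'a, 'c) module_scheme \<Rightarrow> ('k, 'b, 'd) module_scheme
     \<Rightarrow> ('k, ('a \<times> 'b \<Rightarrow> 'k) set) module" where
  "tensor K A B = (let F = free_mod K (carrier A \<times> carrier B); I = tensor_ker K A B in
     \<lparr>carrier = a_rcosets\<^bsub>F\<^esub> I,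
      mult = (\<lambda>X Y. I +>\<^bsub>F\<^esub> lin_ext K F (\<lambda>p. lin_ext K F
                (\<lambda>q. bvec K (fst p \<otimes>\<^bsub>A\<^esub> fst q, snd p \<otimes>\<^bsub>B\<^esub> snd q)) (rep Y)) (rep X)),
      one = I +>\<^bsub>F\<^esub> bvec K (\<one>\<^bsub>A\<^esub>, \<one>\<^bsub>B\<^esub>),
      zero = I,
      add = (\<lambda>X Y. X <+>\<^bsub>F\<^esub> Y),
      smult = (\<lambda>k X. I +>\<^bsub>F\<^esub> (k \<odot>\<^bsub>F\<^esub> rep X))\<rparr>)"

definition tens ::
  "('k, 'm) ring_scheme \<Rightarrow> ('k, 'a, 'c) module_scheme \<Rightarrow> ('k, 'b, 'd) module_scheme
     \<Rightarrow> 'a \<Rightarrow> 'b \<Rightarrow> ('a \<times> 'b \<Rightarrow> 'k) set" where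
  "tens K A B x y = tensor_ker K A B +>\<^bsub>free_mod K (carrier A \<times> carrier B)\<^esub> bvec K (x, y)"

text \<open>The linear map \<open>A \<otimes> B \<rightarrow> V\<close>, \<open>x \<otimes> y \<mapsto> \<beta> x y\<close>, for \<open>\<beta>\<close> bilinear: evaluated on any
  representative of the coset.\<close>

definition tlift ::
  "('k, 'm) ring_scheme \<Rightarrow> ('k, 'v, 'e) module_scheme \<Rightarrow> ('a \<Rightarrow> 'b \<Rightarrow> 'v)
     \<Rightarrow> ('a \<times> 'b \<Rightarrow> 'k) set \<Rightarrow> 'v" where
  "tlift K V \<beta> X = lin_ext K V (\<lambda>p. \<beta> (fst p) (snd p)) (rep X)"

text \<open>\<open>f \<otimes> g\<close>, with codomain \<open>A' \<otimes> B'\<close>.\<close>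

definition tmap ::
  "('k, 'm) ring_scheme \<Rightarrow> ('k, 'c, 'r) module_scheme \<Rightarrow> ('k, 'd, 's) module_scheme
     \<Rightarrow> ('a \<Rightarrow> 'c) \<Rightarrow> ('b \<Rightarrow> 'd) \<Rightarrow> ('a \<times> 'b \<Rightarrow> 'k) set \<Rightarrow> ('c \<times> 'd \<Rightarrow> 'k) set" where
  "tmap K A' B' f g = tlift K (tensor K A' B') (\<lambda>x y. tens K A' B' (f x) (g y))"

text \<open>\<open>(A \<otimes> B) \<otimes> C \<rightarrow> A \<otimes> (B \<otimes> C)\<close>\<close>

definition tassoc ::
  "('k, 'm) ring_scheme \<Rightarrow> ('k, 'a, 'r) module_scheme \<Rightarrow> ('k, 'b, 's) module_scheme
     \<Rightarrow> ('k, 'c, 't) module_scheme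
     \<Rightarrow> (('a \<times> 'b \<Rightarrow> 'k) set \<times> 'c \<Rightarrow> 'k) set \<Rightarrow> ('a \<times> ('b \<times> 'c \<Rightarrow> 'k) set \<Rightarrow> 'k) set" where
  "tassoc K A B C = (let T = tensor K A (tensor K B C) in
     tlift K T (\<lambda>s z. tlift K T (\<lambda>x y. tens K A (tensor K B C) x (tens K B C y z)) s))"

text \<open>\<open>A \<otimes> c \<otimes> D\<close> for the flip \<open>c : B \<otimes> C \<rightarrow> C \<otimes> B\<close>, bracketed as
  \<open>(A \<otimes> B) \<otimes> (C \<otimes> D) \<rightarrow> (A \<otimes> C) \<otimes> (B \<otimes> D)\<close>.\<close>

definition tswap ::
  "('k, 'm) ring_scheme \<Rightarrow> ('k, 'a, 'r) module_scheme \<Rightarrow> ('k, 'b, 's) module_scheme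
     \<Rightarrow> ('k, 'c, 't) module_scheme \<Rightarrow> ('k, 'd, 'u) module_scheme
     \<Rightarrow> (('a \<times> 'b \<Rightarrow> 'k) set \<times> ('c \<times> 'd \<Rightarrow> 'k) set \<Rightarrow> 'k) set
     \<Rightarrow> (('a \<times> 'c \<Rightarrow> 'k) set \<times> ('b \<times> 'd \<Rightarrow> 'k) set \<Rightarrow> 'k) set" where
  "tswap K A B C D = (let T = tensor K (tensor K A C) (tensor K B D) in
     tlift K T (\<lambda>s t. tlift K T (\<lambda>a b. tlift K T (\<lambda>c d.
       tens K (tensor K A C) (tensor K B D) (tens K A C a c) (tens K B D b d)) t) s))"


section \<open>Coalgebras and Hopf algebras\<close>

record ('k, 'a) coalg = "('k, 'a) module" +
  comul  :: "'a \<Rightarrow> ('a \<times> 'a \<Rightarrow> 'k) set"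
  counit :: "'a \<Rightarrow> 'k"

record ('k, 'a) hopf = "('k, 'a) coalg" +
  antipode :: "'a \<Rightarrow> 'a"

definition coalgebra :: "('k, 'm) ring_scheme \<Rightarrow> ('k, 'a, 'c) coalg_scheme \<Rightarrow> bool" where
  "coalgebra K C \<longleftrightarrow> module K C \<and>
     comul C \<in> lin_hom K C (tensor K C C) \<and>
     counit C \<in> lin_hom K C (ground K) \<and>
     (\<forall>x\<in>carrier C.
        tassoc K C C C (tmap K (tensor K C C) C (comul C) id (comul C x)) =
        tmap K C (tensor K C C) id (comul C) (comul C x)) \<and>
     (\<forall>x\<in>carrier C.
        tlift K C (\<lambda>y z. counit C y \<odot>\<^bsub>C\<^esub> z) (comul C x) = x \<and>
        tlift K C (\<lambda>y z. counit C z \<odot>\<^bsub>C\<^esub> y) (comul C x) = x)"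

definition coalg_hom ::
  "('k, 'm) ring_scheme \<Rightarrow> ('k, 'a, 'c) coalg_scheme \<Rightarrow> ('k, 'b, 'd) coalg_scheme
     \<Rightarrow> ('a \<Rightarrow> 'b) set" where
  "coalg_hom K C D = {f \<in> lin_hom K C D. \<forall>x\<in>carrier C.
     comul D (f x) = tmap K D D f f (comul C x) \<and> counit D (f x) = counit C x}"

definition tensor_coalg ::
  "('k, 'm) ring_scheme \<Rightarrow> ('k, 'a, 'c) coalg_scheme \<Rightarrow> ('k, 'b, 'd) coalg_scheme
     \<Rightarrow> ('k, ('a \<times> 'b \<Rightarrow> 'k) set) coalg" where
  "tensor_coalg K C D = (let T = tensor K C D in
     \<lparr>carrier = carrier T, mult = mult T, one = one T, zero = zero T, add = add T, smult = smult T,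
      comul = (\<lambda>t. tswap K C C D D (tmap K (tensor K C C) (tensor K D D) (comul C) (comul D) t)),
      counit = tlift K (ground K) (\<lambda>x y. counit C x \<otimes>\<^bsub>K\<^esub> counit D y)\<rparr>)"

text \<open>Associative unital algebras; \<open>HOL-Algebra\<close>'s \<open>algebra\<close> is restricted to commutative ones.\<close>

definition unital_algebra :: "('k, 'm) ring_scheme \<Rightarrow> ('k, 'a, 'c) module_scheme \<Rightarrow> bool" where
  "unital_algebra K A \<longleftrightarrow> module K A \<and> ring A \<and>
     (\<forall>k\<in>carrier K. \<forall>x\<in>carrier A. \<forall>y\<in>carrier A.
        (k \<odot>\<^bsub>A\<^esub> x) \<otimes>\<^bsub>A\<^esub> y = k \<odot>\<^bsub>A\<^esub> (x \<otimes>\<^bsub>A\<^esub> y) \<and> x \<otimes>\<^bsub>A\<^esub> (k \<odot>\<^bsub>A\<^esub> y) = k \<odot>\<^bsub>A\<^esub> (x \<otimes>\<^bsub>A\<^esub> y))"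

definition tmult ::
  "('k, 'm) ring_scheme \<Rightarrow> ('k, 'a, 'c) module_scheme \<Rightarrow> ('a \<times> 'a \<Rightarrow> 'k) set \<Rightarrow> 'a" where
  "tmult K A = tlift K A (\<lambda>x y. x \<otimes>\<^bsub>A\<^esub> y)"

definition hopf_algebra :: "('k, 'm) ring_scheme \<Rightarrow> ('k, 'a, 'c) hopf_scheme \<Rightarrow> bool" where
  "hopf_algebra K H \<longleftrightarrow> unital_algebra K H \<and> coalgebra K H \<and>
     comul H \<in> ring_hom H (tensor K H H) \<and> counit H \<in> ring_hom H K \<and>
     antipode H \<in> lin_hom K H H \<and>
     (\<forall>x\<in>carrier H.
        tmult K H (tmap K H H (antipode H) id (comul H x)) = counit H x \<odot>\<^bsub>H\<^esub> \<one>\<^bsub>H\<^esub> \<and>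
        tmult K H (tmap K H H id (antipode H) (comul H x)) = counit H x \<odot>\<^bsub>H\<^esub> \<one>\<^bsub>H\<^esub>)"

text \<open>Algebra and coalgebra morphisms (such maps commute with the antipodes automatically).
  Extensionality makes equality of morphisms the equality of maps on the carrier.\<close>

definition hopf_hom ::
  "('k, 'm) ring_scheme \<Rightarrow> ('k, 'a, 'c) hopf_scheme \<Rightarrow> ('k, 'b, 'd) hopf_scheme
     \<Rightarrow> ('a \<Rightarrow> 'b) set" where
  "hopf_hom K H H' = coalg_hom K H H' \<inter> ring_hom H H' \<inter> extensional (carrier H)"


subsection \<open>Pointed and cosemisimple coalgebras\<close>

definition subcoalgebra ::
  "('k, 'm) ring_scheme \<Rightarrow> ('k, 'a, 'c) coalg_scheme \<Rightarrow> 'a set \<Rightarrow> bool" where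
  "subcoalgebra K C D \<longleftrightarrow> submodule D K C \<and>
     comul C ` D \<subseteq> lin_span K (tensor K C C) {tens K C C x y | x y. x \<in> D \<and> y \<in> D}"

definition simple_subcoalgebra ::
  "('k, 'm) ring_scheme \<Rightarrow> ('k, 'a, 'c) coalg_scheme \<Rightarrow> 'a set \<Rightarrow> bool" where
  "simple_subcoalgebra K C D \<longleftrightarrow> subcoalgebra K C D \<and> D \<noteq> {\<zero>\<^bsub>C\<^esub>} \<and>
     (\<forall>E. subcoalgebra K C E \<and> E \<subseteq> D \<longrightarrow> E = {\<zero>\<^bsub>C\<^esub>} \<or> E = D)"

definition pointed :: "('k, 'm) ring_scheme \<Rightarrow> ('k, 'a, 'c) coalg_scheme \<Rightarrow> bool" where
  "pointed K C \<longleftrightarrow> (\<forall>D. simple_subcoalgebra K C D \<longrightarrow>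
     (\<exists>x\<in>carrier C. x \<noteq> \<zero>\<^bsub>C\<^esub> \<and> D = {k \<odot>\<^bsub>C\<^esub> x | k. k \<in> carrier K}))"

definition coradical :: "('k, 'm) ring_scheme \<Rightarrow> ('k, 'a, 'c) coalg_scheme \<Rightarrow> 'a set" where
  "coradical K C = lin_span K C (\<Union>{D. simple_subcoalgebra K C D})"

definition cosemisimple :: "('k, 'm) ring_scheme \<Rightarrow> ('k, 'a, 'c) coalg_scheme \<Rightarrow> bool" where
  "cosemisimple K C \<longleftrightarrow> coradical K C = carrier C"


section \<open>Generalized skew bracoids\<close>

record 'u skbrcd =
  grpG :: "'u monoid"
  grpN :: "'u monoid"
  actn :: "'u \<Rightarrow> 'u \<Rightarrow> 'u"

definition gen_skew_bracoid :: "'u skbrcd \<Rightarrow> bool" where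
  "gen_skew_bracoid S \<longleftrightarrow> (let N = grpN S; a = actn S in
     group (grpG S) \<and> group N \<and> group_action (grpG S) (carrier N) a \<and>
     (\<forall>g\<in>carrier (grpG S). \<forall>n\<in>carrier N. \<forall>n'\<in>carrier N.
        a g (n \<otimes>\<^bsub>N\<^esub> n') = a g n \<otimes>\<^bsub>N\<^esub> inv\<^bsub>N\<^esub> (a g \<one>\<^bsub>N\<^esub>) \<otimes>\<^bsub>N\<^esub> a g n'))"

definition gSkBrcd :: "('u skbrcd, ('u \<Rightarrow> 'u) \<times> ('u \<Rightarrow> 'u)) cat" where
  "gSkBrcd = \<lparr>
     Obj = {S. gen_skew_bracoid S},
     Hom = (\<lambda>S T. {(f, g).
        f \<in> hom (grpG S) (grpG T) \<inter> extensional (carrier (grpG S)) \<and>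
        g \<in> hom (grpN S) (grpN T) \<inter> extensional (carrier (grpN S)) \<and>
        (\<forall>x\<in>carrier (grpG S). \<forall>n\<in>carrier (grpN S). g (actn S x n) = actn T (f x) (g n))}),
     Idn = (\<lambda>S. (\<lambda>x\<in>carrier (grpG S). x, \<lambda>n\<in>carrier (grpN S). n)),
     Comp = (\<lambda>S T U q p. (compose (carrier (grpG S)) (fst q) (fst p),
                          compose (carrier (grpN S)) (snd q) (snd p)))\<rparr>"


section \<open>Hopf bracoids\<close>

record ('k, 'u) hbrcd =
  hopH :: "('k, 'u) hopf"
  hopB :: "('k, 'u) hopf"
  phiB :: "('u \<times> 'u \<Rightarrow> 'k) set \<Rightarrow> 'u"

definition u_phi :: "('k, 'm) ring_scheme \<Rightarrow> ('k, 'u) hbrcd \<Rightarrow> 'u \<Rightarrow> 'u" where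
  "u_phi K X h = phiB X (tens K (hopH X) (hopB X) h \<one>\<^bsub>hopB X\<^esub>)"

definition Phi_B :: "('k, 'm) ring_scheme \<Rightarrow> ('k, 'u) hbrcd \<Rightarrow> ('u \<times> 'u \<Rightarrow> 'k) set \<Rightarrow> 'u" where
  "Phi_B K X t = (let H = hopH X; B = hopB X in
     tmult K B (tmap K B B (antipode B \<circ> u_phi K X) (phiB X)
       (tassoc K H H B (tmap K (tensor K H H) B (comul H) id t))))"

definition hopf_bracoid :: "('k, 'm) ring_scheme \<Rightarrow> ('k, 'u) hbrcd \<Rightarrow> bool" where
  "hopf_bracoid K X \<longleftrightarrow> (let H = hopH X; B = hopB X; \<phi> = phiB X in
     hopf_algebra K H \<and> hopf_algebra K B \<and>
     \<phi> \<in> lin_hom K (tensor K H B) B \<and>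
     (\<forall>b\<in>carrier B. \<phi> (tens K H B \<one>\<^bsub>H\<^esub> b) = b) \<and>
     (\<forall>h\<in>carrier H. \<forall>h'\<in>carrier H. \<forall>b\<in>carrier B.
        \<phi> (tens K H B (h \<otimes>\<^bsub>H\<^esub> h') b) = \<phi> (tens K H B h (\<phi> (tens K H B h' b)))) \<and>
     (\<forall>t\<in>carrier (tensor K H (tensor K B B)).
        \<phi> (tmap K H B id (tmult K B) t) =
        tmult K B (tmap K B B \<phi> (Phi_B K X)
          (tswap K H H B B (tmap K (tensor K H H) (tensor K B B) (comul H) id t)))))"

definition HBrcd_bar ::
  "('k, 'm) ring_scheme \<Rightarrow> (('k, 'u) hbrcd, ('u \<Rightarrow> 'u) \<times> ('u \<Rightarrow> 'u)) cat" where
  "HBrcd_bar K = \<lparr>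
     Obj = {X. hopf_bracoid K X \<and>
               phiB X \<in> coalg_hom K (tensor_coalg K (hopH X) (hopB X)) (hopB X)},
     Hom = (\<lambda>X Y. {(f, g).
        f \<in> hopf_hom K (hopH X) (hopH Y) \<and> g \<in> hopf_hom K (hopB X) (hopB Y) \<and>
        (\<forall>t\<in>carrier (tensor K (hopH X) (hopB X)).
           g (phiB X t) = phiB Y (tmap K (hopH Y) (hopB Y) f g t))}),
     Idn = (\<lambda>X. (\<lambda>x\<in>carrier (hopH X). x, \<lambda>b\<in>carrier (hopB X). b)),
     Comp = (\<lambda>X Y Z q p. (compose (carrier (hopH X)) (fst q) (fst p),
                          compose (carrier (hopB X)) (snd q) (snd p)))\<rparr>"

definition pointed_cosemisimple :: "('k, 'm) ring_scheme \<Rightarrow> ('k, 'u) hbrcd \<Rightarrow> bool" where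
  "pointed_cosemisimple K X \<longleftrightarrow>
     pointed K (hopH X) \<and> cosemisimple K (hopH X) \<and>
     pointed K (hopB X) \<and> cosemisimple K (hopB X)"


section \<open>Group Hopf algebras\<close>

text \<open>Both categories live over one type \<open>'u\<close>, which must therefore contain the elements of \<open>K[G]\<close>
  for groups \<open>G\<close> inside \<open>'u\<close>. This is provided by a map \<open>enc\<close>, injective on \<open>fin_supp K\<close>, that
  names every formal linear combination of elements of \<open>'u\<close> by an element of \<open>'u\<close>. Such \<open>'u\<close> and
  \<open>enc\<close> exist above every type of group elements:\<close>

datatype ('a, 'k) univ = Atom 'a | Comb "(('a, 'k) univ \<times> 'k) fset"

lemma universe_exists:
  fixes K :: "('k, 'm) ring_scheme"
  shows "\<exists>(e :: 'a \<Rightarrow> ('a, 'k) univ) (enc :: (('a, 'k) univ \<Rightarrow> 'k) \<Rightarrow> ('a, 'k) univ).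
           inj e \<and> inj_on enc (fin_supp K)"
proof (intro exI conjI)
  show "inj (Atom :: 'a \<Rightarrow> ('a, 'k) univ)"
    by (simp add: inj_def)
  let ?gr = "\<lambda>c :: ('a, 'k) univ \<Rightarrow> 'k. (\<lambda>x. (x, c x)) ` {x. c x \<noteq> \<zero>\<^bsub>K\<^esub>}"
  show "inj_on (\<lambda>c. Comb (Abs_fset (?gr c))) (fin_supp K)"
  proof (rule inj_onI)
    fix c d assume c: "c \<in> fin_supp K" and d: "d \<in> fin_supp K"
      and eq: "Comb (Abs_fset (?gr c)) = Comb (Abs_fset (?gr d))"
    have "finite (?gr c)" "finite (?gr d)"
      using c d by (auto simp: fin_supp_def)
    then have gr: "?gr c = ?gr d"
      using eq by (simp add: Abs_fset_inject)
    show "c = d"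
    proof
      fix x
      have "(x, c x) \<in> ?gr c \<longleftrightarrow> (x, c x) \<in> ?gr d" "(x, d x) \<in> ?gr c \<longleftrightarrow> (x, d x) \<in> ?gr d"
        using gr by auto
      then show "c x = d x" by auto
    qed
  qed
qed

definition gincl :: "('k, 'm) ring_scheme \<Rightarrow> (('u \<Rightarrow> 'k) \<Rightarrow> 'u) \<Rightarrow> 'u \<Rightarrow> 'u" where
  "gincl K enc x = enc (bvec K x)"

definition gcoeffs :: "('k, 'm) ring_scheme \<Rightarrow> (('u \<Rightarrow> 'k) \<Rightarrow> 'u) \<Rightarrow> 'u \<Rightarrow> 'u \<Rightarrow> 'k" where
  "gcoeffs K enc = inv_into (fin_supp K) enc"

definition gext ::
  "('k, 'm) ring_scheme \<Rightarrow> (('u \<Rightarrow> 'k) \<Rightarrow> 'u) \<Rightarrow> ('k, 'v, 'e) module_scheme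
     \<Rightarrow> ('u \<Rightarrow> 'v) \<Rightarrow> 'u \<Rightarrow> 'v" where
  "gext K enc V f X = lin_ext K V f (gcoeffs K enc X)"

definition galg ::
  "('k, 'm) ring_scheme \<Rightarrow> (('u \<Rightarrow> 'k) \<Rightarrow> 'u) \<Rightarrow> ('u, 'g) monoid_scheme \<Rightarrow> ('k, 'u) module" where
  "galg K enc G = (let F = free_mod K (carrier G) in
     \<lparr>carrier = enc ` carrier F,
      mult = (\<lambda>X Y. enc (lin_ext K F (\<lambda>x. lin_ext K F (\<lambda>y. bvec K (x \<otimes>\<^bsub>G\<^esub> y))
                (gcoeffs K enc Y)) (gcoeffs K enc X))),
      one = gincl K enc \<one>\<^bsub>G\<^esub>,
      zero = enc \<zero>\<^bsub>F\<^esub>,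
      add = (\<lambda>X Y. enc (gcoeffs K enc X \<oplus>\<^bsub>F\<^esub> gcoeffs K enc Y)),
      smult = (\<lambda>k X. enc (k \<odot>\<^bsub>F\<^esub> gcoeffs K enc X))\<rparr>)"

definition ghopf ::
  "('k, 'm) ring_scheme \<Rightarrow> (('u \<Rightarrow> 'k) \<Rightarrow> 'u) \<Rightarrow> ('u, 'g) monoid_scheme \<Rightarrow> ('k, 'u) hopf" where
  "ghopf K enc G = (let A = galg K enc G; i = gincl K enc in
     \<lparr>carrier = carrier A, mult = mult A, one = one A, zero = zero A, add = add A, smult = smult A,
      comul = gext K enc (tensor K A A) (\<lambda>x. tens K A A (i x) (i x)),
      counit = gext K enc (ground K) (\<lambda>x. \<one>\<^bsub>K\<^esub>),
      antipode = gext K enc A (\<lambda>x. i (inv\<^bsub>G\<^esub> x))\<rparr>)"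

definition ghopf_map ::
  "('k, 'm) ring_scheme \<Rightarrow> (('u \<Rightarrow> 'k) \<Rightarrow> 'u) \<Rightarrow> ('u, 'g) monoid_scheme \<Rightarrow> ('u, 'h) monoid_scheme
     \<Rightarrow> ('u \<Rightarrow> 'u) \<Rightarrow> 'u \<Rightarrow> 'u" where
  "ghopf_map K enc G G' f =
     restrict (gext K enc (galg K enc G') (\<lambda>x. gincl K enc (f x))) (carrier (galg K enc G))"

definition grouplikes ::
  "('k, 'm) ring_scheme \<Rightarrow> ('k, 'a, 'c) coalg_scheme \<Rightarrow> 'a monoid" where
  "grouplikes K X = \<lparr>carrier = {x \<in> carrier X. comul X x = tens K X X x x \<and> counit X x = \<one>\<^bsub>K\<^esub>},
                     mult = mult X, one = one X\<rparr>"


section \<open>The functors P and R\<close>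

definition P_obj ::
  "('k, 'm) ring_scheme \<Rightarrow> (('u \<Rightarrow> 'k) \<Rightarrow> 'u) \<Rightarrow> 'u skbrcd \<Rightarrow> ('k, 'u) hbrcd" where
  "P_obj K enc S = (let B = ghopf K enc (grpN S) in
     \<lparr>hopH = ghopf K enc (grpG S), hopB = B,
      phiB = tlift K B (\<lambda>X Y. gext K enc B (\<lambda>g. gext K enc B
               (\<lambda>n. gincl K enc (actn S g n)) Y) X)\<rparr>)"

definition P_functor ::
  "('k, 'm) ring_scheme \<Rightarrow> (('u \<Rightarrow> 'k) \<Rightarrow> 'u) \<Rightarrow>
   ('u skbrcd, ('u \<Rightarrow> 'u) \<times> ('u \<Rightarrow> 'u), ('k, 'u) hbrcd, ('u \<Rightarrow> 'u) \<times> ('u \<Rightarrow> 'u)) func" where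
  "P_functor K enc = \<lparr>FObj = P_obj K enc,
     FMap = (\<lambda>S T p. (ghopf_map K enc (grpG S) (grpG T) (fst p),
                      ghopf_map K enc (grpN S) (grpN T) (snd p)))\<rparr>"

definition R_obj :: "('k, 'm) ring_scheme \<Rightarrow> ('k, 'u) hbrcd \<Rightarrow> 'u skbrcd" where
  "R_obj K X =
     \<lparr>grpG = grouplikes K (hopH X), grpN = grouplikes K (hopB X),
      actn = (\<lambda>h. \<lambda>b\<in>carrier (grouplikes K (hopB X)). phiB X (tens K (hopH X) (hopB X) h b))\<rparr>"

definition R_functor ::
  "('k, 'm) ring_scheme \<Rightarrow>
   (('k, 'u) hbrcd, ('u \<Rightarrow> 'u) \<times> ('u \<Rightarrow> 'u), 'u skbrcd, ('u \<Rightarrow> 'u) \<times> ('u \<Rightarrow> 'u)) func" where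
  "R_functor K = \<lparr>FObj = R_obj K,
     FMap = (\<lambda>X Y p. (restrict (fst p) (carrier (grouplikes K (hopH X))),
                      restrict (snd p) (carrier (grouplikes K (hopB X)))))\<rparr>"

text \<open>\<open>(p, q) \<mapsto> (p|\<^sub>G, q|\<^sub>N)\<close>, where \<open>G\<close> sits in \<open>K[G]\<close> via \<open>gincl\<close>.\<close>

definition PR_bij ::
  "('k, 'm) ring_scheme \<Rightarrow> (('u \<Rightarrow> 'k) \<Rightarrow> 'u) \<Rightarrow> 'u skbrcd \<Rightarrow> ('k, 'u) hbrcd
     \<Rightarrow> ('u \<Rightarrow> 'u) \<times> ('u \<Rightarrow> 'u) \<Rightarrow> ('u \<Rightarrow> 'u) \<times> ('u \<Rightarrow> 'u)" where
  "PR_bij K enc S X p = (\<lambda>x\<in>carrier (grpG S). fst p (gincl K enc x),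
                         \<lambda>n\<in>carrier (grpN S). snd p (gincl K enc n))"

end

theory Submission
  imports Defs
begin

text \<open>Linear maps on \<open>K[G]\<close> and on tensor products of group algebras are determined by their values
  on group elements, so the identities for \<open>P\<close> and for the adjunction reduce to identities between
  group elements.

  Let a coalgebra have a basis \<open>S\<close> of group-like elements with coordinate functions \<open>M\<^sub>s\<close>. Then
  \<open>(M\<^sub>s \<otimes> id)(\<delta> x) = M\<^sub>s(x) s\<close> for all \<open>x\<close>, as it suffices to check this on \<open>S\<close>. For group-like \<open>x\<close>
  the left side is \<open>M\<^sub>s(x) x\<close>, so \<open>x \<in> S\<close>; for \<open>x\<close> in a subcoalgebra \<open>D\<close> it lies in \<open>D\<close>, so a nonzero \<open>D\<close>
  contains some \<open>s \<in> S\<close>. Hence the group-like elements of \<open>K[G]\<close> are those of \<open>G\<close>, which makes the unit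
  an isomorphism, and \<open>K[G]\<close> is pointed and cosemisimple. Conversely, a pointed cosemisimple
  Hopf algebra \<open>H\<close> is spanned by its group-like elements. A maximal linearly independent set of
  them is a basis, so it consists of all of them, and the counit \<open>K[G(H)] \<rightarrow> H\<close> is bijective.\<close>

section \<open>Linear maps and spans\<close>

text \<open>The formal obstacle is choice. An element of a tensor product is a coset, and
  \<open>tlift\<close> and the product of \<open>tensor\<close> evaluate on a representative picked
  by \<open>SOME\<close>; an element of a group algebra is a code that \<open>gcoeffs\<close> has to
  decode. Both are meaningful only through bilinearity, respectively injectivity of
  \<open>enc\<close>, so each nested construction (associator, flip, products, the action of
  \<open>P\<close>) comes with a proof that it is linear in every variable.

  The coordinate functions act as dual functionals. Applying one of them to a single tensor leg
  extracts what is needed from a coproduct, so linear independence of pure tensors in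
  \<open>C \<otimes> C\<close> never has to be established. Zorn's lemma supplies the coordinates in
  any dimension.

  The equivalence itself is formal: it needs a unit that is invertible everywhere, a counit that is
  invertible on a full subcategory, and an image of \<open>P\<close> inside that subcategory.
  Spanning by group-like elements is what the counit needs; the lines through group elements are
  what puts \<open>K[G]\<close> into the subcategory.\<close>

lemma finsum_struct_cong:
  assumes "carrier V = carrier W" "add V = add W" "zero V = zero W"
  shows "finsum V f A = finsum W f A"
  using assms by (simp add: finsum_def finprod_def)

lemma lin_homI:
  assumes "\<And>x. x \<in> carrier V \<Longrightarrow> f x \<in> carrier W"
    and "\<And>x y. x \<in> carrier V \<Longrightarrow> y \<in> carrier V \<Longrightarrow> f (x \<oplus>\<^bsub>V\<^esub> y) = f x \<oplus>\<^bsub>W\<^esub> f y"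
    and "\<And>k x. k \<in> carrier K \<Longrightarrow> x \<in> carrier V \<Longrightarrow> f (k \<odot>\<^bsub>V\<^esub> x) = k \<odot>\<^bsub>W\<^esub> f x"
  shows "f \<in> lin_hom K V W"
  using assms by (auto simp: lin_hom_def)

lemma lin_hom_closed: "f \<in> lin_hom K V W \<Longrightarrow> x \<in> carrier V \<Longrightarrow> f x \<in> carrier W"
  by (auto simp: lin_hom_def)

lemma lin_hom_add:
  "f \<in> lin_hom K V W \<Longrightarrow> x \<in> carrier V \<Longrightarrow> y \<in> carrier V \<Longrightarrow> f (x \<oplus>\<^bsub>V\<^esub> y) = f x \<oplus>\<^bsub>W\<^esub> f y"
  by (auto simp: lin_hom_def)

lemma lin_hom_smult:
  "f \<in> lin_hom K V W \<Longrightarrow> k \<in> carrier K \<Longrightarrow> x \<in> carrier V \<Longrightarrow> f (k \<odot>\<^bsub>V\<^esub> x) = k \<odot>\<^bsub>W\<^esub> f x"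
  by (auto simp: lin_hom_def)

lemma lin_hom_id: "id \<in> lin_hom K V V"
  by (auto simp: lin_hom_def)

lemma lin_hom_ident: "(\<lambda>x. x) \<in> lin_hom K V V"
  by (auto simp: lin_hom_def)

lemma lin_hom_comp:
  "f \<in> lin_hom K V W \<Longrightarrow> g \<in> lin_hom K W U \<Longrightarrow> (\<lambda>x. g (f x)) \<in> lin_hom K V U"
  by (auto simp: lin_hom_def Pi_iff)

lemma lin_hom_cong:
  assumes "f \<in> lin_hom K V W" "module K V" "\<And>x. x \<in> carrier V \<Longrightarrow> g x = f x"
  shows "g \<in> lin_hom K V W"
proof -
  interpret V: module K V by fact
  show ?thesis using assms(1,3) by (auto simp: lin_hom_def)
qed

lemma lin_hom_restrict:
  "f \<in> lin_hom K V W \<Longrightarrow> module K V \<Longrightarrow> restrict f (carrier V) \<in> lin_hom K V W"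
  by (erule lin_hom_cong) auto

lemma lin_hom_struct_cong:
  assumes "carrier V = carrier V'" "add V = add V'" "smult V = smult V'"
    and "carrier W = carrier W'" "add W = add W'" "smult W = smult W'"
  shows "lin_hom K V W = lin_hom K V' W'"
  using assms by (simp add: lin_hom_def)

lemma lin_hom_smult_left:
  assumes "module K V" "f \<in> lin_hom K V W" "module K W" "k \<in> carrier K"
  shows "(\<lambda>x. k \<odot>\<^bsub>W\<^esub> f x) \<in> lin_hom K V W"
proof -
  interpret V: module K V by fact
  interpret W: module K W by fact
  show ?thesis using assms
    by (auto intro!: lin_homI simp: lin_hom_closed lin_hom_add lin_hom_smult W.smult_r_distr
        W.smult_assoc1[symmetric] V.m_comm)
qed

lemma lin_hom_zero:
  assumes "module K V" "module K W" "f \<in> lin_hom K V W"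
  shows "f \<zero>\<^bsub>V\<^esub> = \<zero>\<^bsub>W\<^esub>"
proof -
  interpret V: module K V by fact
  interpret W: module K W by fact
  have "f (\<zero>\<^bsub>K\<^esub> \<odot>\<^bsub>V\<^esub> \<zero>\<^bsub>V\<^esub>) = \<zero>\<^bsub>K\<^esub> \<odot>\<^bsub>W\<^esub> f \<zero>\<^bsub>V\<^esub>"
    using assms(3) by (intro lin_hom_smult) auto
  then show ?thesis using lin_hom_closed[OF assms(3)] by simp
qed

text \<open>The module laws are equations between images of elements of \<open>F\<close>, so they
  pass to a surjective image whose operations are induced along \<open>q\<close>. This gives both
  the quotient by the bilinearity relations, with \<open>q\<close> the class map, and the encoded
  group algebra, with \<open>q\<close> equal to \<open>enc\<close>.\<close>

lemma module_image:
  assumes "module K F" and carr: "carrier T = q ` carrier F" and zero: "\<zero>\<^bsub>T\<^esub> = q \<zero>\<^bsub>F\<^esub>"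
    and add: "\<And>c d. c \<in> carrier F \<Longrightarrow> d \<in> carrier F \<Longrightarrow> q c \<oplus>\<^bsub>T\<^esub> q d = q (c \<oplus>\<^bsub>F\<^esub> d)"
    and smult: "\<And>k c. k \<in> carrier K \<Longrightarrow> c \<in> carrier F \<Longrightarrow> k \<odot>\<^bsub>T\<^esub> q c = q (k \<odot>\<^bsub>F\<^esub> c)"
  shows "module K T"
proof -
  interpret F: module K F by fact
  note S = zero add smult
  have carrE: "\<exists>c\<in>carrier F. X = q c" if "X \<in> carrier T" for X
    using that carr by auto
  have I: "q c \<in> carrier T" if "c \<in> carrier F" for c
    using that carr by simp
  show ?thesis
  proof (rule moduleI)
    show "cring K" by (rule F.R.is_cring)
    show "abelian_group T"
    proof (rule abelian_groupI)
      fix X assume "X \<in> carrier T"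
      then obtain c where c: "c \<in> carrier F" "X = q c" using carrE by blast
      show "\<zero>\<^bsub>T\<^esub> \<oplus>\<^bsub>T\<^esub> X = X" using c by (simp add: S)
      show "\<exists>Y\<in>carrier T. Y \<oplus>\<^bsub>T\<^esub> X = \<zero>\<^bsub>T\<^esub>"
        by (rule bexI[of _ "q (\<ominus>\<^bsub>F\<^esub> c)"]) (use c in \<open>simp_all add: S I F.l_neg\<close>)
      fix Y assume "Y \<in> carrier T"
      then obtain d where d: "d \<in> carrier F" "Y = q d" using carrE by blast
      show "X \<oplus>\<^bsub>T\<^esub> Y \<in> carrier T" "X \<oplus>\<^bsub>T\<^esub> Y = Y \<oplus>\<^bsub>T\<^esub> X" using c d by (simp_all add: S I F.a_comm)
      fix Z assume "Z \<in> carrier T"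
      then obtain e where e: "e \<in> carrier F" "Z = q e" using carrE by blast
      show "X \<oplus>\<^bsub>T\<^esub> Y \<oplus>\<^bsub>T\<^esub> Z = X \<oplus>\<^bsub>T\<^esub> (Y \<oplus>\<^bsub>T\<^esub> Z)" using c d e by (simp add: S F.a_assoc)
    qed (simp add: S I)
    fix X assume "X \<in> carrier T"
    then obtain c where c: "c \<in> carrier F" "X = q c" using carrE by blast
    show "\<one>\<^bsub>K\<^esub> \<odot>\<^bsub>T\<^esub> X = X" using c by (simp add: S)
    fix k assume k: "k \<in> carrier K"
    show "k \<odot>\<^bsub>T\<^esub> X \<in> carrier T" using c k by (simp add: S I)
    {
      fix l assume "l \<in> carrier K"
      then show "(k \<oplus>\<^bsub>K\<^esub> l) \<odot>\<^bsub>T\<^esub> X = k \<odot>\<^bsub>T\<^esub> X \<oplus>\<^bsub>T\<^esub> l \<odot>\<^bsub>T\<^esub> X"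
        "(k \<otimes>\<^bsub>K\<^esub> l) \<odot>\<^bsub>T\<^esub> X = k \<odot>\<^bsub>T\<^esub> (l \<odot>\<^bsub>T\<^esub> X)"
        using c k by (simp_all add: S F.smult_l_distr F.smult_assoc1)
    next
      fix Y assume "Y \<in> carrier T"
      then obtain d where d: "d \<in> carrier F" "Y = q d" using carrE by blast
      show "k \<odot>\<^bsub>T\<^esub> (X \<oplus>\<^bsub>T\<^esub> Y) = k \<odot>\<^bsub>T\<^esub> X \<oplus>\<^bsub>T\<^esub> k \<odot>\<^bsub>T\<^esub> Y"
        using c d k by (simp add: S F.smult_r_distr)
    }
  qed
qed

lemma submodule_line:
  assumes "module K V" "v \<in> carrier V"
  shows "submodule {k \<odot>\<^bsub>V\<^esub> v | k. k \<in> carrier K} K V" (is "submodule ?L K V")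
proof -
  interpret V: module K V by fact
  note v = assms(2)
  show ?thesis
  proof (rule V.submoduleI)
    show "\<zero>\<^bsub>V\<^esub> \<in> ?L" using v by (auto intro!: exI[of _ "\<zero>\<^bsub>K\<^esub>"])
    show "\<ominus>\<^bsub>V\<^esub> a \<in> ?L" if "a \<in> ?L" for a
      using that v by (auto simp: V.smult_l_minus[symmetric])
    show "a \<oplus>\<^bsub>V\<^esub> b \<in> ?L" if "a \<in> ?L" "b \<in> ?L" for a b
      using that v by (auto simp: V.smult_l_distr[symmetric])
    show "k \<odot>\<^bsub>V\<^esub> a \<in> ?L" if "k \<in> carrier K" "a \<in> ?L" for k a
      using that v by (auto simp: V.smult_assoc1[symmetric])
  qed (use v in auto)
qed

section \<open>Spans, and linear maps determined on spanning sets\<close>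

lemma lin_span_submodule:
  assumes "module K V" "S \<subseteq> carrier V"
  shows "submodule (lin_span K V S) K V"
proof -
  interpret V: module K V by fact
  let ?F = "{W. submodule W K V \<and> S \<subseteq> W}"
  have car: "carrier V \<in> ?F" using V.carrier_is_submodule assms by auto
  note E = V.submoduleE
  show ?thesis unfolding lin_span_def
  proof (rule V.submoduleI)
    show "\<Inter>?F \<subseteq> carrier V" using car by auto
    show "\<zero>\<^bsub>V\<^esub> \<in> \<Inter>?F"
      using subgroup.one_closed[OF submodule.axioms(1)] by fastforce
  qed (use E in auto)
qed

lemma lin_span_incl: "S \<subseteq> lin_span K V S"
  by (auto simp: lin_span_def)

lemma lin_span_least: "submodule W K V \<Longrightarrow> S \<subseteq> W \<Longrightarrow> lin_span K V S \<subseteq> W"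
  by (auto simp: lin_span_def)

lemma lin_span_mono: "S \<subseteq> S' \<Longrightarrow> lin_span K V S \<subseteq> lin_span K V S'"
  by (auto simp: lin_span_def)

lemma lin_span_carrier:
  "module K V \<Longrightarrow> S \<subseteq> carrier V \<Longrightarrow> lin_span K V S \<subseteq> carrier V"
  by (simp add: lin_span_least module.carrier_is_submodule)

lemma lin_span_zero:
  assumes "module K V" "S \<subseteq> carrier V" shows "\<zero>\<^bsub>V\<^esub> \<in> lin_span K V S"
  using subgroup.one_closed[OF submodule.axioms(1)[OF lin_span_submodule[OF assms]]] by simp

text \<open>The members of the span with property \<open>P\<close> form a submodule containing
  \<open>S\<close>, and the span is the least such. Membership in the span stays available in the
  inductive cases, which supplies the carrier conditions there.\<close>

lemma lin_span_induct [consumes 3, case_names base zero add smult]: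
  assumes "x \<in> lin_span K V S" "module K V" "S \<subseteq> carrier V"
    and base: "\<And>x. x \<in> S \<Longrightarrow> P x"
    and zero: "P \<zero>\<^bsub>V\<^esub>"
    and add: "\<And>x y. x \<in> lin_span K V S \<Longrightarrow> y \<in> lin_span K V S \<Longrightarrow> P x \<Longrightarrow> P y \<Longrightarrow> P (x \<oplus>\<^bsub>V\<^esub> y)"
    and smult: "\<And>k x. k \<in> carrier K \<Longrightarrow> x \<in> lin_span K V S \<Longrightarrow> P x \<Longrightarrow> P (k \<odot>\<^bsub>V\<^esub> x)"
  shows "P x"
proof -
  interpret V: module K V by fact
  note sub = lin_span_submodule[OF assms(2,3)]
  note E = V.submoduleE[OF sub]
  have "submodule {x \<in> lin_span K V S. P x} K V"
  proof (rule V.submoduleI)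
    fix a assume "a \<in> {x \<in> lin_span K V S. P x}"
    then have a: "a \<in> lin_span K V S" "P a" by auto
    \<comment> \<open>Closure under negation is the case \<open>smult\<close> for the scalar
      -1.\<close>
    have "\<ominus>\<^bsub>V\<^esub> a = (\<ominus>\<^bsub>K\<^esub> \<one>\<^bsub>K\<^esub>) \<odot>\<^bsub>V\<^esub> a"
      using a E(1) by (auto simp: V.smult_l_minus)
    then show "\<ominus>\<^bsub>V\<^esub> a \<in> {x \<in> lin_span K V S. P x}"
      using a E smult[of "\<ominus>\<^bsub>K\<^esub> \<one>\<^bsub>K\<^esub>" a] by auto
  qed (use E assms(4-7) lin_span_zero[OF assms(2,3)] in auto)
  then have "lin_span K V S \<subseteq> {x \<in> lin_span K V S. P x}"
    by (rule lin_span_least) (use base lin_span_incl[of S] in auto)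
  then show ?thesis using assms(1) by auto
qed

text \<open>Agreement of two linear maps survives sums and multiples. This is the reason why almost
  every identity below is tested on generators only.\<close>

lemma lin_hom_eq_on_span:
  assumes "module K V" "module K W" "f \<in> lin_hom K V W" "g \<in> lin_hom K V W"
    and S: "S \<subseteq> carrier V" and eq: "\<And>x. x \<in> S \<Longrightarrow> f x = g x" and "x \<in> lin_span K V S"
  shows "f x = g x"
  using assms(7,1) S
proof (induction rule: lin_span_induct)
  case zero
  then show ?case using assms lin_hom_zero by metis
next
  case (add x y)
  then show ?case using lin_span_carrier[OF assms(1) S] lin_hom_add[OF assms(3)] lin_hom_add[OF assms(4)]
    by (simp add: subset_iff)
next
  case (smult k x)
  then show ?case using lin_span_carrier[OF assms(1) S] lin_hom_smult[OF assms(3)] lin_hom_smult[OF assms(4)]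
    by (simp add: subset_iff)
qed (use eq in auto)

lemma lin_hom_image_span:
  assumes "module K V" "module K W" "f \<in> lin_hom K V W" "S \<subseteq> carrier V" "x \<in> lin_span K V S"
    "submodule D K W" "f ` S \<subseteq> D"
  shows "f x \<in> D"
  using assms(5,1,4)
proof (induction rule: lin_span_induct)
  interpret W: module K W by fact
  note E = W.submoduleE[OF assms(6)]
  note c = lin_span_carrier[OF assms(1,4)]
  {
    case zero
    then show ?case using lin_hom_zero[OF assms(1-3)]
        subgroup.one_closed[OF submodule.axioms(1)[OF assms(6)]] by simp
  next
    case (add x y)
    then show ?case using c E lin_hom_add[OF assms(3)] by (simp add: subset_iff)
  next
    case (smult k x)
    then show ?case using c E lin_hom_smult[OF assms(3)] by (simp add: subset_iff)
  }
qed (use assms in auto)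

text \<open>A surjective linear map carries generators to generators. Basis vectors of a free space
  thereby become the pure tensors of a tensor product and the group elements of a group
  algebra.\<close>

lemma lin_span_eq_carrier_image:
  assumes "module K V" "module K W" "f \<in> lin_hom K V W" "f ` carrier V = carrier W"
    "S \<subseteq> carrier V" "carrier V = lin_span K V S"
  shows "carrier W = lin_span K W (f ` S)"
proof
  have fS: "f ` S \<subseteq> carrier W" using assms by auto
  show "lin_span K W (f ` S) \<subseteq> carrier W" by (rule lin_span_carrier[OF assms(2) fS])
  show "carrier W \<subseteq> lin_span K W (f ` S)"
  proof
    fix y assume "y \<in> carrier W"
    then obtain x where "x \<in> carrier V" "y = f x" using assms(4) by auto
    then show "y \<in> lin_span K W (f ` S)"
      using lin_hom_image_span[OF assms(1-3,5) _ lin_span_submodule[OF assms(2) fS] lin_span_incl] assms(6)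
      by auto
  qed
qed


section \<open>Free vector spaces\<close>

locale base_field =
  fixes K :: "('k, 'm) ring_scheme"
  assumes field_K: "field K"
begin

sublocale K: field K
  by (rule field_K)

lemma smult_inverse:
  assumes "module K V" "a \<in> carrier K" "a \<noteq> \<zero>\<^bsub>K\<^esub>" "x \<in> carrier V"
  shows "inv\<^bsub>K\<^esub> a \<in> carrier K" "inv\<^bsub>K\<^esub> a \<odot>\<^bsub>V\<^esub> (a \<odot>\<^bsub>V\<^esub> x) = x"
proof -
  interpret V: module K V by fact
  have a: "inv\<^bsub>K\<^esub> a \<in> carrier K" "inv\<^bsub>K\<^esub> a \<otimes>\<^bsub>K\<^esub> a = \<one>\<^bsub>K\<^esub>"
    using assms(2,3) K.field_Units by auto
  then show "inv\<^bsub>K\<^esub> a \<in> carrier K" "inv\<^bsub>K\<^esub> a \<odot>\<^bsub>V\<^esub> (a \<odot>\<^bsub>V\<^esub> x) = x"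
    using assms by (simp_all add: V.smult_assoc1[symmetric])
qed

lemma module_ground: "module K (ground K)"
  by (rule moduleI) (auto simp: ground_def K.l_distr K.r_distr K.m_assoc K.is_cring
      intro!: abelian_groupI K.a_assoc K.a_comm K.add.l_inv_ex)

lemma free_mod_simps [simp]:
  "zero (free_mod K S) = (\<lambda>x. \<zero>\<^bsub>K\<^esub>)"
  "add (free_mod K S) = (\<lambda>c d x. c x \<oplus>\<^bsub>K\<^esub> d x)"
  "smult (free_mod K S) = (\<lambda>k c x. k \<otimes>\<^bsub>K\<^esub> c x)"
  by (simp_all add: free_mod_def)

lemma free_mod_carrier:
  "c \<in> carrier (free_mod K S) \<longleftrightarrow>
     (\<forall>x. c x \<in> carrier K) \<and> finite {x. c x \<noteq> \<zero>\<^bsub>K\<^esub>} \<and> {x. c x \<noteq> \<zero>\<^bsub>K\<^esub>} \<subseteq> S"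
  by (auto simp: free_mod_def fin_supp_def)

lemma free_mod_carrierI:
  assumes "\<And>x. c x \<in> carrier K" "finite A" "A \<subseteq> S" "\<And>x. x \<notin> A \<Longrightarrow> c x = \<zero>\<^bsub>K\<^esub>"
  shows "c \<in> carrier (free_mod K S)"
proof -
  have "{x. c x \<noteq> \<zero>\<^bsub>K\<^esub>} \<subseteq> A" using assms(4) by auto
  then show ?thesis using assms(1-3) by (auto simp: free_mod_carrier intro: finite_subset)
qed

lemma module_free_mod: "module K (free_mod K S)"
proof (rule moduleI)
  show "abelian_group (free_mod K S)"
  proof (rule abelian_groupI)
    fix c d assume cd: "c \<in> carrier (free_mod K S)" "d \<in> carrier (free_mod K S)"
    show "c \<oplus>\<^bsub>free_mod K S\<^esub> d \<in> carrier (free_mod K S)"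
      by (rule free_mod_carrierI[where A = "{x. c x \<noteq> \<zero>\<^bsub>K\<^esub>} \<union> {x. d x \<noteq> \<zero>\<^bsub>K\<^esub>}"])
        (use cd in \<open>auto simp: free_mod_carrier\<close>)
  next
    fix c assume c: "c \<in> carrier (free_mod K S)"
    show "\<exists>y\<in>carrier (free_mod K S). y \<oplus>\<^bsub>free_mod K S\<^esub> c = \<zero>\<^bsub>free_mod K S\<^esub>"
      by (rule bexI[of _ "\<lambda>x. \<ominus>\<^bsub>K\<^esub> c x"])
        (use c in \<open>auto simp: free_mod_carrier K.l_neg
          intro!: free_mod_carrierI[where A = "{x. c x \<noteq> \<zero>\<^bsub>K\<^esub>}"]\<close>)
  next
    show "\<zero>\<^bsub>free_mod K S\<^esub> \<in> carrier (free_mod K S)"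
      by (auto simp: free_mod_carrier)
  qed (auto simp: free_mod_carrier K.a_ac fun_eq_iff)
next
  fix k c assume "k \<in> carrier K" "c \<in> carrier (free_mod K S)"
  then show "k \<odot>\<^bsub>free_mod K S\<^esub> c \<in> carrier (free_mod K S)"
    by (intro free_mod_carrierI[where A = "{x. c x \<noteq> \<zero>\<^bsub>K\<^esub>}"]) (auto simp: free_mod_carrier)
qed (auto simp: free_mod_carrier K.l_distr K.r_distr K.m_assoc K.is_cring)

lemma bvec_closed [simp]: "x \<in> S \<Longrightarrow> bvec K x \<in> carrier (free_mod K S)"
  by (rule free_mod_carrierI[where A = "{x}"]) (auto simp: bvec_def)

lemma free_mod_span: "carrier (free_mod K S) = lin_span K (free_mod K S) (bvec K ` S)"
proof
  interpret F: module K "free_mod K S" by (rule module_free_mod)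
  let ?L = "lin_span K (free_mod K S) (bvec K ` S)"
  have bS: "bvec K ` S \<subseteq> carrier (free_mod K S)" by auto
  note sub = lin_span_submodule[OF module_free_mod bS]
  note E = F.submoduleE[OF sub]
  show "?L \<subseteq> carrier (free_mod K S)" by (rule lin_span_carrier[OF module_free_mod bS])
  \<comment> \<open>\<open>A\<close> only bounds the support of \<open>c\<close>, so the induction
    may set the entry at \<open>a\<close> to zero and continue with the smaller set.\<close>
  have "c \<in> ?L" if "finite A" "A \<subseteq> S" "\<And>x. c x \<in> carrier K" "\<And>x. x \<notin> A \<Longrightarrow> c x = \<zero>\<^bsub>K\<^esub>" for A c
    using that
  proof (induction A arbitrary: c rule: finite_induct)
    case empty
    then have "c = \<zero>\<^bsub>free_mod K S\<^esub>" by auto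
    then show ?case using lin_span_zero[OF module_free_mod bS] by simp
  next
    case (insert a A)
    have 1: "c(a := \<zero>\<^bsub>K\<^esub>) \<in> ?L" by (rule insert.IH) (use insert.prems in auto)
    have 2: "bvec K a \<in> ?L" using insert.prems(1) lin_span_incl[of "bvec K ` S"] by auto
    have "c = (c a \<odot>\<^bsub>free_mod K S\<^esub> bvec K a) \<oplus>\<^bsub>free_mod K S\<^esub> c(a := \<zero>\<^bsub>K\<^esub>)"
      using insert.prems by (auto simp: bvec_def)
    moreover have "c a \<odot>\<^bsub>free_mod K S\<^esub> bvec K a \<in> ?L"
      by (rule E(4)) (use insert.prems 2 in auto)
    ultimately show ?case using 1 E(5) by metis
  qed
  then show "carrier (free_mod K S) \<subseteq> ?L"
    unfolding subset_iff free_mod_carrier by blast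
qed

lemma free_mod_hom_eq:
  assumes "module K W" "f \<in> lin_hom K (free_mod K S) W" "g \<in> lin_hom K (free_mod K S) W"
    "\<And>x. x \<in> S \<Longrightarrow> f (bvec K x) = g (bvec K x)" "c \<in> carrier (free_mod K S)"
  shows "f c = g c"
  by (rule lin_hom_eq_on_span[OF module_free_mod assms(1-3), where S = "bvec K ` S"])
    (use assms(4,5) free_mod_span in auto)

text \<open>\<open>lin_ext\<close> sums over the exact support, which varies with \<open>c\<close>.
  Further indices contribute zero, so sums for different combinations can be taken over one common
  finite set.\<close>

lemma lin_ext_superset:
  assumes "module K V" "finite A" "{x. c x \<noteq> \<zero>\<^bsub>K\<^esub>} \<subseteq> A" "\<And>x. c x \<in> carrier K"
    "f \<in> A \<rightarrow> carrier V"
  shows "lin_ext K V f c = finsum V (\<lambda>x. c x \<odot>\<^bsub>V\<^esub> f x) A"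
proof -
  interpret V: module K V by fact
  show ?thesis unfolding lin_ext_def
    by (rule V.add.finprod_mono_neutral_cong_left) (use assms in \<open>auto simp: Pi_iff\<close>)
qed

lemma lin_ext_hom:
  assumes "module K V" "f \<in> S \<rightarrow> carrier V"
  shows "lin_ext K V f \<in> lin_hom K (free_mod K S) V"
proof (rule lin_homI)
  interpret V: module K V by fact
  fix c assume c: "c \<in> carrier (free_mod K S)"
  let ?A = "{x. c x \<noteq> \<zero>\<^bsub>K\<^esub>}"
  have cV: "(\<lambda>x. c x \<odot>\<^bsub>V\<^esub> f x) \<in> ?A \<rightarrow> carrier V"
    using c assms(2) by (auto simp: free_mod_carrier)
  then show "lin_ext K V f c \<in> carrier V"
    unfolding lin_ext_def by (rule V.finsum_closed)
  {
    fix d assume d: "d \<in> carrier (free_mod K S)"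
    \<comment> \<open>The support of a sum can shrink by cancellation; the union of the two supports
      serves all three sums.\<close>
    let ?B = "?A \<union> {x. d x \<noteq> \<zero>\<^bsub>K\<^esub>}"
    have B: "finite ?B" "?B \<subseteq> S" using c d by (auto simp: free_mod_carrier)
    have fB: "f \<in> ?B \<rightarrow> carrier V" using B assms(2) by auto
    have cd: "c x \<in> carrier K" "d x \<in> carrier K" for x using c d by (auto simp: free_mod_carrier)
    have "lin_ext K V f (c \<oplus>\<^bsub>free_mod K S\<^esub> d) = finsum V (\<lambda>x. (c x \<oplus>\<^bsub>K\<^esub> d x) \<odot>\<^bsub>V\<^esub> f x) ?B"
      by (subst lin_ext_superset[OF assms(1) B(1) _ _ fB]) (auto simp: cd)
    also have "\<dots> = finsum V (\<lambda>x. c x \<odot>\<^bsub>V\<^esub> f x \<oplus>\<^bsub>V\<^esub> d x \<odot>\<^bsub>V\<^esub> f x) ?B"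
      by (rule V.finsum_cong') (use cd fB in \<open>auto simp: V.smult_l_distr Pi_iff\<close>)
    also have "\<dots> = finsum V (\<lambda>x. c x \<odot>\<^bsub>V\<^esub> f x) ?B \<oplus>\<^bsub>V\<^esub> finsum V (\<lambda>x. d x \<odot>\<^bsub>V\<^esub> f x) ?B"
      by (rule V.finsum_addf) (use cd fB in \<open>auto simp: Pi_iff\<close>)
    also have "\<dots> = lin_ext K V f c \<oplus>\<^bsub>V\<^esub> lin_ext K V f d"
      by (subst (1 2) lin_ext_superset[OF assms(1) B(1) _ _ fB]) (auto simp: cd)
    finally show "lin_ext K V f (c \<oplus>\<^bsub>free_mod K S\<^esub> d) = lin_ext K V f c \<oplus>\<^bsub>V\<^esub> lin_ext K V f d" .
  next
    fix k assume k: "k \<in> carrier K"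
    have A: "finite ?A" "?A \<subseteq> S" using c by (auto simp: free_mod_carrier)
    have fA: "f \<in> ?A \<rightarrow> carrier V" using A assms(2) by auto
    have cK: "c x \<in> carrier K" for x using c by (auto simp: free_mod_carrier)
    have "lin_ext K V f (k \<odot>\<^bsub>free_mod K S\<^esub> c) = finsum V (\<lambda>x. (k \<otimes>\<^bsub>K\<^esub> c x) \<odot>\<^bsub>V\<^esub> f x) ?A"
      by (subst lin_ext_superset[OF assms(1) A(1) _ _ fA]) (use k cK in auto)
    also have "\<dots> = finsum V (\<lambda>x. k \<odot>\<^bsub>V\<^esub> (c x \<odot>\<^bsub>V\<^esub> f x)) ?A"
      by (rule V.finsum_cong') (use k cK fA in \<open>auto simp: V.smult_assoc1 Pi_iff\<close>)
    also have "\<dots> = k \<odot>\<^bsub>V\<^esub> lin_ext K V f c"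
      unfolding lin_ext_def by (rule V.finsum_smult_ldistr[symmetric]) (use A k cV in auto)
    finally show "lin_ext K V f (k \<odot>\<^bsub>free_mod K S\<^esub> c) = k \<odot>\<^bsub>V\<^esub> lin_ext K V f c" .
  }
qed

lemma lin_ext_bvec:
  assumes "module K V" "f x \<in> carrier V"
  shows "lin_ext K V f (bvec K x) = f x"
proof -
  interpret V: module K V by fact
  have "lin_ext K V f (bvec K x) = finsum V (\<lambda>y. bvec K x y \<odot>\<^bsub>V\<^esub> f y) {x}"
    by (rule lin_ext_superset) (use assms in \<open>auto simp: bvec_def\<close>)
  also have "\<dots> = f x" using assms by (simp add: bvec_def)
  finally show ?thesis .
qed

text \<open>Uniqueness in the universal property of the free space. That \<open>f\<close> takes
  values in \<open>V\<close> on \<open>S\<close> follows from its agreement with \<open>L\<close>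
  there.\<close>

lemma lin_ext_unique:
  assumes "module K V" "L \<in> lin_hom K (free_mod K S) V" "c \<in> carrier (free_mod K S)"
    and "\<And>x. x \<in> S \<Longrightarrow> L (bvec K x) = f x"
  shows "lin_ext K V f c = L c"
proof -
  have f: "f x \<in> carrier V" if "x \<in> S" for x
    using that assms(4)[OF that, symmetric] lin_hom_closed[OF assms(2)] by simp
  show ?thesis
    by (rule free_mod_hom_eq[OF assms(1) lin_ext_hom assms(2) _ assms(3)])
      (use f assms in \<open>auto simp: lin_ext_bvec\<close>)
qed

lemma lin_ext_cong:
  assumes "module K V" "c \<in> carrier (free_mod K S)" "\<And>x. x \<in> S \<Longrightarrow> f x = g x" "g \<in> S \<rightarrow> carrier V"
  shows "lin_ext K V f c = lin_ext K V g c"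
proof (rule lin_ext_unique[OF assms(1) lin_ext_hom[OF assms(1,4)] assms(2)])
  fix x assume "x \<in> S"
  then show "lin_ext K V g (bvec K x) = f x"
    using assms(3,4) by (auto intro!: lin_ext_bvec[OF assms(1)])
qed

text \<open>Both sides are linear in \<open>c\<close> and agree on basis vectors. The products of
  \<open>tensor\<close> and \<open>galg\<close> are defined by nested \<open>lin_ext\<close> in a
  free space; this lemma moves \<open>tclass\<close> and \<open>enc\<close> inside them.\<close>

lemma lin_hom_lin_ext:
  assumes "module K V" "module K W" "L \<in> lin_hom K V W" "f \<in> S \<rightarrow> carrier V"
    "c \<in> carrier (free_mod K S)"
  shows "L (lin_ext K V f c) = lin_ext K W (\<lambda>x. L (f x)) c"
proof (rule lin_ext_unique[OF assms(2) _ assms(5), symmetric])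
  show "(\<lambda>c. L (lin_ext K V f c)) \<in> lin_hom K (free_mod K S) W"
    by (rule lin_hom_comp[OF lin_ext_hom[OF assms(1,4)] assms(3)])
next
  fix x assume "x \<in> S"
  then show "L (lin_ext K V f (bvec K x)) = L (f x)"
    using assms(4) by (simp add: lin_ext_bvec[OF assms(1)] Pi_iff)
qed

declare free_mod_simps [simp del]

end

section \<open>Tensor products\<close>

text \<open>Stated through the two partial maps, so that every rule for \<open>lin_hom\<close>,
  composition above all, applies in each argument.\<close>

definition bilin ::
  "('k, 'm) ring_scheme \<Rightarrow> ('k, 'a, 'c) module_scheme \<Rightarrow> ('k, 'b, 'd) module_scheme
     \<Rightarrow> ('k, 'v, 'e) module_scheme \<Rightarrow> ('a \<Rightarrow> 'b \<Rightarrow> 'v) \<Rightarrow> bool" where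
  "bilin K A B V \<beta> \<longleftrightarrow> (\<forall>x\<in>carrier A. \<beta> x \<in> lin_hom K B V) \<and>
     (\<forall>y\<in>carrier B. (\<lambda>x. \<beta> x y) \<in> lin_hom K A V)"

lemma bilinI:
  assumes "\<And>x. x \<in> carrier A \<Longrightarrow> (\<lambda>y. \<beta> x y) \<in> lin_hom K B V"
    and "\<And>y. y \<in> carrier B \<Longrightarrow> (\<lambda>x. \<beta> x y) \<in> lin_hom K A V"
  shows "bilin K A B V \<beta>"
  using assms by (simp add: bilin_def)

lemma bilin_right: "bilin K A B V \<beta> \<Longrightarrow> x \<in> carrier A \<Longrightarrow> \<beta> x \<in> lin_hom K B V"
  and bilin_left: "bilin K A B V \<beta> \<Longrightarrow> y \<in> carrier B \<Longrightarrow> (\<lambda>x. \<beta> x y) \<in> lin_hom K A V"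
  by (simp_all add: bilin_def)

lemma bilin_closed:
  "bilin K A B V \<beta> \<Longrightarrow> x \<in> carrier A \<Longrightarrow> y \<in> carrier B \<Longrightarrow> \<beta> x y \<in> carrier V"
  by (metis bilin_right lin_hom_closed)

lemma lin_hom_zero_map:
  assumes "module K W"
  shows "(\<lambda>x. \<zero>\<^bsub>W\<^esub>) \<in> lin_hom K V W"
proof -
  interpret W: module K W by fact
  show ?thesis by (auto intro!: lin_homI)
qed

lemma lin_hom_sum:
  assumes "module K V" "module K W" "f \<in> lin_hom K V W" "g \<in> lin_hom K V W"
  shows "(\<lambda>x. f x \<oplus>\<^bsub>W\<^esub> g x) \<in> lin_hom K V W"
proof -
  interpret V: module K V by fact
  interpret W: module K W by fact
  show ?thesis using assms(3,4)
    by (auto intro!: lin_homI simp: lin_hom_closed lin_hom_add lin_hom_smult W.smult_r_distr W.a_ac)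
qed

text \<open>Maps that are linear in \<open>z\<close> are closed under sums and multiples, so
  linearity in the parameter spreads from generators \<open>s\<close> to every \<open>v\<close> in
  their span. Bilinearity of iterated lifts rests on this.\<close>

lemma lin_hom_param_span:
  assumes "module K C" "module K V" "module K W" "S \<subseteq> carrier V" "v \<in> lin_span K V S"
    and h: "\<And>z. z \<in> carrier C \<Longrightarrow> h z \<in> lin_hom K V W"
    and lin: "\<And>s. s \<in> S \<Longrightarrow> (\<lambda>z. h z s) \<in> lin_hom K C W"
  shows "(\<lambda>z. h z v) \<in> lin_hom K C W"
  using assms(5,2,4)
proof (induction rule: lin_span_induct)
  note c = subsetD[OF lin_span_carrier[OF assms(2,4)]]
  {
    case (base s)
    then show ?case by (rule lin)
  next
    case zero
    show ?case
      by (rule lin_hom_cong[OF lin_hom_zero_map[OF assms(3)] assms(1)]) (rule lin_hom_zero[OF assms(2,3) h])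
  next
    case (add t u)
    show ?case
      by (rule lin_hom_cong[OF lin_hom_sum[OF assms(1,3) add(3,4)] assms(1)])
        (use add c in \<open>simp add: lin_hom_add[OF h]\<close>)
  next
    case (smult k t)
    show ?case
      by (rule lin_hom_cong[OF lin_hom_smult_left[OF assms(1) smult(3) assms(3) smult(1)] assms(1)])
        (use smult c in \<open>simp add: lin_hom_smult[OF h]\<close>)
  }
qed

lemma lin_hom_minus:
  assumes "module K V" "module K W" "f \<in> lin_hom K V W" "x \<in> carrier V" "y \<in> carrier V"
  shows "f (x \<ominus>\<^bsub>V\<^esub> y) = f x \<ominus>\<^bsub>W\<^esub> f y"
proof -
  interpret V: module K V by fact
  interpret W: module K W by fact
  have "f (x \<ominus>\<^bsub>V\<^esub> y) \<oplus>\<^bsub>W\<^esub> f y = f x"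
    using assms by (simp add: lin_hom_add[OF assms(3), symmetric] V.minus_eq V.a_assoc V.l_neg)
  then show ?thesis
    using assms by (metis V.minus_closed W.add.inv_solve_right W.minus_eq lin_hom_closed)
qed

lemma lin_hom_kernel:
  assumes "module K V" "module K W" "f \<in> lin_hom K V W"
  shows "submodule {x \<in> carrier V. f x = \<zero>\<^bsub>W\<^esub>} K V"
proof -
  interpret V: module K V by fact
  interpret W: module K W by fact
  show ?thesis
  proof (rule V.submoduleI)
    fix a assume a: "a \<in> {x \<in> carrier V. f x = \<zero>\<^bsub>W\<^esub>}"
    then have "f (\<zero>\<^bsub>V\<^esub> \<ominus>\<^bsub>V\<^esub> a) = \<zero>\<^bsub>W\<^esub>"
      using lin_hom_minus[OF assms] lin_hom_zero[OF assms] by (simp add: W.minus_eq)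
    then show "\<ominus>\<^bsub>V\<^esub> a \<in> {x \<in> carrier V. f x = \<zero>\<^bsub>W\<^esub>}"
      using a by (simp add: V.minus_eq)
  qed (use lin_hom_zero[OF assms] lin_hom_add[OF assms(3)] lin_hom_smult[OF assms(3)] in auto)
qed

lemma lin_span_self: "module K V \<Longrightarrow> lin_span K V (carrier V) = carrier V"
  by (simp add: lin_span_carrier lin_span_incl subset_antisym)

lemma submodule_zero: "submodule W K V \<Longrightarrow> \<zero>\<^bsub>V\<^esub> \<in> W"
  using subgroup.one_closed[OF submodule.axioms(1)] by fastforce

section \<open>Cosets of submodules and their chosen representatives\<close>

lemma submodule_abelian_subgroup:
  assumes "module K F" "submodule I K F"
  shows "abelian_subgroup I F"
proof -
  interpret F: module K F by fact
  show ?thesis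
    using assms(2) F.abelian_group_axioms
    by (simp add: abelian_subgroupI3 additive_subgroup.intro submodule.axioms(1))
qed

lemma coset_eq_iff:
  assumes "module K F" "submodule I K F" "c \<in> carrier F" "d \<in> carrier F"
  shows "I +>\<^bsub>F\<^esub> c = I +>\<^bsub>F\<^esub> d \<longleftrightarrow> c \<ominus>\<^bsub>F\<^esub> d \<in> I"
proof -
  interpret F: module K F by fact
  interpret I: abelian_subgroup I F by (rule submodule_abelian_subgroup[OF assms(1,2)])
  have "c \<in> I +>\<^bsub>F\<^esub> d \<longleftrightarrow> c \<ominus>\<^bsub>F\<^esub> d \<in> I"
    using I.a_rcos_module assms by (simp add: F.minus_eq)
  then show ?thesis
    using I.a_repr_independence' I.a_repr_independenceD assms by metis
qed

text \<open>The coset contains \<open>c\<close>, so the choice made by \<open>rep\<close> is a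
  member; which member it is remains unknown, and only its coset can be used.\<close>

lemma coset_rep:
  assumes "module K F" "submodule I K F" "c \<in> carrier F"
  shows "rep (I +>\<^bsub>F\<^esub> c) \<in> carrier F" "I +>\<^bsub>F\<^esub> rep (I +>\<^bsub>F\<^esub> c) = I +>\<^bsub>F\<^esub> c"
proof -
  interpret F: module K F by fact
  interpret I: abelian_subgroup I F by (rule submodule_abelian_subgroup[OF assms(1,2)])
  have "c \<in> I +>\<^bsub>F\<^esub> c" using I.a_rcos_self assms by auto
  then have r: "rep (I +>\<^bsub>F\<^esub> c) \<in> I +>\<^bsub>F\<^esub> c" unfolding rep_def by (rule someI)
  show "rep (I +>\<^bsub>F\<^esub> c) \<in> carrier F" using I.a_elemrcos_carrier[OF assms(3) r] .
  show "I +>\<^bsub>F\<^esub> rep (I +>\<^bsub>F\<^esub> c) = I +>\<^bsub>F\<^esub> c"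
    using I.a_repr_independence'[OF r assms(3)] by simp
qed

lemma coset_add:
  assumes "module K F" "submodule I K F" "c \<in> carrier F" "d \<in> carrier F"
  shows "(I +>\<^bsub>F\<^esub> c) <+>\<^bsub>F\<^esub> (I +>\<^bsub>F\<^esub> d) = I +>\<^bsub>F\<^esub> (c \<oplus>\<^bsub>F\<^esub> d)"
proof -
  interpret F: module K F by fact
  interpret I: abelian_subgroup I F by (rule submodule_abelian_subgroup[OF assms(1,2)])
  show ?thesis by (rule I.a_rcos_sum[OF assms(3,4)])
qed

lemma tensor_ker_cong:
  assumes "carrier A = carrier A'" "add A = add A'" "smult A = smult A'"
    and "carrier B = carrier B'" "add B = add B'" "smult B = smult B'"
  shows "tensor_ker K A B = tensor_ker K A' B'"
  using assms by (simp add: tensor_ker_def tensor_rel_def)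

lemma tens_cong:
  assumes "carrier A = carrier A'" "add A = add A'" "smult A = smult A'"
    and "carrier B = carrier B'" "add B = add B'" "smult B = smult B'"
  shows "tens K A B = tens K A' B'"
  using assms by (simp add: tens_def fun_eq_iff tensor_ker_cong[OF assms])

text \<open>\<open>ghopf\<close> is defined by means of tensor products over \<open>galg\<close>, a
  record of another type with the same operations. Since the construction reads only the listed
  fields, both records yield the same tensor product.\<close>

lemma tensor_cong:
  assumes "carrier A = carrier A'" "add A = add A'" "smult A = smult A'" "mult A = mult A'" "one A = one A'"
    and "carrier B = carrier B'" "add B = add B'" "smult B = smult B'" "mult B = mult B'" "one B = one B'"
  shows "tensor K A B = tensor K A' B'"
  using assms by (simp add: tensor_def tensor_ker_cong[OF assms(1-3,6-8)])

section \<open>The tensor product as a quotient, and its universal property\<close>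

context base_field
begin

abbreviation tfree ::
  "('k, 'a, 'c) module_scheme \<Rightarrow> ('k, 'b, 'd) module_scheme \<Rightarrow> ('k, 'a \<times> 'b \<Rightarrow> 'k) module"
  where "tfree A B \<equiv> free_mod K (carrier A \<times> carrier B)"

abbreviation tclass ::
  "('k, 'a, 'c) module_scheme \<Rightarrow> ('k, 'b, 'd) module_scheme \<Rightarrow> ('a \<times> 'b \<Rightarrow> 'k) \<Rightarrow> ('a \<times> 'b \<Rightarrow> 'k) set"
  where "tclass A B c \<equiv> tensor_ker K A B +>\<^bsub>tfree A B\<^esub> c"

lemma tensor_rel_closed:
  assumes "module K A" "module K B"
  shows "tensor_rel K A B \<subseteq> carrier (tfree A B)"
proof -
  interpret A: module K A by fact
  interpret B: module K B by fact
  interpret F: module K "tfree A B" by (rule module_free_mod)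
  show ?thesis by (auto simp: tensor_rel_def Let_def)
qed

lemma tensor_ker_submodule:
  "module K A \<Longrightarrow> module K B \<Longrightarrow>
     submodule (tensor_ker K A B) K (tfree A B)"
  unfolding tensor_ker_def by (intro lin_span_submodule module_free_mod tensor_rel_closed)

lemma tensor_carrier:
  "carrier (tensor K A B) = tclass A B ` carrier (tfree A B)"
  by (auto simp: tensor_def Let_def A_RCOSETS_def')

lemma tensorE:
  assumes "X \<in> carrier (tensor K A B)"
  obtains c where "c \<in> carrier (tfree A B)" "X = tclass A B c"
  using assms unfolding tensor_carrier by blast

lemma tensor_zero:
  assumes "module K A" "module K B"
  shows "\<zero>\<^bsub>tensor K A B\<^esub> = tclass A B \<zero>\<^bsub>tfree A B\<^esub>"
proof -
  interpret F: module K "tfree A B" by (rule module_free_mod)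
  show ?thesis
    using F.submoduleE(1)[OF tensor_ker_submodule[OF assms]]
    by (simp add: tensor_def Let_def)
qed

lemma tensor_add:
  assumes "module K A" "module K B" "c \<in> carrier (tfree A B)"
    "d \<in> carrier (tfree A B)"
  shows "tclass A B c \<oplus>\<^bsub>tensor K A B\<^esub> tclass A B d =
    tclass A B (c \<oplus>\<^bsub>tfree A B\<^esub> d)"
  using coset_add[OF module_free_mod tensor_ker_submodule[OF assms(1,2)] assms(3,4)]
  by (simp add: tensor_def Let_def)

text \<open>The definition multiplies the chosen representative. It differs from \<open>c\<close> by
  an element of the kernel, which is closed under scalars, so the class does not depend on the
  choice.\<close>

lemma tensor_smult:
  assumes "module K A" "module K B" "c \<in> carrier (tfree A B)" "k \<in> carrier K"
  shows "k \<odot>\<^bsub>tensor K A B\<^esub> tclass A B c = tclass A B (k \<odot>\<^bsub>tfree A B\<^esub> c)"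
proof -
  let ?F = "tfree A B"
  interpret F: module K ?F by (rule module_free_mod)
  note sub = tensor_ker_submodule[OF assms(1,2)]
  note r = coset_rep[OF module_free_mod sub assms(3)]
  let ?r = "rep (tclass A B c)"
  have "?r \<ominus>\<^bsub>?F\<^esub> c \<in> tensor_ker K A B"
    using coset_eq_iff[OF module_free_mod sub r(1) assms(3)] r(2) by simp
  then have "k \<odot>\<^bsub>?F\<^esub> (?r \<ominus>\<^bsub>?F\<^esub> c) \<in> tensor_ker K A B"
    using F.submoduleE(4)[OF sub] assms(4) by blast
  also have "k \<odot>\<^bsub>?F\<^esub> (?r \<ominus>\<^bsub>?F\<^esub> c) = k \<odot>\<^bsub>?F\<^esub> ?r \<ominus>\<^bsub>?F\<^esub> k \<odot>\<^bsub>?F\<^esub> c"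
    using r(1) assms by (simp add: F.minus_eq F.smult_r_distr F.smult_r_minus)
  finally have "tclass A B (k \<odot>\<^bsub>?F\<^esub> ?r) = tclass A B (k \<odot>\<^bsub>?F\<^esub> c)"
    using coset_eq_iff[OF module_free_mod sub] r(1) assms by simp
  then show ?thesis by (simp add: tensor_def Let_def)
qed

lemma module_tensor:
  assumes "module K A" "module K B"
  shows "module K (tensor K A B)"
  by (rule module_image[where q = "tclass A B", OF module_free_mod tensor_carrier tensor_zero[OF assms]])
    (simp_all add: tensor_add[OF assms] tensor_smult[OF assms])

lemma tclass_hom:
  assumes "module K A" "module K B"
  shows "tclass A B \<in> lin_hom K (tfree A B) (tensor K A B)"
  by (rule lin_homI) (simp_all add: tensor_carrier tensor_add[OF assms] tensor_smult[OF assms])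

text \<open>The four families of relations are sent to the four defects of bilinearity of \<beta>,
  all of which vanish.\<close>

lemma lin_ext_tensor_rel:
  assumes "module K A" "module K B" "module K V" "bilin K A B V \<beta>" "c \<in> tensor_rel K A B"
  shows "lin_ext K V (\<lambda>p. \<beta> (fst p) (snd p)) c = \<zero>\<^bsub>V\<^esub>"
proof -
  let ?F = "tfree A B"
  interpret A: module K A by fact
  interpret B: module K B by fact
  interpret V: module K V by fact
  interpret F: module K ?F by (rule module_free_mod)
  let ?L = "lin_ext K V (\<lambda>p. \<beta> (fst p) (snd p))"
  have bc: "\<beta> x y \<in> carrier V" if "x \<in> carrier A" "y \<in> carrier B" for x y
    using bilin_closed[OF assms(4)] that by auto
  have L: "?L \<in> lin_hom K ?F V"
    by (rule lin_ext_hom[OF assms(3)]) (auto simp: bc)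
  have e: "?L (bvec K (x, y)) = \<beta> x y" if "x \<in> carrier A" "y \<in> carrier B" for x y
    using that by (simp add: lin_ext_bvec[OF assms(3)] bc)
  note add1 = lin_hom_add[OF bilin_left[OF assms(4)]] and add2 = lin_hom_add[OF bilin_right[OF assms(4)]]
  note smult1 = lin_hom_smult[OF bilin_left[OF assms(4)]]
    and smult2 = lin_hom_smult[OF bilin_right[OF assms(4)]]
  show ?thesis using assms(5)
    by (auto simp: tensor_rel_def Let_def lin_hom_minus[OF module_free_mod assms(3) L]
        lin_hom_add[OF L] lin_hom_smult[OF L] e add1 add2 smult1 smult2 bc V.minus_eq V.r_neg)
qed

text \<open>The linear extension of a bilinear \<beta> kills the generators of the kernel, hence the
  kernel, hence the difference between \<open>c\<close> and the representative picked by
  \<open>rep\<close>. From here on lifts can be computed without mentioning representatives.\<close>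

lemma tlift_tclass:
  assumes "module K A" "module K B" "module K V" "bilin K A B V \<beta>"
    "c \<in> carrier (tfree A B)"
  shows "tlift K V \<beta> (tclass A B c) = lin_ext K V (\<lambda>p. \<beta> (fst p) (snd p)) c"
proof -
  let ?F = "tfree A B"
  interpret V: module K V by fact
  interpret F: module K ?F by (rule module_free_mod)
  let ?L = "lin_ext K V (\<lambda>p. \<beta> (fst p) (snd p))"
  have L: "?L \<in> lin_hom K ?F V"
    by (rule lin_ext_hom[OF assms(3)]) (auto intro: bilin_closed[OF assms(4)])
  note sub = tensor_ker_submodule[OF assms(1,2)]
  note r = coset_rep[OF module_free_mod sub assms(5)]
  have "tensor_ker K A B \<subseteq> {c \<in> carrier ?F. ?L c = \<zero>\<^bsub>V\<^esub>}"
    unfolding tensor_ker_def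
    by (rule lin_span_least[OF lin_hom_kernel[OF module_free_mod assms(3) L]])
      (use tensor_rel_closed[OF assms(1,2)] lin_ext_tensor_rel[OF assms(1-4)] in auto)
  moreover have "rep (tclass A B c) \<ominus>\<^bsub>?F\<^esub> c \<in> tensor_ker K A B"
    using coset_eq_iff[OF module_free_mod sub r(1) assms(5)] r(2) by simp
  ultimately have 0: "?L (rep (tclass A B c)) \<ominus>\<^bsub>V\<^esub> ?L c = \<zero>\<^bsub>V\<^esub>"
    using lin_hom_minus[OF module_free_mod assms(3) L r(1) assms(5)] by auto
  have "?L (rep (tclass A B c)) = (?L (rep (tclass A B c)) \<ominus>\<^bsub>V\<^esub> ?L c) \<oplus>\<^bsub>V\<^esub> ?L c"
    using lin_hom_closed[OF L r(1)] lin_hom_closed[OF L assms(5)]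
    by (simp add: V.minus_eq V.a_assoc V.l_neg)
  then show ?thesis
    using lin_hom_closed[OF L assms(5)] by (simp add: 0 tlift_def)
qed

lemma tlift_hom:
  assumes "module K A" "module K B" "module K V" "bilin K A B V \<beta>"
  shows "tlift K V \<beta> \<in> lin_hom K (tensor K A B) V"
proof -
  let ?F = "tfree A B"
  interpret F: module K ?F by (rule module_free_mod)
  have L: "lin_ext K V (\<lambda>p. \<beta> (fst p) (snd p)) \<in> lin_hom K ?F V"
    by (rule lin_ext_hom[OF assms(3)]) (auto intro: bilin_closed[OF assms(4)])
  note t = tlift_tclass[OF assms]
  show ?thesis
  proof (rule lin_homI)
    fix X assume "X \<in> carrier (tensor K A B)"
    then obtain c where c: "c \<in> carrier ?F" "X = tclass A B c" by (rule tensorE)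
    show "tlift K V \<beta> X \<in> carrier V" using c lin_hom_closed[OF L] by (simp add: t)
    show "tlift K V \<beta> (k \<odot>\<^bsub>tensor K A B\<^esub> X) = k \<odot>\<^bsub>V\<^esub> tlift K V \<beta> X" if "k \<in> carrier K" for k
      using c that lin_hom_smult[OF L] by (simp add: t tensor_smult[OF assms(1,2)])
    fix Y assume "Y \<in> carrier (tensor K A B)"
    then obtain d where "d \<in> carrier ?F" "Y = tclass A B d" by (rule tensorE)
    then show "tlift K V \<beta> (X \<oplus>\<^bsub>tensor K A B\<^esub> Y) = tlift K V \<beta> X \<oplus>\<^bsub>V\<^esub> tlift K V \<beta> Y"
      using c lin_hom_add[OF L] by (simp add: t tensor_add[OF assms(1,2)])
  qed
qed

lemma tlift_tens:
  assumes "module K A" "module K B" "module K V" "bilin K A B V \<beta>" "x \<in> carrier A" "y \<in> carrier B"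
  shows "tlift K V \<beta> (tens K A B x y) = \<beta> x y"
  using assms tlift_tclass[OF assms(1-4), of "bvec K (x, y)"] bilin_closed[OF assms(4-6)]
  by (simp add: tens_def lin_ext_bvec)

lemma tens_closed:
  assumes "x \<in> carrier A" "y \<in> carrier B"
  shows "tens K A B x y \<in> carrier (tensor K A B)"
  using assms by (simp add: tens_def tensor_carrier)

text \<open>Each of the four laws is one of the families in \<open>tensor_rel\<close>; the union
  rules select the family.\<close>

lemma bilin_tens:
  assumes "module K A" "module K B"
  shows "bilin K A B (tensor K A B) (tens K A B)"
proof -
  let ?F = "tfree A B"
  interpret A: module K A by fact
  interpret B: module K B by fact
  interpret F: module K ?F by (rule module_free_mod)
  note sub = tensor_ker_submodule[OF assms]
  have rel: "tclass A B c = tclass A B d"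
    if "c \<ominus>\<^bsub>?F\<^esub> d \<in> tensor_rel K A B" "c \<in> carrier ?F" "d \<in> carrier ?F" for c d
    using coset_eq_iff[OF module_free_mod sub that(2,3)] that(1)
      lin_span_incl[of "tensor_rel K A B" K ?F] by (auto simp: tensor_ker_def)
  show ?thesis
  proof (intro bilinI lin_homI)
    fix x x' y assume *: "x \<in> carrier A" "x' \<in> carrier A" "y \<in> carrier B"
    have "bvec K (x \<oplus>\<^bsub>A\<^esub> x', y) \<ominus>\<^bsub>?F\<^esub> (bvec K (x, y) \<oplus>\<^bsub>?F\<^esub> bvec K (x', y)) \<in> tensor_rel K A B"
      unfolding tensor_rel_def Let_def by (intro UnI1 CollectI exI conjI) (rule refl, fact+)
    from rel[OF this] * show "tens K A B (x \<oplus>\<^bsub>A\<^esub> x') y = tens K A B x y \<oplus>\<^bsub>tensor K A B\<^esub> tens K A B x' y"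
      by (simp add: tens_def tensor_add[OF assms])
  next
    fix x y y' assume *: "x \<in> carrier A" "y \<in> carrier B" "y' \<in> carrier B"
    have "bvec K (x, y \<oplus>\<^bsub>B\<^esub> y') \<ominus>\<^bsub>?F\<^esub> (bvec K (x, y) \<oplus>\<^bsub>?F\<^esub> bvec K (x, y')) \<in> tensor_rel K A B"
      unfolding tensor_rel_def Let_def by (rule UnI1, rule UnI1, rule UnI2, intro CollectI exI conjI) (rule refl, fact+)
    from rel[OF this] * show "tens K A B x (y \<oplus>\<^bsub>B\<^esub> y') = tens K A B x y \<oplus>\<^bsub>tensor K A B\<^esub> tens K A B x y'"
      by (simp add: tens_def tensor_add[OF assms])
  next
    fix k x y assume *: "k \<in> carrier K" "x \<in> carrier A" "y \<in> carrier B"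
    have "bvec K (k \<odot>\<^bsub>A\<^esub> x, y) \<ominus>\<^bsub>?F\<^esub> k \<odot>\<^bsub>?F\<^esub> bvec K (x, y) \<in> tensor_rel K A B"
      unfolding tensor_rel_def Let_def by (rule UnI1, rule UnI2, intro CollectI exI conjI) (rule refl, fact+)
    from rel[OF this] * show "tens K A B (k \<odot>\<^bsub>A\<^esub> x) y = k \<odot>\<^bsub>tensor K A B\<^esub> tens K A B x y"
      by (simp add: tens_def tensor_smult[OF assms])
    have "bvec K (x, k \<odot>\<^bsub>B\<^esub> y) \<ominus>\<^bsub>?F\<^esub> k \<odot>\<^bsub>?F\<^esub> bvec K (x, y) \<in> tensor_rel K A B"
      unfolding tensor_rel_def Let_def by (rule UnI2, intro CollectI exI conjI) (rule refl, fact+)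
    from rel[OF this] * show "tens K A B x (k \<odot>\<^bsub>B\<^esub> y) = k \<odot>\<^bsub>tensor K A B\<^esub> tens K A B x y"
      by (simp add: tens_def tensor_smult[OF assms])
  qed (simp_all add: tens_closed)
qed

lemma tens_right_hom:
  assumes "module K A" "module K B" "x \<in> carrier A" "f \<in> lin_hom K C B"
  shows "(\<lambda>z. tens K A B x (f z)) \<in> lin_hom K C (tensor K A B)"
  by (rule lin_hom_comp[OF assms(4) bilin_right[OF bilin_tens[OF assms(1,2)] assms(3)]])

lemma tens_left_hom:
  assumes "module K A" "module K B" "y \<in> carrier B" "f \<in> lin_hom K C A"
  shows "(\<lambda>z. tens K A B (f z) y) \<in> lin_hom K C (tensor K A B)"
  by (rule lin_hom_comp[OF assms(4) bilin_left[OF bilin_tens[OF assms(1,2)] assms(3)]])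

lemma tensor_span:
  assumes "module K A" "module K B"
  shows "carrier (tensor K A B) =
    lin_span K (tensor K A B) {tens K A B x y | x y. x \<in> carrier A \<and> y \<in> carrier B}"
proof -
  have "carrier (tensor K A B) =
    lin_span K (tensor K A B) (tclass A B ` (bvec K ` (carrier A \<times> carrier B)))"
    by (rule lin_span_eq_carrier_image[OF module_free_mod module_tensor[OF assms] tclass_hom[OF assms]])
      (auto simp: tensor_carrier free_mod_span[symmetric])
  moreover have "tclass A B ` (bvec K ` (carrier A \<times> carrier B)) =
      {tens K A B x y | x y. x \<in> carrier A \<and> y \<in> carrier B}"
    by (auto simp: tens_def image_iff)
  ultimately show ?thesis by simp
qed

text \<open>Agreement is extended one tensor factor at a time, since with one factor fixed a map on
  the tensor product is linear in the other.\<close>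

lemma tensor_hom_eq_span:
  assumes "module K A" "module K B" "module K W"
    and f: "f \<in> lin_hom K (tensor K A B) W" and g: "g \<in> lin_hom K (tensor K A B) W"
    and S: "S \<subseteq> carrier A" "carrier A = lin_span K A S"
    and S': "S' \<subseteq> carrier B" "carrier B = lin_span K B S'"
    and eq: "\<And>x y. x \<in> S \<Longrightarrow> y \<in> S' \<Longrightarrow> f (tens K A B x y) = g (tens K A B x y)"
    and "t \<in> carrier (tensor K A B)"
  shows "f t = g t"
proof -
  note b = bilin_tens[OF assms(1,2)]
  have 1: "f (tens K A B x y) = g (tens K A B x y)" if "x \<in> S" "y \<in> carrier B" for x y
  proof (rule lin_hom_eq_on_span[OF assms(2,3), where S = S'])
    show "(\<lambda>y. f (tens K A B x y)) \<in> lin_hom K B W" "(\<lambda>y. g (tens K A B x y)) \<in> lin_hom K B W"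
      using bilin_right[OF b, of x] that S by (auto intro: lin_hom_comp f g)
  qed (use that S' eq in auto)
  have 2: "f (tens K A B x y) = g (tens K A B x y)" if "x \<in> carrier A" "y \<in> carrier B" for x y
  proof (rule lin_hom_eq_on_span[OF assms(1,3), where S = S])
    show "(\<lambda>x. f (tens K A B x y)) \<in> lin_hom K A W" "(\<lambda>x. g (tens K A B x y)) \<in> lin_hom K A W"
      using lin_hom_comp[OF bilin_left[OF b that(2)]] f g by auto
  qed (use that S 1 in auto)
  show ?thesis
    by (rule lin_hom_eq_on_span[OF module_tensor[OF assms(1,2)] assms(3) f g, rotated 2])
      (use assms(11)[unfolded tensor_span[OF assms(1,2)]] in \<open>auto simp: 2 tens_closed\<close>)
qed

lemma tensor_hom_eq:
  assumes "module K A" "module K B" "module K W"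
    and "f \<in> lin_hom K (tensor K A B) W" "g \<in> lin_hom K (tensor K A B) W"
    and "\<And>x y. x \<in> carrier A \<Longrightarrow> y \<in> carrier B \<Longrightarrow> f (tens K A B x y) = g (tens K A B x y)"
    and "t \<in> carrier (tensor K A B)"
  shows "f t = g t"
  by (rule tensor_hom_eq_span[OF assms(1-5), of "carrier A" "carrier B"])
    (use assms in \<open>auto simp: lin_span_self\<close>)

text \<open>On pure tensors the lift is \<open>\<gamma> z x y\<close>, linear in \<open>z\<close> by
  hypothesis, and pure tensors generate. A lift of a bilinear map depending on a further variable is
  therefore linear in that variable, as nested lifts require.\<close>

lemma tlift_param_hom:
  assumes "module K A" "module K B" "module K C" "module K V"
    and \<gamma>: "\<And>z. z \<in> carrier C \<Longrightarrow> bilin K A B V (\<gamma> z)"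
    and lin: "\<And>x y. x \<in> carrier A \<Longrightarrow> y \<in> carrier B \<Longrightarrow> (\<lambda>z. \<gamma> z x y) \<in> lin_hom K C V"
    and s: "s \<in> carrier (tensor K A B)"
  shows "(\<lambda>z. tlift K V (\<gamma> z) s) \<in> lin_hom K C V"
proof (rule lin_hom_param_span[OF assms(3) module_tensor[OF assms(1,2)] assms(4) _
      s[unfolded tensor_span[OF assms(1,2)]] tlift_hom[OF assms(1,2,4) \<gamma>]])
  fix t assume "t \<in> {tens K A B x y | x y. x \<in> carrier A \<and> y \<in> carrier B}"
  then obtain x y where t: "t = tens K A B x y" and xy: "x \<in> carrier A" "y \<in> carrier B" by auto
  show "(\<lambda>z. tlift K V (\<gamma> z) t) \<in> lin_hom K C V" unfolding t
    by (rule lin_hom_cong[OF lin[OF xy] assms(3)]) (simp add: tlift_tens[OF assms(1,2,4) \<gamma>] xy)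
qed (auto simp: tens_closed)

end

section \<open>Functoriality, associativity and flip of tensor products\<close>

context base_field
begin

lemma tmap_bilin:
  assumes "module K A" "module K B" "module K A'" "module K B'"
    "f \<in> lin_hom K A A'" "g \<in> lin_hom K B B'"
  shows "bilin K A B (tensor K A' B') (\<lambda>x y. tens K A' B' (f x) (g y))"
  by (intro bilinI tens_right_hom tens_left_hom assms lin_hom_closed[OF assms(5)] lin_hom_closed[OF assms(6)])

lemma tmap_hom:
  assumes "module K A" "module K B" "module K A'" "module K B'"
    "f \<in> lin_hom K A A'" "g \<in> lin_hom K B B'"
  shows "tmap K A' B' f g \<in> lin_hom K (tensor K A B) (tensor K A' B')"
  unfolding tmap_def by (intro tlift_hom module_tensor tmap_bilin assms)

lemma tmap_tens:
  assumes "module K A" "module K B" "module K A'" "module K B'"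
    "f \<in> lin_hom K A A'" "g \<in> lin_hom K B B'" "x \<in> carrier A" "y \<in> carrier B"
  shows "tmap K A' B' f g (tens K A B x y) = tens K A' B' (f x) (g y)"
  unfolding tmap_def
  by (rule tlift_tens[OF assms(1,2) module_tensor[OF assms(3,4)] tmap_bilin[OF assms(1-6)] assms(7,8)])

text \<open>The composites are compared on carriers only. Morphisms are extensional functions, so
  \<open>f''\<close> is typically a restricted composite that differs from
  \<open>f' \<circ> f\<close> elsewhere.\<close>

lemma tmap_comp:
  assumes "module K A" "module K B" "module K A'" "module K B'" "module K A''" "module K B''"
    "f \<in> lin_hom K A A'" "g \<in> lin_hom K B B'" "f' \<in> lin_hom K A' A''" "g' \<in> lin_hom K B' B''"
    and eq: "\<And>x. x \<in> carrier A \<Longrightarrow> f'' x = f' (f x)" "\<And>y. y \<in> carrier B \<Longrightarrow> g'' y = g' (g y)"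
    and "t \<in> carrier (tensor K A B)"
  shows "tmap K A'' B'' f' g' (tmap K A' B' f g t) = tmap K A'' B'' f'' g'' t"
proof (rule tensor_hom_eq[OF assms(1,2) module_tensor[OF assms(5,6)] _ _ _ assms(13)])
  have f'': "f'' \<in> lin_hom K A A''" and g'': "g'' \<in> lin_hom K B B''"
    using lin_hom_comp[OF assms(7,9)] lin_hom_comp[OF assms(8,10)] eq
    by (auto intro: lin_hom_cong assms)
  show "tmap K A'' B'' f'' g'' \<in> lin_hom K (tensor K A B) (tensor K A'' B'')"
    by (intro tmap_hom assms f'' g'')
  show "(\<lambda>t. tmap K A'' B'' f' g' (tmap K A' B' f g t)) \<in> lin_hom K (tensor K A B) (tensor K A'' B'')"
    by (intro lin_hom_comp[OF tmap_hom tmap_hom] assms)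
  fix x y assume "x \<in> carrier A" "y \<in> carrier B"
  then show "tmap K A'' B'' f' g' (tmap K A' B' f g (tens K A B x y)) = tmap K A'' B'' f'' g'' (tens K A B x y)"
    using assms f'' g'' by (simp add: tmap_tens lin_hom_closed[OF assms(7)] lin_hom_closed[OF assms(8)])
qed

lemma tmap_ident:
  assumes "module K A" "module K B" "\<And>x. x \<in> carrier A \<Longrightarrow> f x = x" "\<And>y. y \<in> carrier B \<Longrightarrow> g y = y"
    "t \<in> carrier (tensor K A B)"
  shows "tmap K A B f g t = t"
proof (rule tensor_hom_eq[OF assms(1,2) module_tensor[OF assms(1,2)] _ lin_hom_ident _ assms(5)])
  have f: "f \<in> lin_hom K A A" and g: "g \<in> lin_hom K B B"
    using assms by (auto intro: lin_hom_cong[OF lin_hom_ident])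
  show "tmap K A B f g \<in> lin_hom K (tensor K A B) (tensor K A B)"
    by (intro tmap_hom assms f g)
  fix x y assume "x \<in> carrier A" "y \<in> carrier B"
  then show "tmap K A B f g (tens K A B x y) = tens K A B x y"
    using assms f g by (simp add: tmap_tens)
qed

text \<open>Obtained from \<open>tmap_comp\<close> by taking identities as the second pair of maps;
  this avoids a separate argument about representatives for functions that agree on carriers
  only.\<close>

lemma tmap_cong:
  assumes "module K A" "module K B" "module K A'" "module K B'"
    "f \<in> lin_hom K A A'" "g \<in> lin_hom K B B'"
    "\<And>x. x \<in> carrier A \<Longrightarrow> f' x = f x" "\<And>y. y \<in> carrier B \<Longrightarrow> g' y = g y"
    "t \<in> carrier (tensor K A B)"
  shows "tmap K A' B' f' g' t = tmap K A' B' f g t"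
  using tmap_comp[OF assms(1-4) assms(3,4,5,6) lin_hom_ident lin_hom_ident, of f' g' t]
    tmap_ident[OF assms(3,4), of "\<lambda>x. x" "\<lambda>x. x"] lin_hom_closed[OF tmap_hom[OF assms(1-6)]] assms(7-9)
  by simp

text \<open>For fixed \<open>z\<close> the inner map is bilinear in \<open>x\<close> and
  \<open>y\<close>; its lift is linear in \<open>s\<close> by construction and linear in
  \<open>z\<close> by \<open>tlift_param_hom\<close>, so the outer lift is legitimate too.\<close>

lemma tassoc_hom_tens:
  assumes "module K A" "module K B" "module K C"
  shows "tassoc K A B C \<in> lin_hom K (tensor K (tensor K A B) C) (tensor K A (tensor K B C))"
    and "x \<in> carrier A \<Longrightarrow> y \<in> carrier B \<Longrightarrow> z \<in> carrier C \<Longrightarrow>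
      tassoc K A B C (tens K (tensor K A B) C (tens K A B x y) z) =
      tens K A (tensor K B C) x (tens K B C y z)"
proof -
  note M = assms module_tensor[OF assms(1,2)] module_tensor[OF assms(2,3)]
    module_tensor[OF assms(1) module_tensor[OF assms(2,3)]]
  let ?T = "tensor K A (tensor K B C)"
  let ?g = "\<lambda>z x y. tens K A (tensor K B C) x (tens K B C y z)"
  have g: "bilin K A B ?T (?g z)" if "z \<in> carrier C" for z
    using that by (intro bilinI tens_right_hom tens_left_hom M lin_hom_ident tens_closed)
  have b: "bilin K (tensor K A B) C ?T (\<lambda>s z. tlift K ?T (?g z) s)"
    by (intro bilinI tlift_hom[OF _ _ _ g] tlift_param_hom[OF _ _ _ _ g]
        tens_right_hom tens_left_hom M lin_hom_ident)
  show "tassoc K A B C \<in> lin_hom K (tensor K (tensor K A B) C) ?T"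
    unfolding tassoc_def Let_def by (intro tlift_hom b M)
  show "tassoc K A B C (tens K (tensor K A B) C (tens K A B x y) z) = ?g z x y"
    if "x \<in> carrier A" "y \<in> carrier B" "z \<in> carrier C"
    unfolding tassoc_def Let_def
    using that by (simp add: tlift_tens[OF M(4,3,6) b] tens_closed tlift_tens[OF M(1,2,6) g])
qed

lemmas tassoc_hom = tassoc_hom_tens(1) and tassoc_tens = tassoc_hom_tens(2)

text \<open>Three lifts are nested, and bilinearity is established from the inside out: in
  \<open>c\<close>, \<open>d\<close> for fixed \<open>a\<close>, \<open>b\<close>; then in
  \<open>a\<close>, \<open>b\<close> for a fixed tensor \<open>t\<close>; then in the two tensors
  \<open>s\<close>, \<open>t\<close>.\<close>

lemma tswap_hom_tens:
  assumes "module K A" "module K B" "module K C" "module K D"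
  shows "tswap K A B C D \<in>
      lin_hom K (tensor K (tensor K A B) (tensor K C D)) (tensor K (tensor K A C) (tensor K B D))"
    and "a \<in> carrier A \<Longrightarrow> b \<in> carrier B \<Longrightarrow> c \<in> carrier C \<Longrightarrow> d \<in> carrier D \<Longrightarrow>
      tswap K A B C D (tens K (tensor K A B) (tensor K C D) (tens K A B a b) (tens K C D c d)) =
      tens K (tensor K A C) (tensor K B D) (tens K A C a c) (tens K B D b d)"
proof -
  note M = assms module_tensor[OF assms(1,2)] module_tensor[OF assms(3,4)]
    module_tensor[OF assms(1,3)] module_tensor[OF assms(2,4)]
    module_tensor[OF module_tensor[OF assms(1,3)] module_tensor[OF assms(2,4)]]
  let ?T = "tensor K (tensor K A C) (tensor K B D)"
  let ?g = "\<lambda>a b c d. tens K (tensor K A C) (tensor K B D) (tens K A C a c) (tens K B D b d)"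
  have g: "bilin K C D ?T (?g a b)" if "a \<in> carrier A" "b \<in> carrier B" for a b
    using that by (intro bilinI tens_right_hom tens_left_hom M lin_hom_ident tens_closed)
  have h: "bilin K A B ?T (\<lambda>a b. tlift K ?T (?g a b) t)" if "t \<in> carrier (tensor K C D)" for t
    using that by (intro bilinI tlift_param_hom[OF _ _ _ _ g]
        tens_right_hom tens_left_hom M lin_hom_ident tens_closed)
  have b: "bilin K (tensor K A B) (tensor K C D) ?T (\<lambda>s t. tlift K ?T (\<lambda>a b. tlift K ?T (?g a b) t) s)"
    by (intro bilinI tlift_hom[OF _ _ _ h] tlift_param_hom[OF _ _ _ _ h] tlift_hom[OF _ _ _ g] M)
  show "tswap K A B C D \<in> lin_hom K (tensor K (tensor K A B) (tensor K C D)) ?T"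
    unfolding tswap_def Let_def by (intro tlift_hom b M)
  show "tswap K A B C D (tens K (tensor K A B) (tensor K C D) (tens K A B a b) (tens K C D c d)) = ?g a b c d"
    if "a \<in> carrier A" "b \<in> carrier B" "c \<in> carrier C" "d \<in> carrier D"
    unfolding tswap_def Let_def
    using that by (simp add: tlift_tens[OF M(5,6,9) b] tens_closed tlift_tens[OF M(1,2,9) h]
        tlift_tens[OF M(3,4,9) g])
qed

lemmas tswap_hom = tswap_hom_tens(1) and tswap_tens = tswap_hom_tens(2)

section \<open>Unital algebras and the tensor product algebra\<close>

lemma unital_algebra_module: "unital_algebra K A \<Longrightarrow> module K A"
  and unital_algebra_ring: "unital_algebra K A \<Longrightarrow> ring A"
  by (simp_all add: unital_algebra_def)

text \<open>Both sides of the associative law are linear in each argument, so it spreads from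
  generators to the third, the second and the first argument in turn. Tensor product algebras and
  group algebras are both obtained this way, with pure tensors and group elements as
  generators.\<close>

lemma unital_algebraI_span:
  assumes A: "module K A" and b: "bilin K A A A (\<lambda>x y. x \<otimes>\<^bsub>A\<^esub> y)"
    and S: "S \<subseteq> carrier A" "carrier A = lin_span K A S" and one: "\<one>\<^bsub>A\<^esub> \<in> carrier A"
    and unit: "\<And>x. x \<in> S \<Longrightarrow> \<one>\<^bsub>A\<^esub> \<otimes>\<^bsub>A\<^esub> x = x" "\<And>x. x \<in> S \<Longrightarrow> x \<otimes>\<^bsub>A\<^esub> \<one>\<^bsub>A\<^esub> = x"
    and assoc: "\<And>x y z. x \<in> S \<Longrightarrow> y \<in> S \<Longrightarrow> z \<in> S \<Longrightarrow> x \<otimes>\<^bsub>A\<^esub> y \<otimes>\<^bsub>A\<^esub> z = x \<otimes>\<^bsub>A\<^esub> (y \<otimes>\<^bsub>A\<^esub> z)"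
  shows "unital_algebra K A"
proof -
  interpret A: module K A by fact
  note br = bilin_right[OF b] and bl = bilin_left[OF b] and c = bilin_closed[OF b]
  note eq = lin_hom_eq_on_span[OF A A _ _ S(1) _ subsetD[OF equalityD1[OF S(2)]]] and lc = lin_hom_comp
  have SA: "x \<in> carrier A" if "x \<in> S" for x using that S(1) by auto
  have idl: "\<one>\<^bsub>A\<^esub> \<otimes>\<^bsub>A\<^esub> X = X" if "X \<in> carrier A" for X
    by (rule eq[OF br[OF one] lin_hom_ident unit(1) that])
  have idr: "X \<otimes>\<^bsub>A\<^esub> \<one>\<^bsub>A\<^esub> = X" if "X \<in> carrier A" for X
    by (rule eq[OF bl[OF one] lin_hom_ident unit(2) that])
  have a1: "x \<otimes>\<^bsub>A\<^esub> y \<otimes>\<^bsub>A\<^esub> Z = x \<otimes>\<^bsub>A\<^esub> (y \<otimes>\<^bsub>A\<^esub> Z)" if "x \<in> S" "y \<in> S" "Z \<in> carrier A" for x y Z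
    by (rule eq[OF br lc[OF br br] _ that(3)]) (use that in \<open>simp_all add: SA c assoc\<close>)
  have a2: "x \<otimes>\<^bsub>A\<^esub> Y \<otimes>\<^bsub>A\<^esub> Z = x \<otimes>\<^bsub>A\<^esub> (Y \<otimes>\<^bsub>A\<^esub> Z)" if "x \<in> S" "Y \<in> carrier A" "Z \<in> carrier A" for x Y Z
    by (rule eq[OF lc[OF br bl] lc[OF bl br] _ that(2)]) (use that in \<open>simp_all add: SA c a1\<close>)
  have a3: "X \<otimes>\<^bsub>A\<^esub> Y \<otimes>\<^bsub>A\<^esub> Z = X \<otimes>\<^bsub>A\<^esub> (Y \<otimes>\<^bsub>A\<^esub> Z)" if "X \<in> carrier A" "Y \<in> carrier A" "Z \<in> carrier A" for X Y Z
    by (rule eq[OF lc[OF bl bl] bl _ that(1)]) (use that in \<open>simp_all add: c a2\<close>)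
  have "monoid A" by (rule monoidI) (simp_all add: idl idr a3 c one)
  then have "ring A"
    by (intro ringI) (simp_all add: A.abelian_group_axioms lin_hom_add[OF br] lin_hom_add[OF bl])
  then show ?thesis
    using A lin_hom_smult[OF br] lin_hom_smult[OF bl] by (simp add: unital_algebra_def)
qed

lemma mult_right_hom:
  assumes "unital_algebra K A" "x \<in> carrier A" "f \<in> lin_hom K C A"
  shows "(\<lambda>z. x \<otimes>\<^bsub>A\<^esub> f z) \<in> lin_hom K C A"
proof -
  interpret A: ring A by (rule unital_algebra_ring[OF assms(1)])
  have "(\<lambda>y. x \<otimes>\<^bsub>A\<^esub> y) \<in> lin_hom K A A"
    using assms(1,2) by (intro lin_homI) (auto simp: A.r_distr unital_algebra_def)
  from lin_hom_comp[OF assms(3) this] show ?thesis .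
qed

lemma mult_left_hom:
  assumes "unital_algebra K A" "y \<in> carrier A" "f \<in> lin_hom K C A"
  shows "(\<lambda>z. f z \<otimes>\<^bsub>A\<^esub> y) \<in> lin_hom K C A"
proof -
  interpret A: ring A by (rule unital_algebra_ring[OF assms(1)])
  have "(\<lambda>x. x \<otimes>\<^bsub>A\<^esub> y) \<in> lin_hom K A A"
    using assms(1,2) by (intro lin_homI) (auto simp: A.l_distr unital_algebra_def)
  from lin_hom_comp[OF assms(3) this] show ?thesis .
qed

lemma bilin_mult: "unital_algebra K A \<Longrightarrow> bilin K A A A (\<lambda>x y. x \<otimes>\<^bsub>A\<^esub> y)"
  by (intro bilinI mult_right_hom mult_left_hom lin_hom_ident)

lemma tmult_hom: "unital_algebra K A \<Longrightarrow> tmult K A \<in> lin_hom K (tensor K A A) A"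
  unfolding tmult_def by (intro tlift_hom bilin_mult unital_algebra_module)

lemma tmult_tens:
  "unital_algebra K A \<Longrightarrow> x \<in> carrier A \<Longrightarrow> y \<in> carrier A \<Longrightarrow> tmult K A (tens K A A x y) = x \<otimes>\<^bsub>A\<^esub> y"
  unfolding tmult_def by (simp add: tlift_tens[OF _ _ _ bilin_mult] unital_algebra_module)

text \<open>The definition multiplies representatives inside the free space. Moving
  \<open>tclass\<close> through both linear extensions turns it into a nested \<open>tlift\<close>,
  for which independence of representatives is known.\<close>

lemma tensor_mult_eq:
  assumes "unital_algebra K A" "unital_algebra K B"
    "X \<in> carrier (tensor K A B)" "Y \<in> carrier (tensor K A B)"
  shows "X \<otimes>\<^bsub>tensor K A B\<^esub> Y = tlift K (tensor K A B) (\<lambda>x y. tlift K (tensor K A B)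
    (\<lambda>x' y'. tens K A B (x \<otimes>\<^bsub>A\<^esub> x') (y \<otimes>\<^bsub>B\<^esub> y')) Y) X"
proof -
  interpret A: ring A by (rule unital_algebra_ring[OF assms(1)])
  interpret B: ring B by (rule unital_algebra_ring[OF assms(2)])
  note m = unital_algebra_module[OF assms(1)] unital_algebra_module[OF assms(2)]
  let ?F = "free_mod K (carrier A \<times> carrier B)" and ?T = "tensor K A B"
  have r: "rep Z \<in> carrier ?F" if "Z \<in> carrier ?T" for Z
    using coset_rep(1)[OF module_free_mod tensor_ker_submodule[OF m]] that
    by (auto elim!: tensorE)
  let ?m = "\<lambda>p q. (fst p \<otimes>\<^bsub>A\<^esub> fst q, snd p \<otimes>\<^bsub>B\<^esub> snd q)"
  have inner: "(\<lambda>q. bvec K (?m p q)) \<in> carrier A \<times> carrier B \<rightarrow> carrier ?F"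
    if "p \<in> carrier A \<times> carrier B" for p
    using that by auto
  have outer: "(\<lambda>p. lin_ext K ?F (\<lambda>q. bvec K (?m p q)) (rep Y)) \<in> carrier A \<times> carrier B \<rightarrow> carrier ?F"
    using lin_hom_closed[OF lin_ext_hom[OF module_free_mod inner] r[OF assms(4)]] by auto
  note L = lin_hom_lin_ext[OF module_free_mod module_tensor[OF m] tclass_hom[OF m]]
  have "X \<otimes>\<^bsub>?T\<^esub> Y = tclass A B (lin_ext K ?F (\<lambda>p. lin_ext K ?F (\<lambda>q. bvec K (?m p q)) (rep Y)) (rep X))"
    by (simp add: tensor_def Let_def)
  also have "\<dots> = lin_ext K ?T (\<lambda>p. tclass A B (lin_ext K ?F (\<lambda>q. bvec K (?m p q)) (rep Y))) (rep X)"
    by (rule L[OF outer r[OF assms(3)]])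
  also have "\<dots> = lin_ext K ?T (\<lambda>p. lin_ext K ?T (\<lambda>q. tclass A B (bvec K (?m p q))) (rep Y)) (rep X)"
  proof (rule lin_ext_cong[OF module_tensor[OF m] r[OF assms(3)] L[OF inner r[OF assms(4)]]])
    show "(\<lambda>p. lin_ext K ?T (\<lambda>q. tclass A B (bvec K (?m p q))) (rep Y))
        \<in> carrier A \<times> carrier B \<rightarrow> carrier ?T"
    proof
      fix p assume p: "p \<in> carrier A \<times> carrier B"
      have "(\<lambda>q. tclass A B (bvec K (?m p q))) \<in> carrier A \<times> carrier B \<rightarrow> carrier ?T"
      proof
        fix q assume "q \<in> carrier A \<times> carrier B"
        with p have "?m p q \<in> carrier A \<times> carrier B" by auto
        then show "tclass A B (bvec K (?m p q)) \<in> carrier ?T"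
          by (intro lin_hom_closed[OF tclass_hom[OF m]] bvec_closed)
      qed
      then show "lin_ext K ?T (\<lambda>q. tclass A B (bvec K (?m p q))) (rep Y) \<in> carrier ?T"
        by (intro lin_hom_closed[OF lin_ext_hom[OF module_tensor[OF m]] r[OF assms(4)]])
    qed
  qed
  finally show ?thesis unfolding tlift_def tens_def .
qed

lemma tensor_mult_inner:
  assumes "unital_algebra K A" "unital_algebra K B" "x \<in> carrier A" "y \<in> carrier B"
  shows "bilin K A B (tensor K A B) (\<lambda>x' y'. tens K A B (x \<otimes>\<^bsub>A\<^esub> x') (y \<otimes>\<^bsub>B\<^esub> y'))"
proof -
  interpret A: ring A by (rule unital_algebra_ring[OF assms(1)])
  interpret B: ring B by (rule unital_algebra_ring[OF assms(2)])
  show ?thesis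
    by (intro bilinI tens_right_hom tens_left_hom bilin_right[OF bilin_mult]
        A.m_closed B.m_closed assms unital_algebra_module)
qed

lemma tensor_mult_outer:
  assumes "unital_algebra K A" "unital_algebra K B" "Y \<in> carrier (tensor K A B)"
  shows "bilin K A B (tensor K A B) (\<lambda>x y. tlift K (tensor K A B)
    (\<lambda>x' y'. tens K A B (x \<otimes>\<^bsub>A\<^esub> x') (y \<otimes>\<^bsub>B\<^esub> y')) Y)"
proof -
  interpret A: ring A by (rule unital_algebra_ring[OF assms(1)])
  interpret B: ring B by (rule unital_algebra_ring[OF assms(2)])
  note m = unital_algebra_module[OF assms(1)] unital_algebra_module[OF assms(2)]
  show ?thesis
    by (intro bilinI tlift_param_hom[OF m _ _ tensor_mult_inner[OF assms(1,2)] _ assms(3)]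
        tens_right_hom tens_left_hom bilin_left[OF bilin_mult] A.m_closed B.m_closed module_tensor m assms)
qed

lemma tensor_mult_tens:
  assumes "unital_algebra K A" "unital_algebra K B"
    "x \<in> carrier A" "y \<in> carrier B" "x' \<in> carrier A" "y' \<in> carrier B"
  shows "tens K A B x y \<otimes>\<^bsub>tensor K A B\<^esub> tens K A B x' y' = tens K A B (x \<otimes>\<^bsub>A\<^esub> x') (y \<otimes>\<^bsub>B\<^esub> y')"
  using assms
  by (simp add: tensor_mult_eq tens_closed tlift_tens[OF _ _ _ tensor_mult_outer]
      tlift_tens[OF _ _ _ tensor_mult_inner] unital_algebra_module module_tensor)

lemma bilin_tensor_mult:
  assumes "unital_algebra K A" "unital_algebra K B"
  shows "bilin K (tensor K A B) (tensor K A B) (tensor K A B) (\<lambda>X Y. X \<otimes>\<^bsub>tensor K A B\<^esub> Y)"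
proof (rule bilinI)
  note m = unital_algebra_module[OF assms(1)] unital_algebra_module[OF assms(2)]
  note T = module_tensor[OF m]
  fix X assume X: "X \<in> carrier (tensor K A B)"
  show "(\<lambda>Y. X \<otimes>\<^bsub>tensor K A B\<^esub> Y) \<in> lin_hom K (tensor K A B) (tensor K A B)"
    by (rule lin_hom_cong[OF tlift_param_hom[OF m T T tensor_mult_outer tlift_hom X]])
      (use assms X in \<open>auto simp: tensor_mult_eq m T tensor_mult_inner\<close>)
  show "(\<lambda>Y. Y \<otimes>\<^bsub>tensor K A B\<^esub> X) \<in> lin_hom K (tensor K A B) (tensor K A B)"
    by (rule lin_hom_cong[OF tlift_hom[OF m T tensor_mult_outer[OF assms X]] T])
      (use assms X in \<open>auto simp: tensor_mult_eq\<close>)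
qed

end


section \<open>Group algebras\<close>

text \<open>Linear extension reads only these four fields, so extending into \<open>galg\<close> or
  into \<open>ghopf\<close> is the same map.\<close>

lemma gext_struct_cong:
  assumes "carrier V = carrier W" "add V = add W" "zero V = zero W" "smult V = smult W"
  shows "gext K enc V f X = gext K enc W f X"
  unfolding gext_def lin_ext_def assms(4) by (rule finsum_struct_cong[OF assms(1-3)])

locale coded_field = base_field K for K :: "('k, 'm) ring_scheme" +
  fixes enc :: "('u \<Rightarrow> 'k) \<Rightarrow> 'u"
  assumes inj_enc: "inj_on enc (fin_supp K)"
begin

abbreviation "gh \<equiv> ghopf K enc"
abbreviation "gi \<equiv> gincl K enc"
abbreviation "ge \<equiv> gext K enc"

lemma gcoeffs_enc: "c \<in> carrier (free_mod K S) \<Longrightarrow> gcoeffs K enc (enc c) = c"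
  unfolding gcoeffs_def by (rule inv_into_f_f[OF inj_enc]) (simp add: free_mod_def)

lemma galg_simps:
  "carrier (galg K enc G) = carrier (gh G)" "mult (galg K enc G) = mult (gh G)"
  "one (galg K enc G) = one (gh G)" "zero (galg K enc G) = zero (gh G)"
  "add (galg K enc G) = add (gh G)" "smult (galg K enc G) = smult (gh G)"
  by (simp_all add: ghopf_def Let_def)

lemma ghopf_carrier: "carrier (gh G) = enc ` carrier (free_mod K (carrier G))"
  by (simp add: ghopf_def galg_def Let_def)

lemma ghopf_one: "\<one>\<^bsub>gh G\<^esub> = gi \<one>\<^bsub>G\<^esub>"
  by (simp add: ghopf_def galg_def Let_def)

lemma ghopf_zero: "\<zero>\<^bsub>gh G\<^esub> = enc \<zero>\<^bsub>free_mod K (carrier G)\<^esub>"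
  by (simp add: ghopf_def galg_def Let_def)

lemma ghopf_add:
  "c \<in> carrier (free_mod K (carrier G)) \<Longrightarrow> d \<in> carrier (free_mod K (carrier G)) \<Longrightarrow>
     enc c \<oplus>\<^bsub>gh G\<^esub> enc d = enc (c \<oplus>\<^bsub>free_mod K (carrier G)\<^esub> d)"
  by (simp add: ghopf_def galg_def Let_def gcoeffs_enc)

lemma ghopf_smult:
  "c \<in> carrier (free_mod K (carrier G)) \<Longrightarrow>
     k \<odot>\<^bsub>gh G\<^esub> enc c = enc (k \<odot>\<^bsub>free_mod K (carrier G)\<^esub> c)"
  by (simp add: ghopf_def galg_def Let_def gcoeffs_enc)

text \<open>Restates the coproduct over \<open>ghopf\<close> itself, so that it fits the type of the
  coalgebra axioms for that record.\<close>

lemma ghopf_comul: "comul (gh G) = ge (tensor K (gh G) (gh G)) (\<lambda>x. tens K (gh G) (gh G) (gi x) (gi x))"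
proof -
  have "tensor K (galg K enc G) (galg K enc G) = tensor K (gh G) (gh G)"
    by (rule tensor_cong) (simp_all add: galg_simps)
  moreover have "tens K (galg K enc G) (galg K enc G) = tens K (gh G) (gh G)"
    by (rule tens_cong) (simp_all add: galg_simps)
  moreover have "comul (gh G) = ge (tensor K (galg K enc G) (galg K enc G))
      (\<lambda>x. tens K (galg K enc G) (galg K enc G) (gi x) (gi x))"
    by (simp add: ghopf_def Let_def)
  ultimately show ?thesis by simp
qed

lemma ghopf_counit: "counit (gh G) = ge (ground K) (\<lambda>x. \<one>\<^bsub>K\<^esub>)"
  by (simp add: ghopf_def Let_def)

lemma gext_galg: "ge (galg K enc G) f = ge (gh G) f"
  by (rule ext, rule gext_struct_cong) (simp_all add: galg_simps)

lemma ghopf_antipode: "antipode (gh G) = ge (gh G) (\<lambda>x. gi (inv\<^bsub>G\<^esub> x))"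
  unfolding gext_galg[symmetric] by (simp add: ghopf_def Let_def)

lemma ghopfE:
  assumes "X \<in> carrier (gh G)"
  obtains c where "c \<in> carrier (free_mod K (carrier G))" "X = enc c"
  using assms unfolding ghopf_carrier by blast

lemma module_ghopf: "module K (gh G)"
  by (rule module_image[where q = enc, OF module_free_mod ghopf_carrier ghopf_zero]) (simp_all add: ghopf_add ghopf_smult)

lemma enc_hom: "enc \<in> lin_hom K (free_mod K (carrier G)) (gh G)"
  by (rule lin_homI) (simp_all add: ghopf_carrier ghopf_add ghopf_smult)

lemma gcoeffs_hom: "gcoeffs K enc \<in> lin_hom K (gh G) (free_mod K (carrier G))"
proof (rule lin_homI)
  interpret F: module K "free_mod K (carrier G)" by (rule module_free_mod)
  fix X Y k assume X: "X \<in> carrier (gh G)"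
  then show "gcoeffs K enc X \<in> carrier (free_mod K (carrier G))"
    by (auto elim!: ghopfE simp: gcoeffs_enc)
  show "gcoeffs K enc (X \<oplus>\<^bsub>gh G\<^esub> Y) = gcoeffs K enc X \<oplus>\<^bsub>free_mod K (carrier G)\<^esub> gcoeffs K enc Y"
    if "Y \<in> carrier (gh G)"
    using X that by (auto elim!: ghopfE simp: gcoeffs_enc ghopf_add gcoeffs_enc[OF F.add.m_closed])
  show "gcoeffs K enc (k \<odot>\<^bsub>gh G\<^esub> X) = k \<odot>\<^bsub>free_mod K (carrier G)\<^esub> gcoeffs K enc X" if "k \<in> carrier K"
    using X that by (auto elim!: ghopfE simp: gcoeffs_enc ghopf_smult gcoeffs_enc[OF F.smult_closed])
qed

lemma gincl_closed: "x \<in> carrier G \<Longrightarrow> gi x \<in> carrier (gh G)"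
  by (simp add: gincl_def ghopf_carrier)

lemma gcoeffs_gincl: "gcoeffs K enc (gi x) = bvec K x"
  unfolding gincl_def by (rule gcoeffs_enc[of _ UNIV]) simp

text \<open>After decoding, two basis vectors are compared at \<open>x\<close>, where 1 and 0 differ
  in a field.\<close>

lemma gincl_inj: "gi x = gi y \<Longrightarrow> x = y"
  using gcoeffs_gincl[of x] gcoeffs_gincl[of y] K.one_not_zero
  by (metis bvec_def)

lemma gext_hom:
  assumes "module K V" "f \<in> carrier G \<rightarrow> carrier V"
  shows "ge V f \<in> lin_hom K (gh G) V"
  using lin_hom_comp[OF gcoeffs_hom lin_ext_hom[OF assms]] by (simp add: gext_def[abs_def])

lemma gext_gincl: "module K V \<Longrightarrow> f x \<in> carrier V \<Longrightarrow> ge V f (gi x) = f x"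
  by (simp add: gext_def gcoeffs_gincl lin_ext_bvec)

lemma ghopf_span: "carrier (gh G) = lin_span K (gh G) (gi ` carrier G)"
proof -
  have "carrier (gh G) = lin_span K (gh G) (enc ` (bvec K ` carrier G))"
    by (rule lin_span_eq_carrier_image[OF module_free_mod module_ghopf enc_hom])
      (auto simp: ghopf_carrier free_mod_span[symmetric])
  then show ?thesis by (simp add: image_image gincl_def)
qed

lemma gincl_image: "gi ` carrier G \<subseteq> carrier (gh G)"
  using gincl_closed by auto

lemma ghopf_hom_eq:
  assumes "module K W" "f \<in> lin_hom K (gh G) W" "g \<in> lin_hom K (gh G) W"
    "\<And>x. x \<in> carrier G \<Longrightarrow> f (gi x) = g (gi x)" "X \<in> carrier (gh G)"
  shows "f X = g X"
  by (rule lin_hom_eq_on_span[OF module_ghopf assms(1-3) gincl_image])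
    (use assms(4,5) ghopf_span in auto)

text \<open>The counterpart of \<open>tlift_param_hom\<close> for linear extension from a group; it
  gives linearity of the product and of the action of \<open>P\<close> in the argument of the inner
  extension.\<close>

lemma gext_param_hom:
  assumes "module K C" "module K V"
    and \<gamma>: "\<And>z x. z \<in> carrier C \<Longrightarrow> x \<in> carrier G \<Longrightarrow> \<gamma> z x \<in> carrier V"
    and lin: "\<And>x. x \<in> carrier G \<Longrightarrow> (\<lambda>z. \<gamma> z x) \<in> lin_hom K C V"
    and X: "X \<in> carrier (gh G)"
  shows "(\<lambda>z. ge V (\<gamma> z) X) \<in> lin_hom K C V"
proof (rule lin_hom_param_span[OF assms(1) module_ghopf assms(2) gincl_image X[unfolded ghopf_span]])
  show "ge V (\<gamma> z) \<in> lin_hom K (gh G) V" if "z \<in> carrier C" for z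
    by (rule gext_hom[OF assms(2)]) (use \<gamma> that in auto)
  fix t assume "t \<in> gi ` carrier G"
  then obtain x where t: "t = gi x" and x: "x \<in> carrier G" by auto
  show "(\<lambda>z. ge V (\<gamma> z) t) \<in> lin_hom K C V" unfolding t
    by (rule lin_hom_cong[OF lin[OF x] assms(1)]) (simp add: gext_gincl assms(2) \<gamma> x)
qed

text \<open>The product is defined on decoded coefficient functions. Moving \<open>enc\<close>
  through both linear extensions removes the decoding and leaves nested extensions, whose linearity
  is known.\<close>

lemma ghopf_mult:
  assumes "monoid G" "X \<in> carrier (gh G)" "Y \<in> carrier (gh G)"
  shows "X \<otimes>\<^bsub>gh G\<^esub> Y = ge (gh G) (\<lambda>x. ge (gh G) (\<lambda>y. gi (x \<otimes>\<^bsub>G\<^esub> y)) Y) X"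
proof -
  interpret G: monoid G by fact
  let ?F = "free_mod K (carrier G)" and ?c = "gcoeffs K enc"
  note r = lin_hom_closed[OF gcoeffs_hom]
  have inner: "(\<lambda>y. bvec K (x \<otimes>\<^bsub>G\<^esub> y)) \<in> carrier G \<rightarrow> carrier ?F" if "x \<in> carrier G" for x
    using that by auto
  have outer: "(\<lambda>x. lin_ext K ?F (\<lambda>y. bvec K (x \<otimes>\<^bsub>G\<^esub> y)) (?c Y)) \<in> carrier G \<rightarrow> carrier ?F"
    using lin_hom_closed[OF lin_ext_hom[OF module_free_mod inner] r[OF assms(3)]] by auto
  note L = lin_hom_lin_ext[OF module_free_mod module_ghopf enc_hom]
  have "X \<otimes>\<^bsub>gh G\<^esub> Y = enc (lin_ext K ?F (\<lambda>x. lin_ext K ?F (\<lambda>y. bvec K (x \<otimes>\<^bsub>G\<^esub> y)) (?c Y)) (?c X))"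
    by (simp add: ghopf_def galg_def Let_def)
  also have "\<dots> = lin_ext K (gh G) (\<lambda>x. enc (lin_ext K ?F (\<lambda>y. bvec K (x \<otimes>\<^bsub>G\<^esub> y)) (?c Y))) (?c X)"
    by (rule L[OF outer r[OF assms(2)]])
  also have "\<dots> = lin_ext K (gh G) (\<lambda>x. lin_ext K (gh G) (\<lambda>y. gi (x \<otimes>\<^bsub>G\<^esub> y)) (?c Y)) (?c X)"
  proof (rule lin_ext_cong[OF module_ghopf r[OF assms(2)]])
    show "enc (lin_ext K ?F (\<lambda>y. bvec K (x \<otimes>\<^bsub>G\<^esub> y)) (?c Y)) = lin_ext K (gh G) (\<lambda>y. gi (x \<otimes>\<^bsub>G\<^esub> y)) (?c Y)"
      if "x \<in> carrier G" for x
      unfolding gincl_def by (rule L[OF inner[OF that] r[OF assms(3)]])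
    show "(\<lambda>x. lin_ext K (gh G) (\<lambda>y. gi (x \<otimes>\<^bsub>G\<^esub> y)) (?c Y)) \<in> carrier G \<rightarrow> carrier (gh G)"
      by (rule Pi_I, rule lin_hom_closed[OF lin_ext_hom[OF module_ghopf] r[OF assms(3)]])
        (simp add: gincl_closed)
  qed
  finally show ?thesis by (simp add: gext_def)
qed

lemma ghopf_mult_gincl:
  assumes "monoid G" "x \<in> carrier G" "y \<in> carrier G"
  shows "gi x \<otimes>\<^bsub>gh G\<^esub> gi y = gi (x \<otimes>\<^bsub>G\<^esub> y)"
proof -
  interpret G: monoid G by fact
  show ?thesis using assms
    by (simp add: ghopf_mult gincl_closed gext_gincl module_ghopf)
qed

lemma bilin_ghopf_mult:
  assumes "monoid G"
  shows "bilin K (gh G) (gh G) (gh G) (\<lambda>x y. x \<otimes>\<^bsub>gh G\<^esub> y)"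
proof (rule bilinI)
  interpret G: monoid G by fact
  have in1: "ge (gh G) (\<lambda>y. gi (x \<otimes>\<^bsub>G\<^esub> y)) \<in> lin_hom K (gh G) (gh G)" if "x \<in> carrier G" for x
    using that by (intro gext_hom module_ghopf) (auto simp: gincl_closed)
  fix X assume X: "X \<in> carrier (gh G)"
  show "(\<lambda>Y. X \<otimes>\<^bsub>gh G\<^esub> Y) \<in> lin_hom K (gh G) (gh G)"
    by (rule lin_hom_cong[OF gext_param_hom[OF module_ghopf module_ghopf _ _ X] module_ghopf])
      (use assms X in \<open>auto simp: ghopf_mult intro: lin_hom_closed[OF in1] in1\<close>)
  show "(\<lambda>Y. Y \<otimes>\<^bsub>gh G\<^esub> X) \<in> lin_hom K (gh G) (gh G)"
    by (rule lin_hom_cong[OF gext_hom[OF module_ghopf] module_ghopf])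
      (use assms X in \<open>auto simp: ghopf_mult lin_hom_closed[OF in1]\<close>)
qed

lemma unital_algebra_ghopf:
  assumes "monoid G"
  shows "unital_algebra K (gh G)"
proof -
  interpret G: monoid G by fact
  show ?thesis
    by (rule unital_algebraI_span[OF module_ghopf bilin_ghopf_mult[OF assms] gincl_image ghopf_span])
      (auto simp: ghopf_one gincl_closed ghopf_mult_gincl assms G.m_assoc)
qed

end

section \<open>Group-like elements of Hopf algebras\<close>

context base_field
begin

lemma tensor_one: "\<one>\<^bsub>tensor K A B\<^esub> = tens K A B \<one>\<^bsub>A\<^esub> \<one>\<^bsub>B\<^esub>"
  by (simp add: tensor_def tens_def Let_def)

lemma unital_algebra_tensor:
  assumes "unital_algebra K A" "unital_algebra K B"
  shows "unital_algebra K (tensor K A B)"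
proof -
  interpret A: ring A by (rule unital_algebra_ring[OF assms(1)])
  interpret B: ring B by (rule unital_algebra_ring[OF assms(2)])
  note m = unital_algebra_module[OF assms(1)] unital_algebra_module[OF assms(2)]
  show ?thesis
    by (rule unital_algebraI_span[OF module_tensor[OF m] bilin_tensor_mult[OF assms] _ tensor_span[OF m]])
      (auto simp: tensor_one tens_closed tensor_mult_tens[OF assms] A.m_assoc B.m_assoc)
qed

lemma ground_simps [simp]:
  "carrier (ground K) = carrier K" "add (ground K) = add K" "smult (ground K) = mult K"
  "zero (ground K) = zero K"
  by (simp_all add: ground_def)

lemma scalar_hom:
  assumes "module K V" "v \<in> carrier V" "f \<in> lin_hom K C (ground K)"
  shows "(\<lambda>x. f x \<odot>\<^bsub>V\<^esub> v) \<in> lin_hom K C V"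
proof -
  interpret V: module K V by fact
  have "(\<lambda>k. k \<odot>\<^bsub>V\<^esub> v) \<in> lin_hom K (ground K) V"
    using assms(2) by (intro lin_homI) (auto simp: V.smult_l_distr V.smult_assoc1)
  from lin_hom_comp[OF assms(3) this] show ?thesis .
qed

lemma bilin_scalar:
  assumes "module K A" "module K V" "f \<in> lin_hom K A (ground K)"
  shows "bilin K A V V (\<lambda>x v. f x \<odot>\<^bsub>V\<^esub> v)"
  by (intro bilinI scalar_hom lin_hom_smult_left lin_hom_ident assms
      lin_hom_closed[OF assms(3), simplified])

lemma bilin_scalar_swap:
  assumes "module K A" "module K V" "f \<in> lin_hom K A (ground K)"
  shows "bilin K V A V (\<lambda>v x. f x \<odot>\<^bsub>V\<^esub> v)"
  by (intro bilinI scalar_hom lin_hom_smult_left lin_hom_ident assms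
      lin_hom_closed[OF assms(3), simplified])

lemma coalgebraD:
  assumes "coalgebra K C"
  shows "module K C" "comul C \<in> lin_hom K C (tensor K C C)" "counit C \<in> lin_hom K C (ground K)"
  using assms by (simp_all add: coalgebra_def)

lemma counit_left:
  assumes "coalgebra K C" "x \<in> carrier C"
  shows "tlift K C (\<lambda>y z. counit C y \<odot>\<^bsub>C\<^esub> z) (comul C x) = x"
  using assms by (simp add: coalgebra_def)

lemma hopf_algebraD:
  assumes "hopf_algebra K H"
  shows "module K H" "unital_algebra K H" "coalgebra K H" "comul H \<in> lin_hom K H (tensor K H H)"
    "counit H \<in> lin_hom K H (ground K)" "comul H \<in> ring_hom H (tensor K H H)"
    "counit H \<in> ring_hom H K" "antipode H \<in> lin_hom K H H" "ring H"
  using assms by (simp_all add: hopf_algebra_def coalgebra_def unital_algebra_def)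

abbreviation "gls H \<equiv> carrier (grouplikes K H)"

lemma grouplikes_carrier:
  "x \<in> gls H \<longleftrightarrow> x \<in> carrier H \<and> comul H x = tens K H H x x \<and> counit H x = \<one>\<^bsub>K\<^esub>"
  by (simp add: grouplikes_def)

lemma grouplikes_simps [simp]: "mult (grouplikes K H) = mult H" "one (grouplikes K H) = one H"
  by (simp_all add: grouplikes_def)

text \<open>Coproduct and counit are multiplicative, and pure tensors multiply
  componentwise.\<close>

lemma grouplikes_mult:
  assumes "hopf_algebra K H" "x \<in> gls H" "y \<in> gls H"
  shows "x \<otimes>\<^bsub>H\<^esub> y \<in> gls H"
proof -
  note H = hopf_algebraD[OF assms(1)]
  interpret H: ring H by (rule H)
  show ?thesis using assms(2,3) ring_hom_mult[OF H(6)] ring_hom_mult[OF H(7)]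
    by (simp add: grouplikes_carrier tensor_mult_tens[OF H(2) H(2)])
qed

lemma grouplikes_one:
  assumes "hopf_algebra K H"
  shows "\<one>\<^bsub>H\<^esub> \<in> gls H"
proof -
  note H = hopf_algebraD[OF assms(1)]
  interpret H: ring H by (rule H)
  show ?thesis using ring_hom_one[OF H(6)] ring_hom_one[OF H(7)]
    by (simp add: grouplikes_carrier tensor_one)
qed

text \<open>For group-like \<open>x\<close> the coproduct is a pure tensor and the counit is 1, so
  the two antipode axioms become the two inverse laws.\<close>

lemma antipode_grouplike_inv:
  assumes "hopf_algebra K H" "x \<in> gls H"
  shows "antipode H x \<otimes>\<^bsub>H\<^esub> x = \<one>\<^bsub>H\<^esub>" "x \<otimes>\<^bsub>H\<^esub> antipode H x = \<one>\<^bsub>H\<^esub>"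
proof -
  note H = hopf_algebraD[OF assms(1)]
  interpret H: ring H by (rule H)
  interpret V: module K H by (rule H)
  have x: "x \<in> carrier H" "comul H x = tens K H H x x" "counit H x = \<one>\<^bsub>K\<^esub>"
    using assms(2) by (simp_all add: grouplikes_carrier)
  have s: "antipode H x \<in> carrier H" using lin_hom_closed[OF H(8) x(1)] .
  have "tmult K H (tmap K H H (antipode H) id (comul H x)) = counit H x \<odot>\<^bsub>H\<^esub> \<one>\<^bsub>H\<^esub>"
    "tmult K H (tmap K H H id (antipode H) (comul H x)) = counit H x \<odot>\<^bsub>H\<^esub> \<one>\<^bsub>H\<^esub>"
    using assms(1) x(1) by (simp_all add: hopf_algebra_def)
  then show "antipode H x \<otimes>\<^bsub>H\<^esub> x = \<one>\<^bsub>H\<^esub>" "x \<otimes>\<^bsub>H\<^esub> antipode H x = \<one>\<^bsub>H\<^esub>"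
    using x s by (simp_all add: tmap_tens[OF H(1) H(1) H(1) H(1)] H lin_hom_id tmult_tens)
qed

text \<open>In the tensor product algebra the coproduct of \<open>antipode H x\<close> is a left
  inverse of \<open>x \<otimes> x\<close>, and \<open>antipode H x \<otimes> antipode H x\<close> is
  a right inverse. Uniqueness of inverses identifies them, without a general formula for the
  coproduct of an antipode.\<close>

lemma antipode_grouplike:
  assumes "hopf_algebra K H" "x \<in> gls H"
  shows "antipode H x \<in> gls H"
proof -
  note H = hopf_algebraD[OF assms(1)]
  let ?T = "tensor K H H"
  interpret H: ring H by (rule H)
  interpret T: ring ?T by (rule unital_algebra_ring[OF unital_algebra_tensor[OF H(2) H(2)]])
  note inv = antipode_grouplike_inv[OF assms]
  have x: "x \<in> carrier H" "comul H x = tens K H H x x" "counit H x = \<one>\<^bsub>K\<^esub>"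
    using assms(2) by (simp_all add: grouplikes_carrier)
  have s: "antipode H x \<in> carrier H" using lin_hom_closed[OF H(8) x(1)] .
  note c = tens_closed[OF x(1) x(1)] tens_closed[OF s s] lin_hom_closed[OF H(4) s]
  have 1: "comul H (antipode H x) \<otimes>\<^bsub>?T\<^esub> tens K H H x x = \<one>\<^bsub>?T\<^esub>"
    using ring_hom_mult[OF H(6) s x(1)] ring_hom_one[OF H(6)] by (simp add: inv x(2))
  have 2: "tens K H H x x \<otimes>\<^bsub>?T\<^esub> tens K H H (antipode H x) (antipode H x) = \<one>\<^bsub>?T\<^esub>"
    using x s by (simp add: tensor_mult_tens[OF H(2) H(2)] inv tensor_one)
  have "comul H (antipode H x) = tens K H H (antipode H x) (antipode H x)"
    using T.inv_unique[OF 1 2 c(1) c(3) c(2)] .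
  moreover have "counit H (antipode H x) = \<one>\<^bsub>K\<^esub>"
    using ring_hom_mult[OF H(7) s x(1)] ring_hom_one[OF H(7)] lin_hom_closed[OF H(5) s]
    by (simp add: inv x(3))
  ultimately show ?thesis using s by (simp add: grouplikes_carrier)
qed

lemma group_grouplikes:
  assumes "hopf_algebra K H"
  shows "group (grouplikes K H)"
proof -
  interpret H: ring H by (rule hopf_algebraD[OF assms])
  have c: "x \<in> carrier H" if "x \<in> gls H" for x
    using that by (simp add: grouplikes_carrier)
  show ?thesis
    by (rule groupI) (auto simp: grouplikes_mult[OF assms] grouplikes_one[OF assms] c H.m_assoc
        intro!: bexI[OF _ antipode_grouplike[OF assms]] antipode_grouplike_inv[OF assms])
qed

lemma inv_grouplikes:
  assumes "hopf_algebra K H" "x \<in> gls H"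
  shows "inv\<^bsub>grouplikes K H\<^esub> x = antipode H x"
proof -
  interpret G: group "grouplikes K H" by (rule group_grouplikes[OF assms(1)])
  show ?thesis
    using G.inv_equality[of "antipode H x" x] antipode_grouplike[OF assms] antipode_grouplike_inv[OF assms] assms
    by simp
qed

section \<open>Coalgebra morphisms and Hopf algebra morphisms\<close>

lemma coalg_homD:
  assumes "f \<in> coalg_hom K C D"
  shows "f \<in> lin_hom K C D" "x \<in> carrier C \<Longrightarrow> comul D (f x) = tmap K D D f f (comul C x)"
    "x \<in> carrier C \<Longrightarrow> counit D (f x) = counit C x"
  using assms by (auto simp: coalg_hom_def)

lemma coalg_hom_grouplike:
  assumes "coalgebra K C" "coalgebra K D" "f \<in> coalg_hom K C D" "x \<in> gls C"
  shows "f x \<in> gls D"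
proof -
  note C = coalgebraD[OF assms(1)] and D = coalgebraD[OF assms(2)]
  note f = coalg_homD[OF assms(3)]
  show ?thesis using assms(4) f lin_hom_closed[OF f(1)]
    by (simp add: grouplikes_carrier tmap_tens[OF C(1) C(1) D(1) D(1)])
qed

text \<open>Membership in \<open>hopf_hom\<close> asks for an extensional function. Restriction
  achieves this and keeps the other conditions, which only see values on the carrier; for
  \<open>tmap\<close> this is \<open>tmap_cong\<close>.\<close>

lemma hopf_homI:
  assumes "hopf_algebra K H" "f \<in> coalg_hom K H H'" "f \<in> ring_hom H H'" "hopf_algebra K H'"
  shows "restrict f (carrier H) \<in> hopf_hom K H H'"
proof -
  note H = hopf_algebraD[OF assms(1)] and H' = hopf_algebraD[OF assms(4)]
  interpret H: ring H by (rule H)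
  note f = coalg_homD[OF assms(2)]
  have "tmap K H' H' (restrict f (carrier H)) (restrict f (carrier H)) (comul H x) = tmap K H' H' f f (comul H x)"
    if "x \<in> carrier H" for x
    by (rule tmap_cong[OF H(1) H(1) H'(1) H'(1) f(1) f(1) _ _ lin_hom_closed[OF H(4) that]]) simp_all
  then have "restrict f (carrier H) \<in> coalg_hom K H H'"
    using f(2,3) lin_hom_restrict[OF f(1) H(1)] by (simp add: coalg_hom_def)
  moreover have "restrict f (carrier H) \<in> ring_hom H H'"
    using assms(3) by (auto simp: ring_hom_def)
  ultimately show ?thesis by (simp add: hopf_hom_def)
qed

lemma hopf_homD:
  assumes "f \<in> hopf_hom K H H'"
  shows "f \<in> coalg_hom K H H'" "f \<in> ring_hom H H'" "f \<in> extensional (carrier H)" "f \<in> lin_hom K H H'"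
  using assms by (auto simp: hopf_hom_def coalg_hom_def)

end

section \<open>Group Hopf algebras\<close>

context coded_field
begin

lemma comul_ghopf_hom: "comul (gh G) \<in> lin_hom K (gh G) (tensor K (gh G) (gh G))"
  unfolding ghopf_comul
  by (intro gext_hom module_tensor module_ghopf) (simp add: tens_closed gincl_closed)

lemma comul_gincl: "x \<in> carrier G \<Longrightarrow> comul (gh G) (gi x) = tens K (gh G) (gh G) (gi x) (gi x)"
  unfolding ghopf_comul by (simp add: gext_gincl module_tensor module_ghopf tens_closed gincl_closed)

lemma counit_ghopf_hom: "counit (gh G) \<in> lin_hom K (gh G) (ground K)"
  unfolding ghopf_counit by (intro gext_hom module_ground) simp

lemma counit_gincl: "counit (gh G) (gi x) = \<one>\<^bsub>K\<^esub>"
  unfolding ghopf_counit by (simp add: gext_gincl module_ground)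

lemma antipode_ghopf_hom:
  assumes "group G" shows "antipode (gh G) \<in> lin_hom K (gh G) (gh G)"
proof -
  interpret G: group G by fact
  show ?thesis unfolding ghopf_antipode by (intro gext_hom module_ghopf) (simp add: gincl_closed)
qed

lemma antipode_gincl:
  assumes "group G" "x \<in> carrier G" shows "antipode (gh G) (gi x) = gi (inv\<^bsub>G\<^esub> x)"
proof -
  interpret G: group G by fact
  show ?thesis unfolding ghopf_antipode using assms(2)
    by (simp add: gext_gincl module_ghopf gincl_closed)
qed

lemma coalgebra_ghopf: "coalgebra K (gh G)"
proof -
  let ?H = "gh G"
  note M = module_ghopf[of G] module_tensor[OF module_ghopf[of G] module_ghopf[of G]]
    module_tensor[OF module_ghopf[of G] module_tensor[OF module_ghopf[of G] module_ghopf[of G]]]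
  note cm = comul_ghopf_hom[of G] and cu = counit_ghopf_hom[of G]
  note S = comul_gincl gincl_closed tens_closed M
  have "tassoc K ?H ?H ?H (tmap K (tensor K ?H ?H) ?H (comul ?H) id (comul ?H X)) =
      tmap K ?H (tensor K ?H ?H) id (comul ?H) (comul ?H X)" if X: "X \<in> carrier ?H" for X
    by (rule ghopf_hom_eq[OF M(3) lin_hom_comp[OF lin_hom_comp[OF cm tmap_hom[OF M(1,1,2,1) cm lin_hom_id]]
          tassoc_hom[OF M(1,1,1)]] lin_hom_comp[OF cm tmap_hom[OF M(1,1,1,2) lin_hom_id cm]] _ X])
      (simp add: S tmap_tens[OF M(1,1,2,1) cm lin_hom_id] tmap_tens[OF M(1,1,1,2) lin_hom_id cm]
          tassoc_tens)
  moreover have "tlift K ?H (\<lambda>y z. counit ?H y \<odot>\<^bsub>?H\<^esub> z) (comul ?H X) = X" if X: "X \<in> carrier ?H" for X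
  proof (rule ghopf_hom_eq[OF M(1) lin_hom_comp[OF cm tlift_hom[OF M(1,1,1) bilin_scalar[OF M(1,1) cu]]]
        lin_hom_ident _ X])
    interpret H: module K ?H by (rule M)
    fix x assume "x \<in> carrier G"
    then show "tlift K ?H (\<lambda>y z. counit ?H y \<odot>\<^bsub>?H\<^esub> z) (comul ?H (gi x)) = gi x"
      by (simp add: S tlift_tens[OF M(1,1,1) bilin_scalar[OF M(1,1) cu]] counit_gincl)
  qed
  moreover have "tlift K ?H (\<lambda>y z. counit ?H z \<odot>\<^bsub>?H\<^esub> y) (comul ?H X) = X" if X: "X \<in> carrier ?H" for X
  proof (rule ghopf_hom_eq[OF M(1) lin_hom_comp[OF cm tlift_hom[OF M(1,1,1) bilin_scalar_swap[OF M(1,1) cu]]]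
        lin_hom_ident _ X])
    interpret H: module K ?H by (rule M)
    fix x assume "x \<in> carrier G"
    then show "tlift K ?H (\<lambda>y z. counit ?H z \<odot>\<^bsub>?H\<^esub> y) (comul ?H (gi x)) = gi x"
      by (simp add: S tlift_tens[OF M(1,1,1) bilin_scalar_swap[OF M(1,1) cu]] counit_gincl)
  qed
  ultimately show ?thesis using M cm cu by (simp add: coalgebra_def)
qed

text \<open>Multiplicativity spreads from group elements to one factor and then to the other. It
  serves for the coproduct, the counit and the extension of a group morphism alike.\<close>

lemma ring_hom_ghopfI:
  assumes "monoid G" "unital_algebra K A" "f \<in> lin_hom K (gh G) A"
    and one: "f (gi \<one>\<^bsub>G\<^esub>) = \<one>\<^bsub>A\<^esub>"
    and mult: "\<And>x y. x \<in> carrier G \<Longrightarrow> y \<in> carrier G \<Longrightarrow> f (gi (x \<otimes>\<^bsub>G\<^esub> y)) = f (gi x) \<otimes>\<^bsub>A\<^esub> f (gi y)"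
  shows "f \<in> ring_hom (gh G) A"
proof (rule ring_hom_memI)
  note A = unital_algebra_module[OF assms(2)]
  interpret A: ring A by (rule unital_algebra_ring[OF assms(2)])
  interpret G: monoid G by fact
  note b = bilin_ghopf_mult[OF assms(1)]
  note br = bilin_right[OF b] and bl = bilin_left[OF b]
  note fc = lin_hom_closed[OF assms(3)]
  have 1: "f (gi x \<otimes>\<^bsub>gh G\<^esub> Y) = f (gi x) \<otimes>\<^bsub>A\<^esub> f Y" if "x \<in> carrier G" "Y \<in> carrier (gh G)" for x Y
    by (rule ghopf_hom_eq[OF A lin_hom_comp[OF br assms(3)] mult_right_hom[OF assms(2) fc assms(3)] _ that(2)])
      (use that in \<open>simp_all add: gincl_closed ghopf_mult_gincl assms(1) mult\<close>)
  fix X Y assume XY: "X \<in> carrier (gh G)" "Y \<in> carrier (gh G)"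
  show "f (X \<otimes>\<^bsub>gh G\<^esub> Y) = f X \<otimes>\<^bsub>A\<^esub> f Y"
    by (rule ghopf_hom_eq[OF A lin_hom_comp[OF bl assms(3)] mult_left_hom[OF assms(2) fc assms(3)] _ XY(1)])
      (use XY in \<open>simp_all add: 1\<close>)
  show "f (X \<oplus>\<^bsub>gh G\<^esub> Y) = f X \<oplus>\<^bsub>A\<^esub> f Y" using lin_hom_add[OF assms(3) XY] .
qed (simp_all add: lin_hom_closed[OF assms(3)] ghopf_one one)

lemma unital_algebra_ground: "unital_algebra K (ground K)"
proof -
  have "ring (ground K)"
    by (rule ringI) (auto simp: ground_def K.l_distr K.r_distr K.m_assoc
      intro!: abelian_groupI monoidI K.a_assoc K.a_comm K.add.l_inv_ex)
  then show ?thesis using module_ground by (auto simp: unital_algebra_def ground_def K.m_ac)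
qed

lemma hopf_algebra_ghopf:
  assumes "group G"
  shows "hopf_algebra K (gh G)"
proof -
  let ?H = "gh G"
  interpret G: group G by fact
  note m = G.monoid_axioms
  note U = unital_algebra_ghopf[OF m]
  note M = module_ghopf[of G]
  interpret H: module K ?H by (rule M)
  note ah = antipode_ghopf_hom[OF assms] and cm = comul_ghopf_hom[of G] and cu = counit_ghopf_hom[of G]
  have "comul ?H \<in> ring_hom ?H (tensor K ?H ?H)"
    by (rule ring_hom_ghopfI[OF m unital_algebra_tensor[OF U U] cm])
      (simp_all add: comul_gincl tensor_one ghopf_one tensor_mult_tens[OF U U] gincl_closed ghopf_mult_gincl m)
  moreover have "counit ?H \<in> ring_hom ?H (ground K)"
    by (rule ring_hom_ghopfI[OF m unital_algebra_ground cu])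
      (simp_all add: counit_gincl, simp_all add: ground_def)
  \<comment> \<open>\<open>ring_hom\<close> looks only at fields that \<open>ground K\<close> copies
    from \<open>K\<close>.\<close>
  then have "counit ?H \<in> ring_hom ?H K" by (simp add: ring_hom_def ground_def)
  moreover have "tmult K ?H (tmap K ?H ?H (antipode ?H) id (comul ?H X)) = counit ?H X \<odot>\<^bsub>?H\<^esub> \<one>\<^bsub>?H\<^esub>"
    if X: "X \<in> carrier ?H" for X
    by (rule ghopf_hom_eq[OF M lin_hom_comp[OF cm lin_hom_comp[OF tmap_hom[OF M M M M ah lin_hom_id] tmult_hom[OF U]]]
          scalar_hom[OF M _ cu] _ X])
      (simp_all add: comul_gincl tmap_tens[OF M M M M ah lin_hom_id] gincl_closed ghopf_one counit_gincl
        antipode_gincl assms tmult_tens[OF U] ghopf_mult_gincl m)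
  moreover have "tmult K ?H (tmap K ?H ?H id (antipode ?H) (comul ?H X)) = counit ?H X \<odot>\<^bsub>?H\<^esub> \<one>\<^bsub>?H\<^esub>"
    if X: "X \<in> carrier ?H" for X
    by (rule ghopf_hom_eq[OF M lin_hom_comp[OF cm lin_hom_comp[OF tmap_hom[OF M M M M lin_hom_id ah] tmult_hom[OF U]]]
          scalar_hom[OF M _ cu] _ X])
      (simp_all add: comul_gincl tmap_tens[OF M M M M lin_hom_id ah] gincl_closed ghopf_one counit_gincl
        antipode_gincl assms tmult_tens[OF U] ghopf_mult_gincl m)
  ultimately show ?thesis
    using U coalgebra_ghopf ah by (simp add: hopf_algebra_def)
qed

lemma gincl_grouplike: "x \<in> carrier G \<Longrightarrow> gi x \<in> gls (gh G)"
  by (simp add: grouplikes_carrier gincl_closed comul_gincl counit_gincl)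

text \<open>Universal property of the group algebra. On a group element compatibility with coproduct
  and counit says that \<open>f x\<close> is group-like, and multiplicativity is that of
  \<open>f\<close>.\<close>

lemma gext_hopf_hom:
  assumes "group G" "hopf_algebra K H" "f \<in> hom G (grouplikes K H)"
  shows "restrict (ge H f) (carrier (gh G)) \<in> hopf_hom K (gh G) H"
proof -
  interpret G: group G by fact
  interpret L: group "grouplikes K H" by (rule group_grouplikes[OF assms(2)])
  interpret f: group_hom G "grouplikes K H" f
    by (intro group_hom.intro group_hom_axioms.intro assms G.group_axioms L.group_axioms)
  note H = hopf_algebraD[OF assms(2)] and G = hopf_algebraD[OF hopf_algebra_ghopf[OF assms(1)]]
  have fl: "f x \<in> gls H" if "x \<in> carrier G" for x using that by simp
  have fc: "f x \<in> carrier H" "comul H (f x) = tens K H H (f x) (f x)" "counit H (f x) = \<one>\<^bsub>K\<^esub>"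
    if "x \<in> carrier G" for x
    using fl[OF that] by (simp_all add: grouplikes_carrier)
  have g: "ge H f (gi x) = f x" if "x \<in> carrier G" for x
    using that by (simp add: gext_gincl H(1) fc)
  have gh: "ge H f \<in> lin_hom K (gh G) H" by (rule gext_hom[OF H(1)]) (use fc in auto)
  have "comul H (ge H f X) = tmap K H H (ge H f) (ge H f) (comul (gh G) X)" if X: "X \<in> carrier (gh G)" for X
    by (rule ghopf_hom_eq[OF module_tensor[OF H(1) H(1)] lin_hom_comp[OF gh H(4)]
          lin_hom_comp[OF G(4) tmap_hom[OF G(1) G(1) H(1) H(1) gh gh]] _ X])
      (simp add: g fc comul_gincl gincl_closed tmap_tens[OF G(1) G(1) H(1) H(1) gh gh])
  moreover have "counit H (ge H f X) = counit (gh G) X" if X: "X \<in> carrier (gh G)" for X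
    by (rule ghopf_hom_eq[OF module_ground lin_hom_comp[OF gh H(5)] G(5) _ X])
      (simp add: g fc counit_gincl)
  ultimately have "ge H f \<in> coalg_hom K (gh G) H" using gh by (simp add: coalg_hom_def)
  moreover have "ge H f \<in> ring_hom (gh G) H"
    by (rule ring_hom_ghopfI[OF G.monoid_axioms H(2) gh]) (simp_all add: g f.hom_one[simplified] f.hom_mult[simplified])
  ultimately show ?thesis by (rule hopf_homI[OF hopf_algebra_ghopf[OF assms(1)] _ _ assms(2)])
qed

end

section \<open>Coalgebras with a basis of group-like elements\<close>

text \<open>Linear independence is encoded by \<open>M\<close>: a linear map with
  \<open>M (i s) = bvec K s\<close> is a system of coordinates dual to the basis. The map
  \<open>i\<close> covers both uses, \<open>gi\<close> on a group and the identity on a set of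
  group-like elements.\<close>

locale grouplike_basis = base_field K for K :: "('k, 'm) ring_scheme" +
  fixes C :: "('k, 'a, 'c) coalg_scheme" and S :: "'s set" and i :: "'s \<Rightarrow> 'a" and M :: "'a \<Rightarrow> 's \<Rightarrow> 'k"
  assumes coalgebra_C: "coalgebra K C"
    and grouplike: "s \<in> S \<Longrightarrow> i s \<in> gls C"
    and span: "carrier C = lin_span K C (i ` S)"
    and M_hom: "M \<in> lin_hom K C (free_mod K S)"
    and M_basis: "s \<in> S \<Longrightarrow> M (i s) = bvec K s"
begin

lemmas C = coalgebraD[OF coalgebra_C]

sublocale C: module K C by (rule C)

lemma basis_closed: "s \<in> S \<Longrightarrow> i s \<in> carrier C"
  and basis_comul: "s \<in> S \<Longrightarrow> comul C (i s) = tens K C C (i s) (i s)"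
  using grouplike by (simp_all add: grouplikes_carrier)

text \<open>The counit is 1 on a group-like element and 0 on zero.\<close>

lemma grouplike_nonzero: "x \<in> gls C \<Longrightarrow> x \<noteq> \<zero>\<^bsub>C\<^esub>"
  using lin_hom_zero[OF C(1) module_ground C(3)] K.one_not_zero by (auto simp: grouplikes_carrier)

lemma basis_hom_eq:
  assumes "module K W" "f \<in> lin_hom K C W" "g \<in> lin_hom K C W"
    "\<And>s. s \<in> S \<Longrightarrow> f (i s) = g (i s)" "x \<in> carrier C"
  shows "f x = g x"
  by (rule lin_hom_eq_on_span[OF C(1) assms(1-3), where S = "i ` S"])
    (use assms span basis_closed in auto)

lemma coord_hom: "(\<lambda>x. M x s) \<in> lin_hom K C (ground K)"
  using M_hom by (intro lin_homI)
    (auto simp: lin_hom_add[OF M_hom] lin_hom_smult[OF M_hom] free_mod_simps free_mod_carrier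
      dest: lin_hom_closed[OF M_hom])

lemma coord_closed: "x \<in> carrier C \<Longrightarrow> M x s \<in> carrier K"
  using lin_hom_closed[OF coord_hom] by simp

lemma expansion:
  assumes "x \<in> carrier C"
  shows "x = lin_ext K C i (M x)"
proof (rule basis_hom_eq[OF C(1) lin_hom_ident _ _ assms])
  show "(\<lambda>x. lin_ext K C i (M x)) \<in> lin_hom K C C"
    by (rule lin_hom_comp[OF M_hom lin_ext_hom[OF C(1)]]) (simp add: basis_closed)
  fix s assume "s \<in> S"
  then show "i s = lin_ext K C i (M (i s))"
    by (simp add: M_basis lin_ext_bvec C(1) basis_closed)
qed

lemma coord_nonzero:
  assumes "x \<in> carrier C" "x \<noteq> \<zero>\<^bsub>C\<^esub>"
  obtains s where "s \<in> S" "M x s \<noteq> \<zero>\<^bsub>K\<^esub>"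
proof -
  have "\<exists>s. M x s \<noteq> \<zero>\<^bsub>K\<^esub>"
  proof (rule ccontr)
    assume "\<not> ?thesis"
    then have "lin_ext K C i (M x) = \<zero>\<^bsub>C\<^esub>" by (simp add: lin_ext_def)
    then show False using expansion[OF assms(1)] assms(2) by simp
  qed
  then show ?thesis
    using that lin_hom_closed[OF M_hom assms(1)] by (auto simp: free_mod_carrier)
qed

text \<open>On a basis element \<open>i t\<close> the coefficient is a Kronecker delta in
  \<open>s\<close> and \<open>t\<close>, so both sides are \<open>i s\<close> for
  \<open>t = s\<close> and zero otherwise.\<close>

lemma coord_comul:
  assumes "x \<in> carrier C" "s \<in> S"
  shows "M x s \<odot>\<^bsub>C\<^esub> i s = tlift K C (\<lambda>x y. M x s \<odot>\<^bsub>C\<^esub> y) (comul C x)"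
proof (rule basis_hom_eq[OF C(1) scalar_hom[OF C(1) basis_closed[OF assms(2)] coord_hom]
      lin_hom_comp[OF C(2) tlift_hom[OF C(1,1,1) bilin_scalar[OF C(1,1) coord_hom]]] _ assms(1)])
  fix t assume t: "t \<in> S"
  then show "M (i t) s \<odot>\<^bsub>C\<^esub> i s = tlift K C (\<lambda>x y. M x s \<odot>\<^bsub>C\<^esub> y) (comul C (i t))"
    using assms(2)
    by (simp add: basis_comul tlift_tens[OF C(1,1,1) bilin_scalar[OF C(1,1) coord_hom]] basis_closed
        M_basis bvec_def)
qed

lemma grouplike_in_basis:
  assumes "x \<in> gls C"
  obtains s where "s \<in> S" "x = i s"
proof -
  have x: "x \<in> carrier C" "comul C x = tens K C C x x" "counit C x = \<one>\<^bsub>K\<^esub>"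
    using assms by (simp_all add: grouplikes_carrier)
  obtain s where s: "s \<in> S" "M x s \<noteq> \<zero>\<^bsub>K\<^esub>" by (rule coord_nonzero[OF x(1) grouplike_nonzero[OF assms]])
  have "M x s \<odot>\<^bsub>C\<^esub> i s = M x s \<odot>\<^bsub>C\<^esub> x"
    using coord_comul[OF x(1) s(1)] x
    by (simp add: tlift_tens[OF C(1,1,1) bilin_scalar[OF C(1,1) coord_hom]])
  then have "x = i s"
    using smult_inverse(2)[OF C(1) coord_closed[OF x(1)] s(2)] basis_closed[OF s(1)] x(1) by metis
  then show ?thesis using that s by blast
qed

lemma basis_in_subcoalgebra:
  assumes "subcoalgebra K C D" "D \<noteq> {\<zero>\<^bsub>C\<^esub>}"
  obtains s where "s \<in> S" "i s \<in> D"
proof -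
  have D: "submodule D K C"
    and cD: "comul C ` D \<subseteq> lin_span K (tensor K C C) {tens K C C x y | x y. x \<in> D \<and> y \<in> D}"
    using assms(1) by (simp_all add: subcoalgebra_def)
  note E = C.submoduleE[OF D]
  obtain x where x: "x \<in> D" "x \<noteq> \<zero>\<^bsub>C\<^esub>" using assms(2) submodule_zero[OF D] by auto
  then have xc: "x \<in> carrier C" using E(1) by auto
  obtain s where s: "s \<in> S" "M x s \<noteq> \<zero>\<^bsub>K\<^esub>" by (rule coord_nonzero[OF xc x(2)])
  note b = bilin_scalar[OF C(1,1) coord_hom[of s]]
  \<comment> \<open>Contracting the left leg of \<open>x \<otimes> y\<close> leaves a multiple of
    \<open>y\<close>, so tensors generated by \<open>D\<close> in both legs are sent into
    \<open>D\<close>.\<close>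
  have "tlift K C (\<lambda>x y. M x s \<odot>\<^bsub>C\<^esub> y) (comul C x) \<in> D"
  proof (rule lin_hom_image_span[OF module_tensor[OF C(1,1)] C(1) tlift_hom[OF C(1,1,1) b] _ _ D])
    show "comul C x \<in> lin_span K (tensor K C C) {tens K C C x y | x y. x \<in> D \<and> y \<in> D}"
      using cD x(1) by auto
    show "{tens K C C x y | x y. x \<in> D \<and> y \<in> D} \<subseteq> carrier (tensor K C C)"
      using E(1) by (auto intro!: tens_closed)
    show "tlift K C (\<lambda>x y. M x s \<odot>\<^bsub>C\<^esub> y) ` {tens K C C x y | x y. x \<in> D \<and> y \<in> D} \<subseteq> D"
      using E(1,4) coord_closed by (auto simp: tlift_tens[OF C(1,1,1) b] subset_iff)
  qed
  then have "M x s \<odot>\<^bsub>C\<^esub> i s \<in> D" using coord_comul[OF xc s(1)] by simp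
  then have "inv\<^bsub>K\<^esub> (M x s) \<odot>\<^bsub>C\<^esub> (M x s \<odot>\<^bsub>C\<^esub> i s) \<in> D"
    by (rule E(4)[OF smult_inverse(1)[OF C(1) coord_closed[OF xc] s(2) xc]])
  then show ?thesis
    using smult_inverse(2)[OF C(1) coord_closed[OF xc] s(2) basis_closed[OF s(1)]] that s(1) by simp
qed

text \<open>The coproduct of a multiple of \<open>i s\<close> is a multiple of
  \<open>i s \<otimes> i s\<close>, so the line is a subcoalgebra. A nonzero submodule of it
  contains \<open>i s\<close> after division by a scalar, hence is the whole line.\<close>

lemma line_simple:
  assumes "s \<in> S"
  shows "simple_subcoalgebra K C {k \<odot>\<^bsub>C\<^esub> i s | k. k \<in> carrier K}" (is "simple_subcoalgebra K C ?L")
proof -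
  note c = basis_closed[OF assms]
  note nz = grouplike_nonzero[OF grouplike[OF assms]]
  have mem: "i s \<in> ?L" using c by (auto intro!: exI[of _ "\<one>\<^bsub>K\<^esub>"])
  have sub: "submodule ?L K C" by (rule submodule_line[OF C(1) c])
  let ?T = "{tens K C C x y | x y. x \<in> ?L \<and> y \<in> ?L}"
  have T: "?T \<subseteq> carrier (tensor K C C)" using c by (auto intro!: tens_closed)
  have "comul C x \<in> lin_span K (tensor K C C) ?T" if x: "x \<in> ?L" for x
  proof -
    obtain k where k: "k \<in> carrier K" "x = k \<odot>\<^bsub>C\<^esub> i s" using x by auto
    have "tens K C C (i s) (i s) \<in> lin_span K (tensor K C C) ?T"
      using lin_span_incl[of ?T] mem by blast
    then show ?thesis
      using k c assms module.submoduleE(4)[OF module_tensor[OF C(1,1)] lin_span_submodule[OF module_tensor[OF C(1,1)] T]]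
      by (simp add: lin_hom_smult[OF C(2)] basis_comul)
  qed
  then have "subcoalgebra K C ?L" using sub by (auto simp: subcoalgebra_def)
  moreover have "?L \<noteq> {\<zero>\<^bsub>C\<^esub>}" using mem nz by auto
  moreover have "E = {\<zero>\<^bsub>C\<^esub>} \<or> E = ?L" if subE: "subcoalgebra K C E" and EL: "E \<subseteq> ?L" for E
  proof (rule disjCI)
    assume "E \<noteq> ?L"
    have E: "submodule E K C" using subE by (simp add: subcoalgebra_def)
    note EE = C.submoduleE[OF E]
    show "E = {\<zero>\<^bsub>C\<^esub>}"
    proof (rule ccontr)
      assume "E \<noteq> {\<zero>\<^bsub>C\<^esub>}"
      then obtain x where x: "x \<in> E" "x \<noteq> \<zero>\<^bsub>C\<^esub>" using submodule_zero[OF E] by auto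
      then obtain k where k: "k \<in> carrier K" "x = k \<odot>\<^bsub>C\<^esub> i s" using EL x(1) by blast
      then have "k \<noteq> \<zero>\<^bsub>K\<^esub>" using x c by auto
      note inv = smult_inverse[OF C(1) k(1) this c]
      have "i s \<in> E" using EE(4)[OF inv(1) x(1)] inv(2) k(2) by simp
      then have "?L \<subseteq> E" using EE(4) by auto
      then show False using EL \<open>E \<noteq> ?L\<close> by auto
    qed
  qed
  ultimately show ?thesis by (simp add: simple_subcoalgebra_def)
qed

text \<open>A simple subcoalgebra contains some \<open>i s\<close> and with it the line through
  \<open>i s\<close>; this line is a nonzero subcoalgebra, so simplicity forces equality.\<close>

lemma pointed_C: "pointed K C"
  unfolding pointed_def
proof (intro allI impI)
  fix D assume D: "simple_subcoalgebra K C D"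
  then obtain s where s: "s \<in> S" "i s \<in> D"
    using basis_in_subcoalgebra by (metis simple_subcoalgebra_def)
  let ?L = "{k \<odot>\<^bsub>C\<^esub> i s | k. k \<in> carrier K}"
  have L: "simple_subcoalgebra K C ?L" by (rule line_simple[OF s(1)])
  have "submodule D K C" using D by (simp add: simple_subcoalgebra_def subcoalgebra_def)
  then have "?L \<subseteq> D" using C.submoduleE(4) s by blast
  then have "D = ?L" using D L unfolding simple_subcoalgebra_def by blast
  then show "\<exists>x\<in>carrier C. x \<noteq> \<zero>\<^bsub>C\<^esub> \<and> D = {k \<odot>\<^bsub>C\<^esub> x | k. k \<in> carrier K}"
    using basis_closed[OF s(1)] grouplike_nonzero[OF grouplike[OF s(1)]] by blast
qed

text \<open>The coradical contains every basis line, hence a generating set.\<close>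

lemma cosemisimple_C: "cosemisimple K C"
proof -
  let ?U = "\<Union>{D. simple_subcoalgebra K C D}"
  have "D \<subseteq> carrier C" if "simple_subcoalgebra K C D" for D
    using that C.submoduleE(1)[of D] by (simp add: simple_subcoalgebra_def subcoalgebra_def)
  then have "?U \<subseteq> carrier C" by blast
  then have "coradical K C \<subseteq> carrier C" unfolding coradical_def by (rule lin_span_carrier[OF C(1)])
  moreover have "i ` S \<subseteq> ?U"
  proof
    fix x assume "x \<in> i ` S"
    then obtain s where s: "s \<in> S" "x = i s" by auto
    have "x \<in> {k \<odot>\<^bsub>C\<^esub> i s | k. k \<in> carrier K}"
      using s basis_closed by (auto intro!: exI[of _ "\<one>\<^bsub>K\<^esub>"])
    then show "x \<in> ?U" using line_simple[OF s(1)] by blast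
  qed
  then have "carrier C \<subseteq> coradical K C" unfolding span coradical_def by (rule lin_span_mono)
  ultimately show ?thesis by (auto simp: cosemisimple_def)
qed

end

section \<open>Group-like elements of pointed cosemisimple coalgebras\<close>

context base_field
begin

text \<open>A simple subcoalgebra is a line through some \<open>x\<close>, and its closure under the
  coproduct forces \<open>\<delta> x = m (x \<otimes> x)\<close>. The counit law gives
  \<open>m \<epsilon>(x) = 1\<close>. Hence \<open>m x\<close> is group-like and
  \<open>x = \<epsilon>(x) (m x)\<close>, so each simple subcoalgebra, and then the coradical, lies
  in the span of the group-like elements.\<close>

lemma pointed_cosemisimple_span:
  assumes "coalgebra K C" "pointed K C" "cosemisimple K C"
  shows "carrier C = lin_span K C (gls C)"
proof
  note C = coalgebraD[OF assms(1)]
  interpret C: module K C by (rule C)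
  let ?G = "gls C"
  have G: "?G \<subseteq> carrier C" by (auto simp: grouplikes_carrier)
  note sub = lin_span_submodule[OF C(1) G]
  show "lin_span K C ?G \<subseteq> carrier C" by (rule lin_span_carrier[OF C(1) G])
  have "D \<subseteq> lin_span K C ?G" if D: "simple_subcoalgebra K C D" for D
  proof -
    obtain x where x: "x \<in> carrier C" "x \<noteq> \<zero>\<^bsub>C\<^esub>" "D = {k \<odot>\<^bsub>C\<^esub> x | k. k \<in> carrier K}"
      using assms(2) D by (auto simp: pointed_def)
    let ?T = "tensor K C C"
    interpret T: module K ?T by (rule module_tensor[OF C(1,1)])
    let ?t = "tens K C C x x"
    have t: "?t \<in> carrier ?T" using x by (simp add: tens_closed)
    let ?L = "{m \<odot>\<^bsub>?T\<^esub> ?t | m. m \<in> carrier K}"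
    have "submodule ?L K ?T" by (rule submodule_line[OF module_tensor[OF C(1,1)] t])
    \<comment> \<open>Scalars of both legs move out of the tensor, so \<open>D \<otimes> D\<close>
      is the line through \<open>x \<otimes> x\<close>.\<close>
    moreover have "{tens K C C y z | y z. y \<in> D \<and> z \<in> D} \<subseteq> ?L"
    proof -
      have "tens K C C (k \<odot>\<^bsub>C\<^esub> x) (l \<odot>\<^bsub>C\<^esub> x) = (k \<otimes>\<^bsub>K\<^esub> l) \<odot>\<^bsub>?T\<^esub> ?t"
        if "k \<in> carrier K" "l \<in> carrier K" for k l
        using that x t lin_hom_smult[OF bilin_left[OF bilin_tens[OF C(1,1)]]]
          lin_hom_smult[OF bilin_right[OF bilin_tens[OF C(1,1)]]]
        by (simp add: T.smult_assoc1[symmetric] K.m_comm)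
      then show ?thesis unfolding x(3) by (auto intro!: K.m_closed)
    qed
    moreover have "x \<in> D" using x by (auto intro!: exI[of _ "\<one>\<^bsub>K\<^esub>"])
    then have "comul C x \<in> lin_span K ?T {tens K C C y z | y z. y \<in> D \<and> z \<in> D}"
      using D unfolding simple_subcoalgebra_def subcoalgebra_def by blast
    ultimately have "comul C x \<in> ?L" using lin_span_least[of ?L K ?T] by blast
    then obtain m where m: "m \<in> carrier K" "comul C x = m \<odot>\<^bsub>?T\<^esub> ?t" by auto
    let ?e = "counit C x"
    have e: "?e \<in> carrier K" using lin_hom_closed[OF C(3) x(1)] by simp
    note b = bilin_scalar[OF C(1,1,3)]
    have "m \<odot>\<^bsub>C\<^esub> (?e \<odot>\<^bsub>C\<^esub> x) = x"
      using counit_left[OF assms(1) x(1)] m t x(1)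
      by (simp add: lin_hom_smult[OF tlift_hom[OF C(1,1,1) b]] tlift_tens[OF C(1,1,1) b])
    then have 1: "(m \<otimes>\<^bsub>K\<^esub> ?e) \<odot>\<^bsub>C\<^esub> x = x" using m e x(1) by (simp add: C.smult_assoc1)
    \<comment> \<open>The scalar minus 1 annihilates the nonzero vector \<open>x\<close>; over a
      field it must vanish.\<close>
    have me: "m \<otimes>\<^bsub>K\<^esub> ?e = \<one>\<^bsub>K\<^esub>"
    proof (rule ccontr)
      let ?a = "m \<otimes>\<^bsub>K\<^esub> ?e \<oplus>\<^bsub>K\<^esub> \<ominus>\<^bsub>K\<^esub> \<one>\<^bsub>K\<^esub>"
      assume ne: "m \<otimes>\<^bsub>K\<^esub> ?e \<noteq> \<one>\<^bsub>K\<^esub>"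
      have a: "?a \<in> carrier K" using m e by simp
      have "?a \<noteq> \<zero>\<^bsub>K\<^esub>"
      proof
        assume "?a = \<zero>\<^bsub>K\<^esub>"
        then have "m \<otimes>\<^bsub>K\<^esub> ?e = \<ominus>\<^bsub>K\<^esub> (\<ominus>\<^bsub>K\<^esub> \<one>\<^bsub>K\<^esub>)"
          using m e by (intro K.minus_equality[symmetric]) auto
        then show False using ne by simp
      qed
      note inv = smult_inverse[OF C(1) a this x(1)]
      have "?a \<odot>\<^bsub>C\<^esub> x = \<zero>\<^bsub>C\<^esub>"
        using m e x(1) 1 by (simp add: C.smult_l_distr C.smult_l_minus C.r_neg)
      then show False using inv x(2) by simp
    qed
    \<comment> \<open>Rescaling by \<open>m\<close> is the choice that balances
      \<open>\<delta>\<close>: the coproduct of \<open>m x\<close> carries the factor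
      \<open>m\<close> twice, as does \<open>m x \<otimes> m x\<close>.\<close>
    let ?y = "m \<odot>\<^bsub>C\<^esub> x"
    have y: "?y \<in> carrier C" using m x by simp
    have "tens K C C ?y ?y = m \<odot>\<^bsub>?T\<^esub> (m \<odot>\<^bsub>?T\<^esub> ?t)"
      using m x y lin_hom_smult[OF bilin_left[OF bilin_tens[OF C(1,1)]]]
        lin_hom_smult[OF bilin_right[OF bilin_tens[OF C(1,1)]]] by simp
    then have "comul C ?y = tens K C C ?y ?y"
      using m x by (simp add: lin_hom_smult[OF C(2)])
    moreover have "counit C ?y = \<one>\<^bsub>K\<^esub>" using me m x by (simp add: lin_hom_smult[OF C(3)])
    ultimately have "?y \<in> ?G" using y by (simp add: grouplikes_carrier)
    then have "?y \<in> lin_span K C ?G" using lin_span_incl by fast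
    then have "?e \<odot>\<^bsub>C\<^esub> ?y \<in> lin_span K C ?G" using e C.submoduleE(4)[OF sub] by blast
    moreover have "?e \<odot>\<^bsub>C\<^esub> ?y = x"
      using 1 m e x(1) by (simp add: C.smult_assoc1[symmetric] K.m_comm)
    ultimately show ?thesis unfolding x(3) using C.submoduleE(4)[OF sub] by auto
  qed
  then have "coradical K C \<subseteq> lin_span K C ?G"
    unfolding coradical_def by (intro lin_span_least[OF sub]) auto
  then show "carrier C \<subseteq> lin_span K C ?G" using assms(3) by (simp add: cosemisimple_def)
qed

text \<open>A maximal linearly independent set \<open>S\<close> of group-like elements is a basis, and by
  \<open>grouplike_basis.grouplike_in_basis\<close> it already contains all group-like elements.\<close>

lemma grouplikes_basis:
  assumes "coalgebra K C" "carrier C = lin_span K C (gls C)"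
  obtains M where "grouplike_basis K C (gls C) (\<lambda>x. x) M"
proof -
  note C = coalgebraD[OF assms(1)]
  interpret C: module K C by (rule C)
  let ?G = "gls C"
  have G: "?G \<subseteq> carrier C" by (auto simp: grouplikes_carrier)
  let ?L = "lin_ext K C (\<lambda>x. x)"
  \<comment> \<open>The linearly independent sets of group-like elements; independence means that
    only the zero combination is sent to zero by \<open>?L\<close>.\<close>
  define I where "I = {S. S \<subseteq> ?G \<and> (\<forall>c\<in>carrier (free_mod K S). ?L c = \<zero>\<^bsub>C\<^esub> \<longrightarrow> c = (\<lambda>x. \<zero>\<^bsub>K\<^esub>))}"
  have "\<exists>S\<in>I. \<forall>X\<in>I. S \<subseteq> X \<longrightarrow> X = S"
  proof (rule subset_Zorn')
    fix B assume B: "subset.chain I B"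
    have "c = (\<lambda>x. \<zero>\<^bsub>K\<^esub>)" if c: "c \<in> carrier (free_mod K (\<Union>B))" "?L c = \<zero>\<^bsub>C\<^esub>" for c
    proof (cases "B = {}")
      case True
      then show ?thesis using c by (auto simp: free_mod_carrier)
    next
      case False
      have "finite {x. c x \<noteq> \<zero>\<^bsub>K\<^esub>}" "{x. c x \<noteq> \<zero>\<^bsub>K\<^esub>} \<subseteq> \<Union>B"
        using c(1) by (auto simp: free_mod_carrier)
      \<comment> \<open>A finite subset of the union of a nonempty chain lies in one member. This is
        where finiteness of the support of \<open>c\<close> enters.\<close>
      then obtain S where S: "S \<in> B" "{x. c x \<noteq> \<zero>\<^bsub>K\<^esub>} \<subseteq> S"
        using finite_subset_Union_chain[OF _ _ False B] by metis
      then have "c \<in> carrier (free_mod K S)" using c(1) by (simp add: free_mod_carrier)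
      moreover have "S \<in> I" using S B by (auto simp: subset.chain_def)
      ultimately show ?thesis using c(2) by (auto simp: I_def)
    qed
    moreover have "\<Union>B \<subseteq> ?G" using B by (auto simp: subset.chain_def I_def)
    ultimately show "\<Union>B \<in> I" by (simp add: I_def)
  qed
  then obtain S where S: "S \<in> I" and max: "\<And>X. X \<in> I \<Longrightarrow> S \<subseteq> X \<Longrightarrow> X = S" by auto
  let ?F = "free_mod K S"
  have SG: "S \<subseteq> ?G" and ind: "\<And>c. c \<in> carrier ?F \<Longrightarrow> ?L c = \<zero>\<^bsub>C\<^esub> \<Longrightarrow> c = (\<lambda>x. \<zero>\<^bsub>K\<^esub>)"
    using S by (auto simp: I_def)
  have SC: "S \<subseteq> carrier C" using SG G by auto
  interpret F: module K ?F by (rule module_free_mod)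
  have L: "?L \<in> lin_hom K ?F C" by (rule lin_ext_hom[OF C(1)]) (use SC in auto)
  note sub = lin_span_submodule[OF C(1) SC] and LS = lin_span_carrier[OF C(1) SC]
  have LF: "?L c \<in> lin_span K C S" if "c \<in> carrier ?F" for c
  proof (rule lin_hom_image_span[OF module_free_mod C(1) L _ _ sub])
    show "c \<in> lin_span K ?F (bvec K ` S)" using that free_mod_span by auto
    show "?L ` bvec K ` S \<subseteq> lin_span K C S"
      using SC lin_span_incl[of S K C] by (auto simp: lin_ext_bvec C(1) subset_iff)
  qed auto
  \<comment> \<open>A group-like element outside the span could be added to \<open>S\<close> without
    losing independence, against maximality.\<close>
  have "g \<in> lin_span K C S" if g: "g \<in> ?G" for g
  proof (rule ccontr)
    assume ng: "g \<notin> lin_span K C S"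
    then have gS: "g \<notin> S" using lin_span_incl by fast
    have gc: "g \<in> carrier C" using g G by auto
    have "insert g S \<in> I"
      unfolding I_def
    proof (intro CollectI conjI ballI impI)
      show "insert g S \<subseteq> ?G" using g SG by auto
      fix c assume c: "c \<in> carrier (free_mod K (insert g S))" and c0: "?L c = \<zero>\<^bsub>C\<^esub>"
      let ?d = "c(g := \<zero>\<^bsub>K\<^esub>)"
      have "{x. ?d x \<noteq> \<zero>\<^bsub>K\<^esub>} \<subseteq> {x. c x \<noteq> \<zero>\<^bsub>K\<^esub>}" by auto
      then have d: "?d \<in> carrier ?F"
        using c by (auto simp: free_mod_carrier intro: finite_subset split: if_splits)
      have d': "?d \<in> carrier (free_mod K (insert g S))" using d unfolding free_mod_carrier by blast
      have ck: "c g \<in> carrier K" using c by (simp add: free_mod_carrier)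
      \<comment> \<open>Separating the coefficient of the new element leaves a combination of
        \<open>S\<close>, to which independence of \<open>S\<close> applies once that coefficient is
        shown to be zero.\<close>
      have eq: "c = ?d \<oplus>\<^bsub>free_mod K (insert g S)\<^esub> (c g \<odot>\<^bsub>free_mod K (insert g S)\<^esub> bvec K g)"
        using c by (auto simp: free_mod_simps bvec_def free_mod_carrier)
      have L': "?L \<in> lin_hom K (free_mod K (insert g S)) C"
        by (rule lin_ext_hom[OF C(1)]) (use SC gc in auto)
      interpret F': module K "free_mod K (insert g S)" by (rule module_free_mod)
      have b: "bvec K g \<in> carrier (free_mod K (insert g S))" by simp
      have Ld: "?L ?d \<in> lin_span K C S" by (rule LF[OF d])
      then have Ldc: "?L ?d \<in> carrier C" using LS by auto
      have sum: "?L ?d \<oplus>\<^bsub>C\<^esub> c g \<odot>\<^bsub>C\<^esub> g = \<zero>\<^bsub>C\<^esub>"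
        using c0 lin_hom_add[OF L' d' F'.smult_closed[OF ck b]] lin_hom_smult[OF L' ck b] eq gc
        by (simp add: lin_ext_bvec C(1))
      have "c g = \<zero>\<^bsub>K\<^esub>"
      proof (rule ccontr)
        assume "c g \<noteq> \<zero>\<^bsub>K\<^esub>"
        note inv = smult_inverse[OF C(1) ck this gc]
        \<comment> \<open>A nonzero coefficient could be divided out of the relation, which would
          place \<open>g\<close> in the span of \<open>S\<close>.\<close>
        have "c g \<odot>\<^bsub>C\<^esub> g = \<ominus>\<^bsub>C\<^esub> (?L ?d)"
          using sum Ldc ck gc by (metis C.minus_equality C.a_comm C.smult_closed)
        then have "c g \<odot>\<^bsub>C\<^esub> g \<in> lin_span K C S" using C.submoduleE(3)[OF sub Ld] by simp
        then show False using C.submoduleE(4)[OF sub inv(1)] inv(2) ng by metis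
      qed
      then have "?d = c" by auto
      then show "c = (\<lambda>x. \<zero>\<^bsub>K\<^esub>)" using ind[OF d] c0 by simp
    qed
    then show False using max gS by blast
  qed
  then have "lin_span K C ?G \<subseteq> lin_span K C S" by (intro lin_span_least[OF sub]) auto
  then have spanS: "carrier C = lin_span K C S" using assms(2) LS by auto
  have surj: "?L ` carrier ?F = carrier C"
  proof
    show "?L ` carrier ?F \<subseteq> carrier C" using lin_hom_closed[OF L] by auto
    have "x \<in> ?L ` carrier ?F" if "x \<in> lin_span K C S" for x
      using that C(1) SC
    proof (induction rule: lin_span_induct)
      case (base s)
      then show ?case using SC by (auto intro!: image_eqI[of _ _ "bvec K s"] simp: lin_ext_bvec C(1))
    next
      case zero
      show ?case using lin_hom_zero[OF module_free_mod C(1) L] F.zero_closed by (metis imageI)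
    next
      case (add x y)
      then show ?case by (auto simp: lin_hom_add[OF L, symmetric] intro!: imageI)
    next
      case (smult k x)
      then show ?case by (auto simp: lin_hom_smult[OF L, symmetric] intro!: imageI)
    qed
    then show "carrier C \<subseteq> ?L ` carrier ?F" using spanS by auto
  qed
  have inj: "inj_on ?L (carrier ?F)"
  proof (rule inj_onI)
    fix c d assume cd: "c \<in> carrier ?F" "d \<in> carrier ?F" "?L c = ?L d"
    then have "?L (c \<ominus>\<^bsub>?F\<^esub> d) = \<zero>\<^bsub>C\<^esub>"
      using lin_hom_closed[OF L] by (simp add: lin_hom_minus[OF module_free_mod C(1) L] C.minus_eq C.r_neg)
    then have "c \<ominus>\<^bsub>?F\<^esub> d = \<zero>\<^bsub>?F\<^esub>" using ind[OF F.minus_closed[OF cd(1,2)]] by (simp add: free_mod_simps)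
    moreover have "c = (c \<ominus>\<^bsub>?F\<^esub> d) \<oplus>\<^bsub>?F\<^esub> d" using cd by (simp add: F.minus_eq F.a_assoc F.l_neg)
    ultimately show "c = d" using cd F.l_zero by metis
  qed
  define M where "M = inv_into (carrier ?F) ?L"
  have M_inv: "M (?L c) = c" if "c \<in> carrier ?F" for c
    unfolding M_def using inj that by (rule inv_into_f_f)
  have M: "M \<in> lin_hom K C ?F"
  proof (rule lin_homI)
    fix x assume "x \<in> carrier C"
    then obtain c where c: "c \<in> carrier ?F" "x = ?L c" using surj by auto
    then show "M x \<in> carrier ?F" by (simp add: M_inv)
    show "M (k \<odot>\<^bsub>C\<^esub> x) = k \<odot>\<^bsub>?F\<^esub> M x" if "k \<in> carrier K" for k
      using c that M_inv[OF F.smult_closed[OF that c(1)]] by (simp add: M_inv lin_hom_smult[OF L])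
    fix y assume "y \<in> carrier C"
    then obtain d where d: "d \<in> carrier ?F" "y = ?L d" using surj by auto
    then show "M (x \<oplus>\<^bsub>C\<^esub> y) = M x \<oplus>\<^bsub>?F\<^esub> M y"
      using c M_inv[OF F.add.m_closed[OF c(1) d(1)]] by (simp add: M_inv lin_hom_add[OF L])
  qed
  have Mb: "M s = bvec K s" if "s \<in> S" for s
    using M_inv[of "bvec K s"] that SC by (auto simp: lin_ext_bvec C(1))
  have basis: "grouplike_basis K C S (\<lambda>x. x) M"
    by unfold_locales (use assms SG spanS M Mb in auto)
  interpret grouplike_basis K C S "\<lambda>x. x" M by (rule basis)
  have "?G = S" using SG grouplike_in_basis by blast
  then show ?thesis using that basis by simp
qed

end

section \<open>Group algebras as pointed cosemisimple coalgebras\<close>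

context coded_field
begin

lemma ghopf_grouplike_basis: "grouplike_basis K (gh G) (carrier G) gi (gcoeffs K enc)"
  by unfold_locales
    (simp_all add: coalgebra_ghopf gincl_grouplike ghopf_span[symmetric] gcoeffs_hom gcoeffs_gincl)

lemma carrier_grouplikes_ghopf: "gls (gh G) = gi ` carrier G"
proof -
  interpret grouplike_basis K "gh G" "carrier G" gi "gcoeffs K enc" by (rule ghopf_grouplike_basis)
  show ?thesis using grouplike_in_basis gincl_grouplike by blast
qed

lemma pointed_cosemisimple_ghopf: "pointed K (gh G)" "cosemisimple K (gh G)"
proof -
  interpret grouplike_basis K "gh G" "carrier G" gi "gcoeffs K enc" by (rule ghopf_grouplike_basis)
  show "pointed K (gh G)" "cosemisimple K (gh G)" by (rule pointed_C, rule cosemisimple_C)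
qed

text \<open>The inverse takes the coordinates \<open>M\<close> with respect to the basis of
  group-like elements and encodes them. Both composites are linear and fix the generators.\<close>

lemma gext_grouplikes_bij:
  assumes "hopf_algebra K H" "pointed K H" "cosemisimple K H"
  shows "bij_betw (ge H (\<lambda>x. x)) (carrier (gh (grouplikes K H))) (carrier H)"
proof -
  let ?G = "gls H"
  note H = hopf_algebraD[OF assms(1)]
  note span = pointed_cosemisimple_span[OF H(3) assms(2,3)]
  obtain M where basis: "grouplike_basis K H ?G (\<lambda>x. x) M" by (rule grouplikes_basis[OF H(3) span])
  interpret grouplike_basis K H ?G "\<lambda>x. x" M by (rule basis)
  let ?f = "ge H (\<lambda>x. x)" and ?g = "\<lambda>x. enc (M x)"
  have f: "?f \<in> lin_hom K (gh (grouplikes K H)) H" by (rule gext_hom[OF H(1)]) (auto simp: basis_closed)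
  have g: "?g \<in> lin_hom K H (gh (grouplikes K H))" by (rule lin_hom_comp[OF M_hom enc_hom])
  show ?thesis
  proof (rule bij_betw_byWitness[where f' = ?g])
    show "\<forall>x\<in>carrier (gh (grouplikes K H)). ?g (?f x) = x"
    proof
      fix x assume x: "x \<in> carrier (gh (grouplikes K H))"
      show "?g (?f x) = x"
        by (rule ghopf_hom_eq[OF module_ghopf lin_hom_comp[OF f g] lin_hom_ident _ x])
          (simp add: gext_gincl H(1) basis_closed M_basis, simp add: gincl_def)
    qed
    show "\<forall>x\<in>carrier H. ?f (?g x) = x"
    proof
      fix x assume x: "x \<in> carrier H"
      show "?f (?g x) = x"
        by (rule basis_hom_eq[OF H(1) lin_hom_comp[OF g f] lin_hom_ident _ x])
          (simp add: gext_gincl[unfolded gincl_def] H(1) basis_closed M_basis)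
    qed
  qed (use lin_hom_closed[OF f] lin_hom_closed[OF g] in auto)
qed

end

section \<open>Adjunctions and equivalences\<close>

lemma full_subcat_simps [simp]:
  "Obj (full_subcat D Q) = {X \<in> Obj D. Q X}" "Hom (full_subcat D Q) = Hom D"
  "Idn (full_subcat D Q) = Idn D" "Comp (full_subcat D Q) = Comp D"
  by (simp_all add: full_subcat_def)

lemma category_full_subcat: "category D \<Longrightarrow> category (full_subcat D Q)"
  by (simp add: category_def)

lemma categoryD:
  assumes "category C"
  shows "X \<in> Obj C \<Longrightarrow> Idn C X \<in> Hom C X X"
    and "X \<in> Obj C \<Longrightarrow> Y \<in> Obj C \<Longrightarrow> Z \<in> Obj C \<Longrightarrow> f \<in> Hom C X Y \<Longrightarrow> g \<in> Hom C Y Z \<Longrightarrow>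
      Comp C X Y Z g f \<in> Hom C X Z"
    and "X \<in> Obj C \<Longrightarrow> Y \<in> Obj C \<Longrightarrow> f \<in> Hom C X Y \<Longrightarrow> Comp C X X Y f (Idn C X) = f"
    and "X \<in> Obj C \<Longrightarrow> Y \<in> Obj C \<Longrightarrow> f \<in> Hom C X Y \<Longrightarrow> Comp C X Y Y (Idn C Y) f = f"
  using assms by (simp_all add: category_def)

lemma is_functorD:
  assumes "is_functor C D F"
  shows "category C" "category D" "X \<in> Obj C \<Longrightarrow> FObj F X \<in> Obj D"
    and "X \<in> Obj C \<Longrightarrow> Y \<in> Obj C \<Longrightarrow> f \<in> Hom C X Y \<Longrightarrow> FMap F X Y f \<in> Hom D (FObj F X) (FObj F Y)"
  using assms by (simp_all add: is_functor_def)

lemma is_functor_id: "category C \<Longrightarrow> is_functor C C id_func"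
  by (simp add: is_functor_def id_func_def)

lemma is_functor_comp:
  "is_functor C D F \<Longrightarrow> is_functor D E G \<Longrightarrow> is_functor C E (comp_func G F)"
  by (simp add: is_functor_def comp_func_def)

lemma adjunctionD:
  assumes "adjunction C D F G \<Phi>"
  shows "is_functor C D F" "is_functor D C G"
    and "A \<in> Obj C \<Longrightarrow> X \<in> Obj D \<Longrightarrow> bij_betw (\<Phi> A X) (Hom D (FObj F A) X) (Hom C A (FObj G X))"
    and "A \<in> Obj C \<Longrightarrow> A' \<in> Obj C \<Longrightarrow> X \<in> Obj D \<Longrightarrow> a \<in> Hom C A' A \<Longrightarrow> h \<in> Hom D (FObj F A) X \<Longrightarrow>
      \<Phi> A' X (Comp D (FObj F A') (FObj F A) X h (FMap F A' A a)) = Comp C A' A (FObj G X) (\<Phi> A X h) a"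
    and "A \<in> Obj C \<Longrightarrow> X \<in> Obj D \<Longrightarrow> X' \<in> Obj D \<Longrightarrow> h \<in> Hom D (FObj F A) X \<Longrightarrow> k \<in> Hom D X X' \<Longrightarrow>
      \<Phi> A X' (Comp D (FObj F A) X X' k h) =
        Comp C A (FObj G X) (FObj G X') (FMap G X X' k) (\<Phi> A X h)"
  using assms by (simp_all add: adjunction_def)

text \<open>Both composites are the transpose of \<open>FMap F A A' a\<close>: one by naturality of
  \<Phi> in its first argument, the other by naturality in the second, each applied to an
  identity.\<close>

lemma adjunction_unit_natural:
  assumes adj: "adjunction C D F G \<Phi>" and A: "A \<in> Obj C" "A' \<in> Obj C" "a \<in> Hom C A A'"
  shows "Comp C A (FObj G (FObj F A)) (FObj G (FObj F A')) (FMap G (FObj F A) (FObj F A') (FMap F A A' a))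
      (adj_unit D F \<Phi> A) =
    Comp C A A' (FObj G (FObj F A')) (adj_unit D F \<Phi> A') a"
proof -
  note a = adjunctionD[OF adj] and F = is_functorD[OF adjunctionD(1)[OF adj]]
  note D = categoryD[OF F(2)]
  have "Comp C A A' (FObj G (FObj F A')) (adj_unit D F \<Phi> A') a = \<Phi> A (FObj F A') (FMap F A A' a)"
    unfolding adj_unit_def using A by (simp add: a(4)[symmetric] F D)
  also have "\<dots> = \<Phi> A (FObj F A') (Comp D (FObj F A) (FObj F A) (FObj F A') (FMap F A A' a) (Idn D (FObj F A)))"
    using A by (simp add: F D)
  also have "\<dots> = Comp C A (FObj G (FObj F A)) (FObj G (FObj F A')) (FMap G (FObj F A) (FObj F A') (FMap F A A' a))
      (adj_unit D F \<Phi> A)"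
    unfolding adj_unit_def using A by (intro a(5)) (simp_all add: F D)
  finally show ?thesis by simp
qed

text \<open>Surjectivity of \<Phi> makes the \<open>inv_into\<close> in the definition of the counit
  a genuine preimage of the identity.\<close>

lemma adj_counit_mem:
  assumes adj: "adjunction C D F G \<Phi>" and X: "X \<in> Obj D"
  shows "adj_counit C D F G \<Phi> X \<in> Hom D (FObj F (FObj G X)) X"
    and "\<Phi> (FObj G X) X (adj_counit C D F G \<Phi> X) = Idn C (FObj G X)"
proof -
  note a = adjunctionD[OF adj] and G = is_functorD[OF adjunctionD(2)[OF adj]]
  have "\<Phi> (FObj G X) X ` Hom D (FObj F (FObj G X)) X = Hom C (FObj G X) (FObj G X)"
    using a(3)[OF G(3)[OF X] X] by (simp add: bij_betw_def)
  then have "Idn C (FObj G X) \<in> \<Phi> (FObj G X) X ` Hom D (FObj F (FObj G X)) X"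
    using categoryD(1)[OF G(2) G(3)[OF X]] by simp
  then show "adj_counit C D F G \<Phi> X \<in> Hom D (FObj F (FObj G X)) X"
    "\<Phi> (FObj G X) X (adj_counit C D F G \<Phi> X) = Idn C (FObj G X)"
    unfolding adj_counit_def by (rule inv_into_into, rule f_inv_into_f)
qed

text \<open>Injectivity of \<Phi> allows the counit, defined by choice, to be recognised as an
  explicit morphism.\<close>

lemma adj_counit_eqI:
  assumes adj: "adjunction C D F G \<Phi>" and X: "X \<in> Obj D"
    and "e \<in> Hom D (FObj F (FObj G X)) X" "\<Phi> (FObj G X) X e = Idn C (FObj G X)"
  shows "adj_counit C D F G \<Phi> X = e"
proof -
  have "inj_on (\<Phi> (FObj G X) X) (Hom D (FObj F (FObj G X)) X)"
    using adjunctionD(3)[OF adj is_functorD(3)[OF adjunctionD(2)[OF adj] X] X] by (simp add: bij_betw_def)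
  then show ?thesis using adj_counit_mem[OF adj X] assms(3,4) by (metis inj_onD)
qed

text \<open>Under the injective map \<Phi> both sides have the same transpose
  \<open>FMap G X Y k\<close>.\<close>

lemma adjunction_counit_natural:
  assumes adj: "adjunction C D F G \<Phi>" and X: "X \<in> Obj D" "Y \<in> Obj D" "k \<in> Hom D X Y"
  shows "Comp D (FObj F (FObj G X)) X Y k (adj_counit C D F G \<Phi> X) =
    Comp D (FObj F (FObj G X)) (FObj F (FObj G Y)) Y (adj_counit C D F G \<Phi> Y)
      (FMap F (FObj G X) (FObj G Y) (FMap G X Y k))"
    (is "?l = ?r")
proof -
  note a = adjunctionD[OF adj]
  note F = is_functorD[OF a(1)] and G = is_functorD[OF a(2)]
  note D = categoryD[OF F(2)] and C = categoryD[OF F(1)]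
  note e = adj_counit_mem[OF adj]
  have "\<Phi> (FObj G X) Y ?l = FMap G X Y k"
    using X by (simp add: a(5) e G C)
  moreover have "\<Phi> (FObj G X) Y ?r = FMap G X Y k"
    using X by (simp add: a(4) e G C)
  moreover have "inj_on (\<Phi> (FObj G X) Y) (Hom D (FObj F (FObj G X)) Y)"
    using a(3)[OF G(3)[OF X(1)] X(2)] by (simp add: bij_betw_def)
  moreover have "?l \<in> Hom D (FObj F (FObj G X)) Y" "?r \<in> Hom D (FObj F (FObj G X)) Y"
    using X by (auto intro!: D F G e)
  ultimately show ?thesis by (metis inj_onD)
qed

text \<open>\<open>FQ\<close> lets \<open>F\<close> land in the subcategory. Since that is full, it
  has the same morphisms and composition, so inverses and naturality squares found in
  \<open>D\<close> remain valid there; only objects with \<open>Q\<close> require an invertible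
  counit.\<close>

lemma adjunction_cat_equivalence:
  assumes adj: "adjunction C D F G \<Phi>"
    and FQ: "\<And>A. A \<in> Obj C \<Longrightarrow> Q (FObj F A)"
    and unit: "\<And>A. A \<in> Obj C \<Longrightarrow> is_iso C A (FObj G (FObj F A)) (adj_unit D F \<Phi> A)"
    and counit: "\<And>X. X \<in> Obj D \<Longrightarrow> Q X \<Longrightarrow>
      is_iso D (FObj F (FObj G X)) X (adj_counit C D F G \<Phi> X)"
  shows "cat_equivalence C (full_subcat D Q) F G (adj_unit D F \<Phi>) (adj_counit C D F G \<Phi>)"
proof -
  let ?D = "full_subcat D Q"
  note a = adjunctionD[OF adj]
  have F: "is_functor C ?D F"
    using a(1) FQ by (auto simp: is_functor_def category_full_subcat)
  have G: "is_functor ?D C G"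
    using a(2) by (auto simp: is_functor_def category_full_subcat)
  have "natural_iso C C id_func (comp_func G F) (adj_unit D F \<Phi>)"
    unfolding natural_iso_def
    using is_functor_id[OF is_functorD(1)[OF F]] is_functor_comp[OF F G] unit
      adjunction_unit_natural[OF adj]
    by (simp add: id_func_def comp_func_def)
  moreover have "natural_iso ?D ?D (comp_func F G) id_func (adj_counit C D F G \<Phi>)"
    unfolding natural_iso_def
    using is_functor_id[OF is_functorD(2)[OF F]] is_functor_comp[OF G F] counit
      adjunction_counit_natural[OF adj]
    by (simp add: id_func_def comp_func_def is_iso_def)
  ultimately show ?thesis using F G by (simp add: cat_equivalence_def)
qed


section \<open>The category of generalized skew bracoids\<close>

text \<open>A \<open>group_action\<close> is a homomorphism into \<open>BijGroup\<close>, whose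
  elements are extensional bijections. The element \<open>inv g\<close> supplies the inverse
  bijection, and the extensionality premise explains why \<open>R_obj\<close> restricts its
  action.\<close>

lemma group_actionI:
  assumes "group G" and closed: "\<And>g x. g \<in> carrier G \<Longrightarrow> x \<in> E \<Longrightarrow> \<phi> g x \<in> E"
    and one: "\<And>x. x \<in> E \<Longrightarrow> \<phi> \<one>\<^bsub>G\<^esub> x = x"
    and mult: "\<And>g h x. g \<in> carrier G \<Longrightarrow> h \<in> carrier G \<Longrightarrow> x \<in> E \<Longrightarrow> \<phi> (g \<otimes>\<^bsub>G\<^esub> h) x = \<phi> g (\<phi> h x)"
    and ext: "\<And>g. g \<in> carrier G \<Longrightarrow> \<phi> g \<in> extensional E"
  shows "group_action G E \<phi>"
proof -
  interpret G: group G by fact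
  have bij: "\<phi> g \<in> Bij E" if g: "g \<in> carrier G" for g
  proof -
    have "bij_betw (\<phi> g) E E"
    proof (rule bij_betw_byWitness[where f' = "\<phi> (inv\<^bsub>G\<^esub> g)"])
      show "\<forall>x\<in>E. \<phi> (inv\<^bsub>G\<^esub> g) (\<phi> g x) = x" "\<forall>x\<in>E. \<phi> g (\<phi> (inv\<^bsub>G\<^esub> g) x) = x"
        using g by (simp_all add: mult[symmetric] one)
    qed (use g closed in auto)
    then show ?thesis using ext[OF g] by (simp add: Bij_def)
  qed
  have "\<phi> \<in> hom G (BijGroup E)"
  proof (rule homI)
    fix g h assume gh: "g \<in> carrier G" "h \<in> carrier G"
    show "\<phi> (g \<otimes>\<^bsub>G\<^esub> h) = \<phi> g \<otimes>\<^bsub>BijGroup E\<^esub> \<phi> h"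
      using gh bij ext[of "g \<otimes>\<^bsub>G\<^esub> h"]
      by (auto simp: BijGroup_def compose_def mult fun_eq_iff extensional_def)
  qed (use bij in \<open>simp add: BijGroup_def\<close>)
  then show ?thesis
    by (simp add: group_action_def group_hom_def group_hom_axioms_def G.group_axioms group_BijGroup)
qed

lemma gSkBrcd_simps:
  "S \<in> Obj gSkBrcd \<longleftrightarrow> gen_skew_bracoid S"
  "p \<in> Hom gSkBrcd S T \<longleftrightarrow>
     fst p \<in> hom (grpG S) (grpG T) \<and> fst p \<in> extensional (carrier (grpG S)) \<and>
     snd p \<in> hom (grpN S) (grpN T) \<and> snd p \<in> extensional (carrier (grpN S)) \<and>
     (\<forall>x\<in>carrier (grpG S). \<forall>n\<in>carrier (grpN S). snd p (actn S x n) = actn T (fst p x) (snd p n))"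
  "Idn gSkBrcd S = (\<lambda>x\<in>carrier (grpG S). x, \<lambda>n\<in>carrier (grpN S). n)"
  "Comp gSkBrcd S T U q p = (compose (carrier (grpG S)) (fst q) (fst p),
                          compose (carrier (grpN S)) (snd q) (snd p))"
  by (auto simp: gSkBrcd_def split: prod.splits)

lemma gSkBrcdD:
  assumes "S \<in> Obj gSkBrcd"
  shows "group (grpG S)" "group (grpN S)"
    and "g \<in> carrier (grpG S) \<Longrightarrow> n \<in> carrier (grpN S) \<Longrightarrow> actn S g n \<in> carrier (grpN S)"
    and "n \<in> carrier (grpN S) \<Longrightarrow> actn S \<one>\<^bsub>grpG S\<^esub> n = n"
    and "g \<in> carrier (grpG S) \<Longrightarrow> h \<in> carrier (grpG S) \<Longrightarrow> n \<in> carrier (grpN S) \<Longrightarrow>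
      actn S (g \<otimes>\<^bsub>grpG S\<^esub> h) n = actn S g (actn S h n)"
    and "g \<in> carrier (grpG S) \<Longrightarrow> n \<in> carrier (grpN S) \<Longrightarrow> n' \<in> carrier (grpN S) \<Longrightarrow>
      actn S g (n \<otimes>\<^bsub>grpN S\<^esub> n') =
        actn S g n \<otimes>\<^bsub>grpN S\<^esub> inv\<^bsub>grpN S\<^esub> (actn S g \<one>\<^bsub>grpN S\<^esub>) \<otimes>\<^bsub>grpN S\<^esub> actn S g n'"
proof -
  have act: "group_action (grpG S) (carrier (grpN S)) (actn S)"
    using assms by (simp add: gSkBrcd_simps gen_skew_bracoid_def Let_def)
  show "n \<in> carrier (grpN S) \<Longrightarrow> actn S \<one>\<^bsub>grpG S\<^esub> n = n"
    using group_action.id_eq_one[OF act] by (metis restrict_apply')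
qed (use assms in \<open>auto simp: gSkBrcd_simps gen_skew_bracoid_def Let_def
    intro: group_action.element_image group_action.composition_rule\<close>)

lemma hom_compose:
  assumes "group G" "f \<in> hom G H" "g \<in> hom H I"
  shows "compose (carrier G) g f \<in> hom G I"
proof -
  interpret group G by fact
  show ?thesis using assms(2,3) by (auto simp: hom_def compose_def Pi_iff)
qed

lemma hom_restrict_ident:
  assumes "group G"
  shows "(\<lambda>x\<in>carrier G. x) \<in> hom G G"
proof -
  interpret group G by fact
  show ?thesis by (auto simp: hom_def)
qed

lemma category_gSkBrcd: "category gSkBrcd"
  unfolding category_def
proof (intro conjI ballI)
  fix S assume S: "S \<in> Obj gSkBrcd"
  note SD = gSkBrcdD[OF S]
  show "Idn gSkBrcd S \<in> Hom gSkBrcd S S"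
    by (simp add: gSkBrcd_simps hom_restrict_ident SD)
  fix T p assume T: "T \<in> Obj gSkBrcd" and p: "p \<in> Hom gSkBrcd S T"
  have fp: "fst p \<in> carrier (grpG S) \<rightarrow> carrier (grpG T)" "snd p \<in> carrier (grpN S) \<rightarrow> carrier (grpN T)"
    using p by (auto simp: gSkBrcd_simps hom_def)
  show "Comp gSkBrcd S S T p (Idn gSkBrcd S) = p" "Comp gSkBrcd S T T (Idn gSkBrcd T) p = p"
    using p fp by (simp_all add: gSkBrcd_simps compose_Id Id_compose)
  {
    fix U q assume q: "q \<in> Hom gSkBrcd T U"
    show "Comp gSkBrcd S T U q p \<in> Hom gSkBrcd S U"
      using p q SD fp by (auto simp: gSkBrcd_simps hom_compose compose_eq Pi_iff)
  }
  fix U V q r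
  assume "q \<in> Hom gSkBrcd T U" "r \<in> Hom gSkBrcd U V"
  show "Comp gSkBrcd S U V r (Comp gSkBrcd S T U q p) = Comp gSkBrcd S T V (Comp gSkBrcd T U V r q) p"
    using fp by (simp add: gSkBrcd_simps compose_assoc)
qed

lemma hom_inverse:
  assumes "group G" "f \<in> hom G H" "bij_betw f (carrier G) (carrier H)"
  shows "restrict (inv_into (carrier G) f) (carrier H) \<in> hom H G"
proof -
  interpret group G by fact
  let ?k = "inv_into (carrier G) f"
  have k: "?k y \<in> carrier G" "f (?k y) = y" if "y \<in> carrier H" for y
    using that assms(3) by (auto simp: bij_betw_def inv_into_into f_inv_into_f)
  have kf: "?k (f x) = x" if "x \<in> carrier G" for x
    using that assms(3) by (simp add: bij_betw_def)
  have fc: "f x \<in> carrier H" if "x \<in> carrier G" for x using that assms(2) by (auto simp: hom_def)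
  have H: "y \<otimes>\<^bsub>H\<^esub> z = f (?k y \<otimes>\<^bsub>G\<^esub> ?k z)" if "y \<in> carrier H" "z \<in> carrier H" for y z
    using hom_mult[OF assms(2)] k that by simp
  show ?thesis by (rule homI) (auto simp: k H kf fc)
qed

text \<open>The inverse of a bijective equivariant pair of group morphisms is again one; restricting
  the inverse functions to the target carriers makes them extensional.\<close>

lemma gSkBrcd_isoI:
  assumes S: "S \<in> Obj gSkBrcd" and p: "p \<in> Hom gSkBrcd S T"
    and f: "bij_betw (fst p) (carrier (grpG S)) (carrier (grpG T))"
    and g: "bij_betw (snd p) (carrier (grpN S)) (carrier (grpN T))"
  shows "is_iso gSkBrcd S T p"
proof -
  note SD = gSkBrcdD[OF S]
  let ?k = "inv_into (carrier (grpG S)) (fst p)" and ?l = "inv_into (carrier (grpN S)) (snd p)"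
  let ?q = "(restrict ?k (carrier (grpG T)), restrict ?l (carrier (grpN T)))"
  have k: "?k y \<in> carrier (grpG S)" "fst p (?k y) = y" if "y \<in> carrier (grpG T)" for y
    using that f by (auto simp: bij_betw_def inv_into_into f_inv_into_f)
  have l: "?l y \<in> carrier (grpN S)" "snd p (?l y) = y" if "y \<in> carrier (grpN T)" for y
    using that g by (auto simp: bij_betw_def inv_into_into f_inv_into_f)
  have kf: "?k (fst p x) = x" "fst p x \<in> carrier (grpG T)" if "x \<in> carrier (grpG S)" for x
    using that f by (auto simp: bij_betw_def)
  have lg: "?l (snd p x) = x" "snd p x \<in> carrier (grpN T)" if "x \<in> carrier (grpN S)" for x
    using that g by (auto simp: bij_betw_def)
  \<comment> \<open>Every fact about the action of \<open>T\<close> is read off from the action of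
    \<open>S\<close>, since all arguments lie in the image of \<open>p\<close>.\<close>
  have act: "actn T x n = snd p (actn S (?k x) (?l n))" if "x \<in> carrier (grpG T)" "n \<in> carrier (grpN T)" for x n
    using p k[OF that(1)] l[OF that(2)] by (simp add: gSkBrcd_simps)
  have closed: "actn T x n \<in> carrier (grpN T)" if "x \<in> carrier (grpG T)" "n \<in> carrier (grpN T)" for x n
    using that SD(3) k l lg(2) by (simp add: act)
  have "?l (actn T x n) = actn S (?k x) (?l n)" if "x \<in> carrier (grpG T)" "n \<in> carrier (grpN T)" for x n
    unfolding act[OF that] by (rule lg(1)) (rule SD(3)[OF k(1)[OF that(1)] l(1)[OF that(2)]])
  then have "?q \<in> Hom gSkBrcd T S"
    using p hom_inverse[OF SD(1) _ f] hom_inverse[OF SD(2) _ g] closed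
    by (simp add: gSkBrcd_simps)
  moreover have "Comp gSkBrcd S T S ?q p = Idn gSkBrcd S"
    by (auto simp: gSkBrcd_simps compose_def kf lg)
  moreover have "Comp gSkBrcd T S T p ?q = Idn gSkBrcd T"
    by (auto simp: gSkBrcd_simps compose_def k l)
  ultimately show ?thesis using p by (auto simp: is_iso_def)
qed


section \<open>The category of Hopf bracoids\<close>

context base_field
begin

abbreviation "HB \<equiv> HBrcd_bar K"

lemma HBrcd_bar_simps:
  "X \<in> Obj HB \<longleftrightarrow> hopf_bracoid K X \<and>
     phiB X \<in> coalg_hom K (tensor_coalg K (hopH X) (hopB X)) (hopB X)"
  "p \<in> Hom HB X Y \<longleftrightarrow>
     fst p \<in> hopf_hom K (hopH X) (hopH Y) \<and> snd p \<in> hopf_hom K (hopB X) (hopB Y) \<and>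
     (\<forall>t\<in>carrier (tensor K (hopH X) (hopB X)).
        snd p (phiB X t) = phiB Y (tmap K (hopH Y) (hopB Y) (fst p) (snd p) t))"
  "Idn HB X = (\<lambda>x\<in>carrier (hopH X). x, \<lambda>b\<in>carrier (hopB X). b)"
  "Comp HB X Y Z q p = (compose (carrier (hopH X)) (fst q) (fst p),
                          compose (carrier (hopB X)) (snd q) (snd p))"
  by (auto simp: HBrcd_bar_def split: prod.splits)

lemma HBrcd_barD:
  assumes "X \<in> Obj HB"
  shows "hopf_algebra K (hopH X)" "hopf_algebra K (hopB X)"
    "phiB X \<in> lin_hom K (tensor K (hopH X) (hopB X)) (hopB X)"
    "module K (hopH X)" "module K (hopB X)"
  using assms by (auto simp: HBrcd_bar_simps hopf_bracoid_def Let_def hopf_algebraD)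

lemma HBrcd_HomD:
  assumes "p \<in> Hom HB X Y"
  shows "fst p \<in> hopf_hom K (hopH X) (hopH Y)" "snd p \<in> hopf_hom K (hopB X) (hopB Y)"
    and "t \<in> carrier (tensor K (hopH X) (hopB X)) \<Longrightarrow>
       snd p (phiB X t) = phiB Y (tmap K (hopH Y) (hopB Y) (fst p) (snd p) t)"
  using assms by (simp_all add: HBrcd_bar_simps)

lemma hopf_hom_compose:
  assumes "hopf_algebra K H" "hopf_algebra K H'" "hopf_algebra K H''"
    "f \<in> hopf_hom K H H'" "g \<in> hopf_hom K H' H''"
  shows "compose (carrier H) g f \<in> hopf_hom K H H''"
proof -
  note H = hopf_algebraD[OF assms(1)] and H' = hopf_algebraD[OF assms(2)] and H'' = hopf_algebraD[OF assms(3)]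
  note f = hopf_homD[OF assms(4)] and g = hopf_homD[OF assms(5)]
  note fc = coalg_homD[OF f(1)] and gc = coalg_homD[OF g(1)]
  note fcl = lin_hom_closed[OF f(4)]
  have "(\<lambda>x. g (f x)) \<in> coalg_hom K H H''"
    using lin_hom_comp[OF f(4) g(4)] fcl fc gc
    by (simp add: coalg_hom_def
        tmap_comp[OF H(1,1) H'(1,1) H''(1,1) f(4,4) g(4,4) refl refl lin_hom_closed[OF H(4)]])
  moreover have "(\<lambda>x. g (f x)) \<in> ring_hom H H''"
    using f(2) g(2) by (auto simp: ring_hom_def Pi_iff)
  ultimately show ?thesis unfolding compose_def by (rule hopf_homI[OF assms(1) _ _ assms(3)])
qed

lemma hopf_hom_ident:
  assumes "hopf_algebra K H"
  shows "(\<lambda>x\<in>carrier H. x) \<in> hopf_hom K H H"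
proof -
  note H = hopf_algebraD[OF assms(1)]
  have "(\<lambda>x. x) \<in> coalg_hom K H H"
    by (simp add: coalg_hom_def lin_hom_ident tmap_ident[OF H(1,1) _ _ lin_hom_closed[OF H(4)]])
  moreover have "(\<lambda>x. x) \<in> ring_hom H H" by (auto simp: ring_hom_def)
  ultimately show ?thesis by (rule hopf_homI[OF assms _ _ assms])
qed

text \<open>Each element of the target is some \<open>f x\<close>, so every law for the inverse
  follows from the law for \<open>f\<close>. For the coproduct, \<open>f \<otimes> f\<close>
  followed by the tensor square of the inverse is the identity.\<close>

lemma hopf_hom_inverse:
  assumes "hopf_algebra K H" "hopf_algebra K H'" "f \<in> hopf_hom K H H'"
    and bij: "bij_betw f (carrier H) (carrier H')"
  shows "\<exists>k\<in>hopf_hom K H' H. (\<forall>x\<in>carrier H. k (f x) = x) \<and> (\<forall>y\<in>carrier H'. f (k y) = y)"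
proof -
  note H = hopf_algebraD[OF assms(1)] and H' = hopf_algebraD[OF assms(2)]
  interpret H: ring H by (rule H)
  interpret HM: module K H by (rule H)
  note f = hopf_homD[OF assms(3)]
  note fc = coalg_homD[OF f(1)]
  let ?k = "inv_into (carrier H) f"
  have k: "?k y \<in> carrier H" "f (?k y) = y" if "y \<in> carrier H'" for y
    using that bij by (auto simp: bij_betw_def inv_into_into f_inv_into_f)
  have kf: "?k (f x) = x" if "x \<in> carrier H" for x
    using that bij by (simp add: bij_betw_def)
  have surj: "\<exists>x. x \<in> carrier H \<and> y = f x" if "y \<in> carrier H'" for y
    using that k by metis
  have kl: "?k \<in> lin_hom K H' H"
  proof (rule lin_homI)
    fix y assume "y \<in> carrier H'"
    then obtain x where x: "x \<in> carrier H" "y = f x" using surj by blast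
    then show "?k y \<in> carrier H" by (simp add: kf)
    show "?k (a \<odot>\<^bsub>H'\<^esub> y) = a \<odot>\<^bsub>H\<^esub> ?k y" if "a \<in> carrier K" for a
      using x that kf[of "a \<odot>\<^bsub>H\<^esub> x"] by (simp add: kf lin_hom_smult[OF f(4)])
    fix z assume "z \<in> carrier H'"
    then obtain w where w: "w \<in> carrier H" "z = f w" using surj by blast
    show "?k (y \<oplus>\<^bsub>H'\<^esub> z) = ?k y \<oplus>\<^bsub>H\<^esub> ?k z"
      using x w kf[of "x \<oplus>\<^bsub>H\<^esub> w"] by (simp add: kf lin_hom_add[OF f(4)])
  qed
  have "?k \<in> coalg_hom K H' H"
    unfolding coalg_hom_def
  proof (intro CollectI conjI ballI kl)
    fix y assume "y \<in> carrier H'"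
    then obtain x where x: "x \<in> carrier H" "y = f x" using surj by blast
    note cx = lin_hom_closed[OF H(4) x(1)]
    have "tmap K H H ?k ?k (tmap K H' H' f f (comul H x)) = tmap K H H (\<lambda>x. x) (\<lambda>x. x) (comul H x)"
      by (rule tmap_comp[OF H(1,1) H'(1,1) H(1,1) f(4,4) kl kl _ _ cx]) (simp_all add: kf)
    also have "\<dots> = comul H x" by (rule tmap_ident[OF H(1,1) _ _ cx]) simp_all
    finally show "comul H (?k y) = tmap K H H ?k ?k (comul H' y)" using x fc by (simp add: kf)
    show "counit H (?k y) = counit H' y" using x fc by (simp add: kf)
  qed
  moreover have "?k \<in> ring_hom H' H"
  proof (rule ring_hom_memI)
    fix y z assume "y \<in> carrier H'" "z \<in> carrier H'"
    then obtain x w where xw: "x \<in> carrier H" "y = f x" "w \<in> carrier H" "z = f w" using surj by blast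
    show "?k (y \<otimes>\<^bsub>H'\<^esub> z) = ?k y \<otimes>\<^bsub>H\<^esub> ?k z"
      using xw kf[of "x \<otimes>\<^bsub>H\<^esub> w"] ring_hom_mult[OF f(2)] by (simp add: kf)
    show "?k (y \<oplus>\<^bsub>H'\<^esub> z) = ?k y \<oplus>\<^bsub>H\<^esub> ?k z"
      by (rule lin_hom_add[OF kl]) fact+
  next
    show "?k \<one>\<^bsub>H'\<^esub> = \<one>\<^bsub>H\<^esub>" using kf[of "\<one>\<^bsub>H\<^esub>"] ring_hom_one[OF f(2)] by simp
  qed (simp add: k)
  ultimately have "restrict ?k (carrier H') \<in> hopf_hom K H' H"
    by (rule hopf_homI[OF assms(2) _ _ assms(1)])
  then show ?thesis
    by (rule bexI[rotated]) (simp add: k kf lin_hom_closed[OF f(4)])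
qed

lemma HBrcd_bar_comp:
  assumes "X \<in> Obj HB" "Y \<in> Obj HB" "Z \<in> Obj HB"
    "p \<in> Hom HB X Y" "q \<in> Hom HB Y Z"
  shows "Comp HB X Y Z q p \<in> Hom HB X Z"
proof -
  note X = HBrcd_barD[OF assms(1)] and Y = HBrcd_barD[OF assms(2)] and Z = HBrcd_barD[OF assms(3)]
  note p = HBrcd_HomD[OF assms(4)] and q = HBrcd_HomD[OF assms(5)]
  note pl = hopf_homD(4)[OF p(1)] hopf_homD(4)[OF p(2)] and ql = hopf_homD(4)[OF q(1)] hopf_homD(4)[OF q(2)]
  let ?f = "compose (carrier (hopH X)) (fst q) (fst p)" and ?g = "compose (carrier (hopB X)) (snd q) (snd p)"
  have "?g (phiB X t) = phiB Z (tmap K (hopH Z) (hopB Z) ?f ?g t)"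
    if t: "t \<in> carrier (tensor K (hopH X) (hopB X))" for t
  proof -
    have "tmap K (hopH Z) (hopB Z) (fst q) (snd q) (tmap K (hopH Y) (hopB Y) (fst p) (snd p) t) =
      tmap K (hopH Z) (hopB Z) ?f ?g t"
      by (rule tmap_comp[OF X(4,5) Y(4,5) Z(4,5) pl ql _ _ t]) (simp_all add: compose_eq)
    then show ?thesis
      using t lin_hom_closed[OF X(3)] lin_hom_closed[OF tmap_hom[OF X(4,5) Y(4,5) pl]]
      by (simp add: compose_eq p(3) q(3))
  qed
  then show ?thesis
    using hopf_hom_compose[OF X(1) Y(1) Z(1) p(1) q(1)] hopf_hom_compose[OF X(2) Y(2) Z(2) p(2) q(2)]
    by (simp add: HBrcd_bar_simps)
qed

lemma category_HBrcd_bar: "category HB"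
  unfolding category_def
proof (intro conjI ballI)
  fix X assume X: "X \<in> Obj HB"
  note XD = HBrcd_barD[OF X]
  show "Idn HB X \<in> Hom HB X X"
    using lin_hom_closed[OF XD(3)]
    by (simp add: HBrcd_bar_simps hopf_hom_ident XD tmap_ident)
  fix Y p assume Y: "Y \<in> Obj HB" and p: "p \<in> Hom HB X Y"
  note p' = HBrcd_HomD[OF p]
  have fp: "fst p \<in> carrier (hopH X) \<rightarrow> carrier (hopH Y)" "snd p \<in> carrier (hopB X) \<rightarrow> carrier (hopB Y)"
    using lin_hom_closed[OF hopf_homD(4)[OF p'(1)]] lin_hom_closed[OF hopf_homD(4)[OF p'(2)]] by auto
  show "Comp HB X X Y p (Idn HB X) = p" "Comp HB X Y Y (Idn HB Y) p = p"
    using fp hopf_homD(3)[OF p'(1)] hopf_homD(3)[OF p'(2)]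
    by (simp_all add: HBrcd_bar_simps compose_Id Id_compose)
  {
    fix Z q assume "Z \<in> Obj HB" "q \<in> Hom HB Y Z"
    then show "Comp HB X Y Z q p \<in> Hom HB X Z"
      by (intro HBrcd_bar_comp X Y p)
  }
  fix U V q r
  assume "q \<in> Hom HB Y U" "r \<in> Hom HB U V"
  show "Comp HB X U V r (Comp HB X Y U q p) = Comp HB X Y V (Comp HB Y U V r q) p"
    using fp by (simp add: HBrcd_bar_simps compose_assoc)
qed

lemma HBrcd_bar_isoI:
  assumes X: "X \<in> Obj HB" and Y: "Y \<in> Obj HB" and p: "p \<in> Hom HB X Y"
    and f: "bij_betw (fst p) (carrier (hopH X)) (carrier (hopH Y))"
    and g: "bij_betw (snd p) (carrier (hopB X)) (carrier (hopB Y))"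
  shows "is_iso HB X Y p"
proof -
  note XD = HBrcd_barD[OF X] and YD = HBrcd_barD[OF Y]
  note p' = HBrcd_HomD[OF p]
  obtain k where k: "k \<in> hopf_hom K (hopH Y) (hopH X)" "\<And>x. x \<in> carrier (hopH X) \<Longrightarrow> k (fst p x) = x"
    "\<And>y. y \<in> carrier (hopH Y) \<Longrightarrow> fst p (k y) = y"
    using hopf_hom_inverse[OF XD(1) YD(1) p'(1) f] by blast
  obtain l where l: "l \<in> hopf_hom K (hopB Y) (hopB X)" "\<And>x. x \<in> carrier (hopB X) \<Longrightarrow> l (snd p x) = x"
    "\<And>y. y \<in> carrier (hopB Y) \<Longrightarrow> snd p (l y) = y"
    using hopf_hom_inverse[OF XD(2) YD(2) p'(2) g] by blast
  note pl = hopf_homD(4)[OF p'(1)] hopf_homD(4)[OF p'(2)] and kl = hopf_homD(4)[OF k(1)] hopf_homD(4)[OF l(1)]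
  have "l (phiB Y t) = phiB X (tmap K (hopH X) (hopB X) k l t)"
    if t: "t \<in> carrier (tensor K (hopH Y) (hopB Y))" for t
  proof -
    \<comment> \<open>Compatibility of \<open>p\<close> with the actions at this preimage of
      \<open>t\<close>, followed by \<open>l\<close>, gives compatibility of the inverse
      pair.\<close>
    let ?s = "tmap K (hopH X) (hopB X) k l t"
    have s: "?s \<in> carrier (tensor K (hopH X) (hopB X))"
      by (rule lin_hom_closed[OF tmap_hom[OF YD(4,5) XD(4,5) kl] t])
    have "tmap K (hopH Y) (hopB Y) (fst p) (snd p) ?s = tmap K (hopH Y) (hopB Y) (\<lambda>x. x) (\<lambda>x. x) t"
      by (rule tmap_comp[OF YD(4,5) XD(4,5) YD(4,5) kl pl _ _ t]) (simp_all add: k l)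
    also have "\<dots> = t" by (rule tmap_ident[OF YD(4,5) _ _ t]) simp_all
    finally have "snd p (phiB X ?s) = phiB Y t" using p'(3)[OF s] by simp
    then show ?thesis using l(2)[OF lin_hom_closed[OF XD(3) s]] by simp
  qed
  then have "(k, l) \<in> Hom HB Y X" using k l by (simp add: HBrcd_bar_simps)
  moreover have "Comp HB X Y X (k, l) p = Idn HB X"
    by (auto simp: HBrcd_bar_simps compose_def k l)
  moreover have "Comp HB Y X Y p (k, l) = Idn HB Y"
    by (auto simp: HBrcd_bar_simps compose_def k l)
  ultimately show ?thesis using p by (auto simp: is_iso_def)
qed

end

section \<open>The functors between generalized skew bracoids and Hopf bracoids\<close>

lemma tensor_coalg_simps [simp]:
  "carrier (tensor_coalg K C D) = carrier (tensor K C D)"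
  "comul (tensor_coalg K C D) t = tswap K C C D D (tmap K (tensor K C C) (tensor K D D) (comul C) (comul D) t)"
  "counit (tensor_coalg K C D) = tlift K (ground K) (\<lambda>x y. counit C x \<otimes>\<^bsub>K\<^esub> counit D y)"
  by (simp_all add: tensor_coalg_def Let_def)

lemma lin_hom_tensor_coalg: "lin_hom K (tensor_coalg K C D) W = lin_hom K (tensor K C D) W"
  by (rule lin_hom_struct_cong) (simp_all add: tensor_coalg_def Let_def)

context base_field
begin

text \<open>For group-like \<open>h\<close> the coproduct duplicates \<open>h\<close>, so the
  composite defining \<open>Phi_B\<close> can be evaluated in closed form; for a general
  \<open>h\<close> only linearity is asserted.\<close>

lemma Phi_B_hom_tens:
  assumes "hopf_algebra K (hopH X)" "hopf_algebra K (hopB X)"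
    and phi: "phiB X \<in> lin_hom K (tensor K (hopH X) (hopB X)) (hopB X)"
  shows "Phi_B K X \<in> lin_hom K (tensor K (hopH X) (hopB X)) (hopB X)"
    and "h \<in> gls (hopH X) \<Longrightarrow> b \<in> carrier (hopB X) \<Longrightarrow>
      Phi_B K X (tens K (hopH X) (hopB X) h b) =
        antipode (hopB X) (phiB X (tens K (hopH X) (hopB X) h \<one>\<^bsub>hopB X\<^esub>)) \<otimes>\<^bsub>hopB X\<^esub>
          phiB X (tens K (hopH X) (hopB X) h b)"
proof -
  let ?H = "hopH X" and ?B = "hopB X"
  note H = hopf_algebraD[OF assms(1)] and B = hopf_algebraD[OF assms(2)]
  interpret B: ring ?B by (rule B)
  note M = H(1) B(1) module_tensor[OF H(1,1)] module_tensor[OF H(1) B(1)]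
  have u: "u_phi K X \<in> lin_hom K ?H ?B"
    unfolding u_phi_def by (rule lin_hom_comp[OF tens_left_hom[OF M(1,2) _ lin_hom_ident] phi]) simp
  have su: "antipode ?B \<circ> u_phi K X \<in> lin_hom K ?H ?B"
    using lin_hom_comp[OF u B(8)] by (simp add: comp_def)
  note t1 = tmap_hom[OF M(1,2,3,2) H(4) lin_hom_id] and t2 = tassoc_hom[OF M(1,1,2)]
    and t3 = tmap_hom[OF M(1,4,2,2) su phi] and t4 = tmult_hom[OF B(2)]
  show "Phi_B K X \<in> lin_hom K (tensor K ?H ?B) ?B"
    unfolding Phi_B_def Let_def by (rule lin_hom_comp[OF lin_hom_comp[OF lin_hom_comp[OF t1 t2] t3] t4])
  assume h: "h \<in> gls ?H" and b: "b \<in> carrier ?B"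
  then have h': "h \<in> carrier ?H" "comul ?H h = tens K ?H ?H h h" by (simp_all add: grouplikes_carrier)
  show "Phi_B K X (tens K ?H ?B h b) =
        antipode ?B (phiB X (tens K ?H ?B h \<one>\<^bsub>?B\<^esub>)) \<otimes>\<^bsub>?B\<^esub> phiB X (tens K ?H ?B h b)"
    using h' b lin_hom_closed[OF su] lin_hom_closed[OF phi]
    by (simp add: Phi_B_def Let_def tmap_tens[OF M(1,2,3,2) H(4) lin_hom_id] tassoc_tens[OF M(1,1,2)]
        tmap_tens[OF M(1,4,2,2) su phi] tens_closed tmult_tens[OF B(2)] u_phi_def)
qed

text \<open>At a group-like \<open>h\<close> the right side of the Hopf bracoid axiom becomes the
  right side of the skew bracoid law, with the antipode in place of the group inverse and bracketed
  to the right. Both functors use this dictionary.\<close>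

lemma bracoid_rhs:
  assumes "hopf_algebra K (hopH X)" "hopf_algebra K (hopB X)"
    and phi: "phiB X \<in> lin_hom K (tensor K (hopH X) (hopB X)) (hopB X)"
  defines "rhs \<equiv> \<lambda>t. tmult K (hopB X) (tmap K (hopB X) (hopB X) (phiB X) (Phi_B K X)
          (tswap K (hopH X) (hopH X) (hopB X) (hopB X)
            (tmap K (tensor K (hopH X) (hopH X)) (tensor K (hopB X) (hopB X)) (comul (hopH X)) id t)))"
  shows "rhs \<in> lin_hom K (tensor K (hopH X) (tensor K (hopB X) (hopB X))) (hopB X)"
    and "h \<in> gls (hopH X) \<Longrightarrow> b \<in> carrier (hopB X) \<Longrightarrow> b' \<in> carrier (hopB X) \<Longrightarrow>
      rhs (tens K (hopH X) (tensor K (hopB X) (hopB X)) h (tens K (hopB X) (hopB X) b b')) =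
        phiB X (tens K (hopH X) (hopB X) h b) \<otimes>\<^bsub>hopB X\<^esub>
          (antipode (hopB X) (phiB X (tens K (hopH X) (hopB X) h \<one>\<^bsub>hopB X\<^esub>)) \<otimes>\<^bsub>hopB X\<^esub>
          phiB X (tens K (hopH X) (hopB X) h b'))"
proof -
  let ?H = "hopH X" and ?B = "hopB X"
  let ?T = "tensor K ?B ?B"
  note H = hopf_algebraD[OF assms(1)] and B = hopf_algebraD[OF assms(2)]
  note M = H(1) B(1) module_tensor[OF H(1,1)] module_tensor[OF B(1,1)] module_tensor[OF H(1) B(1)]
  note Phi = Phi_B_hom_tens[OF assms(1-3)]
  note t1 = tmap_hom[OF M(1,4,3,4) H(4) lin_hom_id] and t2 = tswap_hom[OF M(1,1,2,2)]
    and t3 = tmap_hom[OF M(5,5,2,2) phi Phi(1)] and t4 = tmult_hom[OF B(2)]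
  show "rhs \<in> lin_hom K (tensor K ?H ?T) ?B"
    unfolding rhs_def by (rule lin_hom_comp[OF lin_hom_comp[OF lin_hom_comp[OF t1 t2] t3] t4])
  assume h: "h \<in> gls ?H" and b: "b \<in> carrier ?B" "b' \<in> carrier ?B"
  then have h': "h \<in> carrier ?H" "comul ?H h = tens K ?H ?H h h" by (simp_all add: grouplikes_carrier)
  have c: "phiB X (tens K ?H ?B h b) \<in> carrier ?B" "Phi_B K X (tens K ?H ?B h b') \<in> carrier ?B"
    using h' b lin_hom_closed[OF phi] lin_hom_closed[OF Phi(1)] by (simp_all add: tens_closed)
  show "rhs (tens K ?H ?T h (tens K ?B ?B b b')) =
        phiB X (tens K ?H ?B h b) \<otimes>\<^bsub>?B\<^esub>
          (antipode ?B (phiB X (tens K ?H ?B h \<one>\<^bsub>?B\<^esub>)) \<otimes>\<^bsub>?B\<^esub> phiB X (tens K ?H ?B h b'))"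
    using h' b c
    by (simp add: rhs_def tmap_tens[OF M(1,4,3,4) H(4) lin_hom_id] tswap_tens[OF M(1,1,2,2)]
        tmap_tens[OF M(5,5,2,2) phi Phi(1)] tens_closed tmult_tens[OF B(2)] Phi(2)[OF h])
qed

text \<open>The flip takes \<open>(h \<otimes> h) \<otimes> (b \<otimes> b)\<close> to
  \<open>(h \<otimes> b) \<otimes> (h \<otimes> b)\<close>, so a pure tensor of group-like elements
  is group-like in the tensor coalgebra.\<close>

lemma tensor_comul_hom_tens:
  assumes "coalgebra K H" "coalgebra K B"
  shows "comul (tensor_coalg K H B) \<in> lin_hom K (tensor K H B) (tensor K (tensor K H B) (tensor K H B))"
    and "counit (tensor_coalg K H B) \<in> lin_hom K (tensor K H B) (ground K)"
    and "h \<in> gls H \<Longrightarrow> b \<in> gls B \<Longrightarrow>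
      comul (tensor_coalg K H B) (tens K H B h b) =
        tens K (tensor K H B) (tensor K H B) (tens K H B h b) (tens K H B h b)"
    and "h \<in> gls H \<Longrightarrow> b \<in> gls B \<Longrightarrow>
      counit (tensor_coalg K H B) (tens K H B h b) = \<one>\<^bsub>K\<^esub>"
proof -
  note H = coalgebraD[OF assms(1)] and B = coalgebraD[OF assms(2)]
  note M = H(1) B(1) module_tensor[OF H(1,1)] module_tensor[OF B(1,1)]
  have b: "bilin K H B (ground K) (\<lambda>x y. counit H x \<otimes>\<^bsub>K\<^esub> counit B y)"
    using lin_hom_smult_left[OF B(1,3) module_ground] scalar_hom[OF module_ground _ H(3)]
      lin_hom_closed[OF H(3)] lin_hom_closed[OF B(3)]
    by (intro bilinI) auto
  show "comul (tensor_coalg K H B) \<in> lin_hom K (tensor K H B) (tensor K (tensor K H B) (tensor K H B))"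
    using lin_hom_comp[OF tmap_hom[OF M H(2) B(2)] tswap_hom[OF M(1,1,2,2)]]
    by (simp add: tensor_coalg_def Let_def)
  show "counit (tensor_coalg K H B) \<in> lin_hom K (tensor K H B) (ground K)"
    unfolding tensor_coalg_simps by (rule tlift_hom[OF M(1,2) module_ground b])
  assume h: "h \<in> gls H" "b \<in> gls B"
  then show "comul (tensor_coalg K H B) (tens K H B h b) =
        tens K (tensor K H B) (tensor K H B) (tens K H B h b) (tens K H B h b)"
    by (simp add: grouplikes_carrier tmap_tens[OF M H(2) B(2)] tswap_tens[OF M(1,1,2,2)])
  show "counit (tensor_coalg K H B) (tens K H B h b) = \<one>\<^bsub>K\<^esub>"
    using h by (simp add: grouplikes_carrier tlift_tens[OF M(1,2) module_ground b])
qed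

text \<open>Coalgebra morphisms preserve group-like elements. This makes the action of
  \<open>R\<close> well defined and is what the objects of \<open>HBrcd_bar\<close> provide beyond a
  Hopf bracoid.\<close>

lemma phiB_grouplike:
  assumes X: "X \<in> Obj HB"
    and h: "h \<in> gls (hopH X)" and b: "b \<in> gls (hopB X)"
  shows "phiB X (tens K (hopH X) (hopB X) h b) \<in> gls (hopB X)"
proof -
  note XD = HBrcd_barD[OF X]
  let ?H = "hopH X" and ?B = "hopB X"
  let ?t = "tens K ?H ?B h b"
  note T = module_tensor[OF XD(4,5)]
  have t: "?t \<in> carrier (tensor K ?H ?B)" using h b by (simp add: grouplikes_carrier tens_closed)
  have "phiB X \<in> coalg_hom K (tensor_coalg K ?H ?B) ?B" using X by (simp add: HBrcd_bar_simps)
  note f = coalg_homD[OF this]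
  note c = tensor_comul_hom_tens[OF hopf_algebraD(3)[OF XD(1)] hopf_algebraD(3)[OF XD(2)]]
  have "comul ?B (phiB X ?t) = tens K ?B ?B (phiB X ?t) (phiB X ?t)"
    using f(2)[of ?t] t by (simp add: c(3)[OF h b, simplified] tmap_tens[OF T T XD(5,5,3,3)])
  moreover have "counit ?B (phiB X ?t) = \<one>\<^bsub>K\<^esub>"
    using f(3)[of ?t] t by (simp add: c(4)[OF h b, simplified])
  ultimately show ?thesis using lin_hom_closed[OF XD(3) t] by (simp add: grouplikes_carrier)
qed

text \<open>The action laws restrict directly from the module laws; the bracoid law is the Hopf
  bracoid axiom evaluated at a pure tensor of group-like elements.\<close>

lemma R_obj_closed:
  assumes X: "X \<in> Obj HB"
  shows "R_obj K X \<in> Obj gSkBrcd"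
proof -
  note XD = HBrcd_barD[OF X]
  let ?H = "hopH X" and ?B = "hopB X" and ?\<phi> = "phiB X"
  let ?G = "grouplikes K ?H" and ?N = "grouplikes K ?B"
  let ?a = "\<lambda>h. \<lambda>b\<in>carrier ?N. ?\<phi> (tens K ?H ?B h b)"
  have br: "hopf_bracoid K X" using X by (simp add: HBrcd_bar_simps)
  note HD = hopf_algebraD[OF XD(1)] and BD = hopf_algebraD[OF XD(2)]
  interpret G: group ?G by (rule group_grouplikes[OF XD(1)])
  interpret N: group ?N by (rule group_grouplikes[OF XD(2)])
  interpret B: ring ?B by (rule BD)
  note cl = phiB_grouplike[OF X]
  have GH: "h \<in> carrier ?H" if "h \<in> carrier ?G" for h using that by (simp add: grouplikes_carrier)
  have NB: "b \<in> carrier ?B" if "b \<in> carrier ?N" for b using that by (simp add: grouplikes_carrier)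
  have act: "group_action ?G (carrier ?N) ?a"
  proof (rule group_actionI[OF G.group_axioms])
    fix x assume x: "x \<in> carrier ?N"
    show "?a \<one>\<^bsub>?G\<^esub> x = x" using br x NB[OF x] by (simp add: hopf_bracoid_def Let_def)
    fix g assume g: "g \<in> carrier ?G"
    show "?a g x \<in> carrier ?N" using cl g x by simp
    fix h assume h: "h \<in> carrier ?G"
    show "?a (g \<otimes>\<^bsub>?G\<^esub> h) x = ?a g (?a h x)"
      using br x g h GH NB cl by (simp add: hopf_bracoid_def Let_def)
  qed simp
  have eq: "?a g (n \<otimes>\<^bsub>?N\<^esub> n') = ?a g n \<otimes>\<^bsub>?N\<^esub> inv\<^bsub>?N\<^esub> (?a g \<one>\<^bsub>?N\<^esub>) \<otimes>\<^bsub>?N\<^esub> ?a g n'"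
    if g: "g \<in> carrier ?G" and n: "n \<in> carrier ?N" and n': "n' \<in> carrier ?N" for g n n'
  proof -
    let ?t = "tens K ?H (tensor K ?B ?B) g (tens K ?B ?B n n')"
    note T = module_tensor[OF BD(1,1)]
    have t: "?t \<in> carrier (tensor K ?H (tensor K ?B ?B))"
      using GH NB g n n' by (simp add: tens_closed)
    have "?\<phi> (tmap K ?H ?B id (tmult K ?B) ?t) = ?\<phi> (tens K ?H ?B g (n \<otimes>\<^bsub>?B\<^esub> n'))"
      using GH NB g n n'
      by (simp add: tmap_tens[OF HD(1) T HD(1) BD(1) lin_hom_id tmult_hom[OF BD(2)]] tens_closed
          tmult_tens[OF BD(2)])
    moreover have one: "\<one>\<^bsub>?B\<^esub> \<in> carrier ?N" using N.one_closed by simp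
    \<comment> \<open>Inverses of group-like elements are given by the antipode, which turns the
      antipode inside \<open>Phi_B\<close> into the inverse of the skew bracoid law.\<close>
    have "inv\<^bsub>?N\<^esub> (?a g \<one>\<^bsub>?N\<^esub>) = antipode ?B (?\<phi> (tens K ?H ?B g \<one>\<^bsub>?B\<^esub>))"
      using inv_grouplikes[OF XD(2) cl[OF g one]] one by simp
    moreover have "antipode ?B (?\<phi> (tens K ?H ?B g \<one>\<^bsub>?B\<^esub>)) \<in> carrier ?B"
      using antipode_grouplike[OF XD(2) cl[OF g one]] NB by blast
    moreover have "n \<otimes>\<^bsub>?B\<^esub> n' \<in> carrier ?N" using N.m_closed[OF n n'] by simp
    ultimately show ?thesis
      using br t bracoid_rhs(2)[OF XD(1-3) g NB[OF n] NB[OF n']] n n' cl[OF g n] cl[OF g n'] NB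
      by (simp add: hopf_bracoid_def Let_def B.m_assoc)
  qed
  show ?thesis
    unfolding gSkBrcd_simps gen_skew_bracoid_def R_obj_def Let_def skbrcd.select_convs
    by (intro conjI ballI G.group_axioms N.group_axioms act eq)
qed

section \<open>The functor R on morphisms\<close>

lemma R_obj_simps [simp]:
  "grpG (R_obj K X) = grouplikes K (hopH X)" "grpN (R_obj K X) = grouplikes K (hopB X)"
  "actn (R_obj K X) h = (\<lambda>b\<in>gls (hopB X). phiB X (tens K (hopH X) (hopB X) h b))"
  by (simp_all add: R_obj_def)

lemma hopf_hom_grouplikes:
  assumes "hopf_algebra K H" "hopf_algebra K H'" "f \<in> hopf_hom K H H'"
  shows "restrict f (gls H) \<in> hom (grouplikes K H) (grouplikes K H')"
proof -
  interpret group "grouplikes K H" by (rule group_grouplikes[OF assms(1)])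
  note f = hopf_homD[OF assms(3)]
  have "f x \<in> gls H'" if "x \<in> gls H" for x
    using coalg_hom_grouplike[OF hopf_algebraD(3)[OF assms(1)] hopf_algebraD(3)[OF assms(2)] f(1) that] .
  moreover have "f (x \<otimes>\<^bsub>H\<^esub> y) = f x \<otimes>\<^bsub>H'\<^esub> f y"
    if "x \<in> gls H" "y \<in> gls H" for x y
    using that ring_hom_mult[OF f(2)] by (simp add: grouplikes_carrier)
  ultimately show ?thesis using m_closed by (intro homI) auto
qed

lemma HBrcd_Hom_grouplike:
  assumes "X \<in> Obj HB" "Y \<in> Obj HB" "p \<in> Hom HB X Y"
  shows "x \<in> gls (hopH X) \<Longrightarrow> fst p x \<in> gls (hopH Y)"
    and "b \<in> gls (hopB X) \<Longrightarrow> snd p b \<in> gls (hopB Y)"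
proof -
  note X = HBrcd_barD[OF assms(1)] and Y = HBrcd_barD[OF assms(2)]
  have p: "fst p \<in> coalg_hom K (hopH X) (hopH Y)" "snd p \<in> coalg_hom K (hopB X) (hopB Y)"
    using assms(3) by (simp_all add: HBrcd_bar_simps hopf_homD)
  show "x \<in> gls (hopH X) \<Longrightarrow> fst p x \<in> gls (hopH Y)"
    by (rule coalg_hom_grouplike[OF hopf_algebraD(3)[OF X(1)] hopf_algebraD(3)[OF Y(1)] p(1)])
  show "b \<in> gls (hopB X) \<Longrightarrow> snd p b \<in> gls (hopB Y)"
    by (rule coalg_hom_grouplike[OF hopf_algebraD(3)[OF X(2)] hopf_algebraD(3)[OF Y(2)] p(2)])
qed

abbreviation "RF \<equiv> R_functor K"

lemma is_functor_R: "is_functor HB gSkBrcd RF"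
  unfolding is_functor_def
proof (intro conjI ballI)
  fix X assume X: "X \<in> Obj HB"
  note XD = HBrcd_barD[OF X]
  let ?H = "hopH X" and ?B = "hopB X"
  have sub: "gls ?H \<subseteq> carrier ?H" "gls ?B \<subseteq> carrier ?B"
    by (auto simp: grouplikes_carrier)
  show "FObj RF X \<in> Obj gSkBrcd" using R_obj_closed[OF X] by (simp add: R_functor_def)
  show "FMap RF X X (Idn HB X) = Idn gSkBrcd (FObj RF X)"
    using sub by (auto simp: R_functor_def HBrcd_bar_simps gSkBrcd_simps fun_eq_iff)
  fix Y p assume Y: "Y \<in> Obj HB" and p: "p \<in> Hom HB X Y"
  note YD = HBrcd_barD[OF Y]
  note p' = HBrcd_HomD[OF p]
  note pl = hopf_homD(4)[OF p'(1)] hopf_homD(4)[OF p'(2)]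
  note pg = HBrcd_Hom_grouplike[OF X Y p]
  have "snd p (phiB X (tens K ?H ?B x n)) = phiB Y (tens K (hopH Y) (hopB Y) (fst p x) (snd p n))"
    if "x \<in> gls ?H" "n \<in> gls ?B" for x n
    using that sub by (simp add: p'(3) tens_closed subset_iff tmap_tens[OF XD(4,5) YD(4,5) pl])
  then show "FMap RF X Y p \<in> Hom gSkBrcd (FObj RF X) (FObj RF Y)"
    using hopf_hom_grouplikes[OF XD(1) YD(1) p'(1)] hopf_hom_grouplikes[OF XD(2) YD(2) p'(2)] pg
      phiB_grouplike[OF X]
    by (simp add: R_functor_def gSkBrcd_simps)
  fix Z q assume "Z \<in> Obj HB" and "q \<in> Hom HB Y Z"
  show "FMap RF X Z (Comp HB X Y Z q p) =
          Comp gSkBrcd (FObj RF X) (FObj RF Y) (FObj RF Z)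
            (FMap RF Y Z q) (FMap RF X Y p)"
    using sub pg by (auto simp: R_functor_def HBrcd_bar_simps gSkBrcd_simps fun_eq_iff compose_def)
qed (rule category_HBrcd_bar category_gSkBrcd)+

end

section \<open>The functor P\<close>

context coded_field
begin

abbreviation "PO \<equiv> P_obj K enc"
abbreviation "PF \<equiv> P_functor K enc"
abbreviation "PR \<equiv> PR_bij K enc"

lemma P_obj_simps [simp]:
  "hopH (PO S) = gh (grpG S)" "hopB (PO S) = gh (grpN S)"
  by (simp_all add: P_obj_def Let_def)

text \<open>The defining formula is linear in \<open>X\<close> as an outer extension, and linear in
  \<open>Y\<close> by \<open>gext_param_hom\<close>; being bilinear, it may be lifted and evaluated
  on pure tensors.\<close>

lemma P_phi:
  assumes "S \<in> Obj gSkBrcd"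
  shows "phiB (PO S) \<in> lin_hom K (tensor K (gh (grpG S)) (gh (grpN S))) (gh (grpN S))"
    and "g \<in> carrier (grpG S) \<Longrightarrow> n \<in> carrier (grpN S) \<Longrightarrow>
      phiB (PO S) (tens K (gh (grpG S)) (gh (grpN S)) (gi g) (gi n)) = gi (actn S g n)"
proof -
  let ?H = "gh (grpG S)" and ?B = "gh (grpN S)"
  note S = gSkBrcdD[OF assms]
  let ?g = "\<lambda>g. ge ?B (\<lambda>n. gi (actn S g n))"
  have g: "?g x \<in> lin_hom K ?B ?B" if "x \<in> carrier (grpG S)" for x
    by (rule gext_hom[OF module_ghopf]) (auto simp: S that gincl_closed)
  have b: "bilin K ?H ?B ?B (\<lambda>X Y. ge ?B (\<lambda>g. ?g g Y) X)"
  proof (rule bilinI)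
    show "(\<lambda>Y. ge ?B (\<lambda>g. ?g g Y) X) \<in> lin_hom K ?B ?B" if "X \<in> carrier ?H" for X
      by (rule gext_param_hom[OF module_ghopf module_ghopf _ g that]) (rule lin_hom_closed[OF g])
    show "(\<lambda>X. ge ?B (\<lambda>g. ?g g Y) X) \<in> lin_hom K ?H ?B" if "Y \<in> carrier ?B" for Y
      by (rule gext_hom[OF module_ghopf]) (auto intro: lin_hom_closed[OF g] that)
  qed
  have phi: "phiB (PO S) = tlift K ?B (\<lambda>X Y. ge ?B (\<lambda>g. ?g g Y) X)"
    by (simp add: P_obj_def Let_def)
  show "phiB (PO S) \<in> lin_hom K (tensor K ?H ?B) ?B"
    unfolding phi by (rule tlift_hom[OF module_ghopf module_ghopf module_ghopf b])
  assume x: "g \<in> carrier (grpG S)" "n \<in> carrier (grpN S)"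
  then show "phiB (PO S) (tens K ?H ?B (gi g) (gi n)) = gi (actn S g n)"
    unfolding phi
    by (simp add: tlift_tens[OF module_ghopf module_ghopf module_ghopf b] gincl_closed gext_gincl
        module_ghopf lin_hom_closed[OF g] S)
qed

lemma ghopf_tensor_hom_eq:
  assumes "module K W" "f \<in> lin_hom K (tensor K (gh G) (gh N)) W" "f' \<in> lin_hom K (tensor K (gh G) (gh N)) W"
    "\<And>g n. g \<in> carrier G \<Longrightarrow> n \<in> carrier N \<Longrightarrow>
      f (tens K (gh G) (gh N) (gi g) (gi n)) = f' (tens K (gh G) (gh N) (gi g) (gi n))"
    "t \<in> carrier (tensor K (gh G) (gh N))"
  shows "f t = f' t"
  by (rule tensor_hom_eq_span[OF module_ghopf module_ghopf assms(1-3) gincl_image ghopf_span gincl_image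
        ghopf_span _ assms(5)]) (use assms(4) in auto)

lemma P_obj_closed:
  assumes "S \<in> Obj gSkBrcd"
  shows "PO S \<in> Obj HB"
proof -
  note S = gSkBrcdD[OF assms]
  let ?X = "PO S"
  let ?H = "gh (grpG S)" and ?B = "gh (grpN S)" and ?\<phi> = "phiB ?X"
  let ?T = "tensor K ?B ?B"
  interpret G: group "grpG S" by (rule S)
  interpret N: group "grpN S" by (rule S)
  note GM = G.monoid_axioms and NM = N.monoid_axioms
  note phi = P_phi[OF assms]
  note H = hopf_algebra_ghopf[OF S(1)] and B = hopf_algebra_ghopf[OF S(2)]
  note HD = hopf_algebraD[OF H] and BD = hopf_algebraD[OF B]
  note pl = bilin_left[OF bilin_tens[OF HD(1) BD(1)]] and pr = bilin_right[OF bilin_tens[OF HD(1) BD(1)]]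
  note phil = lin_hom_comp[OF pl phi(1)] and phir = lin_hom_comp[OF pr phi(1)]
  note lc = lin_hom_comp
  note phic = lin_hom_closed[OF phi(1) tens_closed]
  note bm = bilin_ghopf_mult[OF GM]
  note c = gincl_closed tens_closed
  have unit: "?\<phi> (tens K ?H ?B \<one>\<^bsub>?H\<^esub> b) = b" if b: "b \<in> carrier ?B" for b
    by (rule ghopf_hom_eq[OF BD(1) phir lin_hom_ident _ b]) (simp_all add: ghopf_one c phi(2) S)
  \<comment> \<open>The module law is extended one argument at a time: in \<open>b\<close> here, in
    \<open>h\<close> by \<open>a2\<close>, in \<open>g\<close> by \<open>a3\<close>.\<close>
  have a1: "?\<phi> (tens K ?H ?B (gi g \<otimes>\<^bsub>?H\<^esub> gi h) b) = ?\<phi> (tens K ?H ?B (gi g) (?\<phi> (tens K ?H ?B (gi h) b)))"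
    if "g \<in> carrier (grpG S)" "h \<in> carrier (grpG S)" "b \<in> carrier ?B" for g h b
    by (rule ghopf_hom_eq[OF BD(1) phir lc[OF phir phir] _ that(3)])
      (use that in \<open>simp_all add: c phi(2) S ghopf_mult_gincl[OF GM]\<close>)
  have a2: "?\<phi> (tens K ?H ?B (gi g \<otimes>\<^bsub>?H\<^esub> h) b) = ?\<phi> (tens K ?H ?B (gi g) (?\<phi> (tens K ?H ?B h b)))"
    if "g \<in> carrier (grpG S)" "h \<in> carrier ?H" "b \<in> carrier ?B" for g h b
    by (rule ghopf_hom_eq[OF BD(1) lc[OF bilin_right[OF bm] phil] lc[OF phil phir] _ that(2)])
      (use that in \<open>simp_all add: c a1\<close>)
  have a3: "?\<phi> (tens K ?H ?B (g \<otimes>\<^bsub>?H\<^esub> h) b) = ?\<phi> (tens K ?H ?B g (?\<phi> (tens K ?H ?B h b)))"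
    if "g \<in> carrier ?H" "h \<in> carrier ?H" "b \<in> carrier ?B" for g h b
    by (rule ghopf_hom_eq[OF BD(1) lc[OF bilin_left[OF bm] phil] phil _ that(1)])
      (use that in \<open>simp_all add: c a2 phic\<close>)
  note T = module_tensor[OF BD(1,1)]
  let ?r = "\<lambda>t. tmult K ?B (tmap K ?B ?B ?\<phi> (Phi_B K ?X)
          (tswap K ?H ?H ?B ?B (tmap K (tensor K ?H ?H) ?T (comul ?H) id t)))"
  note rhs = bracoid_rhs[of ?X, unfolded P_obj_simps, OF H B phi(1)]
  have lhs: "(\<lambda>t. ?\<phi> (tmap K ?H ?B id (tmult K ?B) t)) \<in> lin_hom K (tensor K ?H ?T) ?B"
    by (rule lc[OF tmap_hom[OF HD(1) T HD(1) BD(1) lin_hom_id tmult_hom[OF BD(2)]] phi(1)])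
  \<comment> \<open>The axiom lives on a triple tensor product. With a group element
    \<open>g\<close> fixed both sides are linear on \<open>B \<otimes> B\<close>, where pure tensors
    of group elements suffice; \<open>g\<close> is released afterwards.\<close>
  have br1: "?\<phi> (tmap K ?H ?B id (tmult K ?B) (tens K ?H ?T (gi g) s)) =
        ?r (tens K ?H ?T (gi g) s)"
    if g: "g \<in> carrier (grpG S)" and s: "s \<in> carrier ?T" for g s
  proof (rule ghopf_tensor_hom_eq[OF BD(1) lc[OF _ lhs] lc[OF _ rhs(1)] _ s])
    note br = bilin_right[OF bilin_tens[OF HD(1) T] gincl_closed[OF g]]
    show "tens K ?H ?T (gi g) \<in> lin_hom K ?T (tensor K ?H ?T)"
      "tens K ?H ?T (gi g) \<in> lin_hom K ?T (tensor K ?H ?T)"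
      by (rule br)+
    fix n n' assume n: "n \<in> carrier (grpN S)" "n' \<in> carrier (grpN S)"
    show "?\<phi> (tmap K ?H ?B id (tmult K ?B) (tens K ?H ?T (gi g) (tens K ?B ?B (gi n) (gi n')))) =
        ?r (tens K ?H ?T (gi g) (tens K ?B ?B (gi n) (gi n')))"
      \<comment> \<open>On group elements the axiom is the skew bracoid law of \<open>S\<close>, up
        to associativity.\<close>
      unfolding rhs(2)[OF gincl_grouplike[OF g] gincl_closed[OF n(1)] gincl_closed[OF n(2)]]
      using g n
      by (simp add: tmap_tens[OF HD(1) T HD(1) BD(1) lin_hom_id tmult_hom[OF BD(2)]] c tmult_tens[OF BD(2)]
          ghopf_mult_gincl[OF NM] phi(2) ghopf_one antipode_gincl[OF S(2)] S N.m_assoc)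
  qed
  have br: "?\<phi> (tmap K ?H ?B id (tmult K ?B) t) =
        ?r t"
    if t: "t \<in> carrier (tensor K ?H ?T)" for t
    by (rule tensor_hom_eq_span[OF HD(1) T BD(1) lhs rhs(1) gincl_image ghopf_span subset_refl
          lin_span_self[OF T, symmetric] _ t]) (use br1 in auto)
  have "hopf_bracoid K ?X"
    using H B phi(1) unit a3 br by (simp add: hopf_bracoid_def Let_def)
  moreover have "?\<phi> \<in> coalg_hom K (tensor_coalg K ?H ?B) ?B"
  proof -
    note cc = tensor_comul_hom_tens[OF HD(3) BD(3)]
    note T = module_tensor[OF HD(1) BD(1)]
    \<comment> \<open>At \<open>gi g \<otimes> gi n\<close> both sides are
      \<open>y \<otimes> y\<close> with \<open>y = gi (actn S g n)\<close>.\<close>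
    have "comul ?B (?\<phi> t) = tmap K ?B ?B ?\<phi> ?\<phi> (comul (tensor_coalg K ?H ?B) t)"
      if t: "t \<in> carrier (tensor K ?H ?B)" for t
      by (rule ghopf_tensor_hom_eq[OF module_tensor[OF BD(1,1)] lc[OF phi(1) BD(4)]
            lc[OF cc(1) tmap_hom[OF T T BD(1,1) phi(1,1)]] _ t])
        (simp add: cc(3)[OF gincl_grouplike gincl_grouplike] tmap_tens[OF T T BD(1,1) phi(1,1)] c phi(2)
          comul_gincl S del: tensor_coalg_simps)
    moreover have "counit ?B (?\<phi> t) = counit (tensor_coalg K ?H ?B) t"
      if t: "t \<in> carrier (tensor K ?H ?B)" for t
      by (rule ghopf_tensor_hom_eq[OF module_ground lc[OF phi(1) BD(5)] cc(2) _ t])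
        (simp add: cc(4)[OF gincl_grouplike gincl_grouplike] phi(2) counit_gincl del: tensor_coalg_simps)
    ultimately show ?thesis using phi(1) by (simp add: coalg_hom_def lin_hom_tensor_coalg)
  qed
  ultimately show ?thesis by (simp add: HBrcd_bar_simps)
qed

text \<open>Compatibility of the two extensions with the actions is an identity of linear maps on
  \<open>K[G] \<otimes> K[N]\<close>, so \<open>act\<close> suffices. The morphisms
  \<open>P (f, g)\<close>, the preimages under \<open>PR_bij\<close> and the counit are all
  constructed by this lemma.\<close>

lemma gext_Hom:
  assumes S: "S \<in> Obj gSkBrcd" and X: "X \<in> Obj HB"
    and f: "f \<in> hom (grpG S) (grouplikes K (hopH X))" and f': "f' \<in> hom (grpN S) (grouplikes K (hopB X))"
    and act: "\<And>g n. g \<in> carrier (grpG S) \<Longrightarrow> n \<in> carrier (grpN S) \<Longrightarrow>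
      f' (actn S g n) = phiB X (tens K (hopH X) (hopB X) (f g) (f' n))"
  shows "(restrict (ge (hopH X) f) (carrier (gh (grpG S))), restrict (ge (hopB X) f') (carrier (gh (grpN S))))
    \<in> Hom HB (PO S) X"
proof -
  note SD = gSkBrcdD[OF S] and XD = HBrcd_barD[OF X] and phi = P_phi[OF S]
  let ?H = "gh (grpG S)" and ?B = "gh (grpN S)"
  let ?p = "restrict (ge (hopH X) f) (carrier ?H)" and ?q = "restrict (ge (hopB X) f') (carrier ?B)"
  have p: "?p \<in> hopf_hom K ?H (hopH X)" by (rule gext_hopf_hom[OF SD(1) XD(1) f])
  have q: "?q \<in> hopf_hom K ?B (hopB X)" by (rule gext_hopf_hom[OF SD(2) XD(2) f'])
  note pl = hopf_homD(4)[OF p] and ql = hopf_homD(4)[OF q]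
  have fc: "f g \<in> carrier (hopH X)" if "g \<in> carrier (grpG S)" for g
    using hom_in_carrier[OF f that] by (simp add: grouplikes_carrier)
  have fc': "f' n \<in> carrier (hopB X)" if "n \<in> carrier (grpN S)" for n
    using hom_in_carrier[OF f' that] by (simp add: grouplikes_carrier)
  have g: "ge (hopH X) f (gi x) = f x" if "x \<in> carrier (grpG S)" for x
    using fc[OF that] by (simp add: gext_gincl XD)
  have g': "ge (hopB X) f' (gi x) = f' x" if "x \<in> carrier (grpN S)" for x
    using fc'[OF that] by (simp add: gext_gincl XD)
  have "?q (phiB (PO S) t) = phiB X (tmap K (hopH X) (hopB X) ?p ?q t)"
    if t: "t \<in> carrier (tensor K ?H ?B)" for t
    by (rule ghopf_tensor_hom_eq[OF XD(5) lin_hom_comp[OF phi(1) ql]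
          lin_hom_comp[OF tmap_hom[OF module_ghopf module_ghopf XD(4,5) pl ql] XD(3)] _ t])
      (simp add: phi(2) tmap_tens[OF module_ghopf module_ghopf XD(4,5) pl ql] gincl_closed SD g g' act)
  then show ?thesis using p q by (simp add: HBrcd_bar_simps)
qed

lemma gincl_hom:
  assumes "group G" shows "gi \<in> hom G (grouplikes K (gh G))"
proof -
  interpret group G by fact
  show ?thesis using gincl_grouplike ghopf_mult_gincl[OF monoid_axioms] by (intro homI) auto
qed

lemma ghopf_map_eq: "ghopf_map K enc G G' f = restrict (ge (gh G') (\<lambda>x. gi (f x))) (carrier (gh G))"
  by (simp add: ghopf_map_def gext_galg galg_simps)

lemma ghopf_map_gincl:
  "x \<in> carrier G \<Longrightarrow> f x \<in> carrier G' \<Longrightarrow> ghopf_map K enc G G' f (gi x) = gi (f x)"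
  by (simp add: ghopf_map_eq gincl_closed gext_gincl module_ghopf)

lemma hopf_hom_ghopf_eq:
  assumes "hopf_algebra K H" "f \<in> hopf_hom K (gh G) H" "g \<in> hopf_hom K (gh G) H"
    "\<And>x. x \<in> carrier G \<Longrightarrow> f (gi x) = g (gi x)"
  shows "f = g"
proof (rule extensionalityI[OF hopf_homD(3)[OF assms(2)] hopf_homD(3)[OF assms(3)]])
  fix X assume X: "X \<in> carrier (gh G)"
  show "f X = g X"
    by (rule ghopf_hom_eq[OF hopf_algebraD(1)[OF assms(1)] hopf_homD(4)[OF assms(2)] hopf_homD(4)[OF assms(3)] _ X])
      (rule assms(4))
qed

text \<open>Linearity determines the maps on the carriers, and extensionality everywhere else.
  Functoriality of \<open>P\<close> and injectivity of the adjunction map both reduce to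
  this.\<close>

lemma Hom_P_eqI:
  assumes "X \<in> Obj HB" "p \<in> Hom HB (PO S) X" "q \<in> Hom HB (PO S) X"
    "\<And>x. x \<in> carrier (grpG S) \<Longrightarrow> fst p (gi x) = fst q (gi x)"
    "\<And>n. n \<in> carrier (grpN S) \<Longrightarrow> snd p (gi n) = snd q (gi n)"
  shows "p = q"
proof (rule prod_eqI)
  note XD = HBrcd_barD[OF assms(1)]
  show "fst p = fst q"
    by (rule hopf_hom_ghopf_eq[OF XD(1), of _ "grpG S"]) (use assms in \<open>simp_all add: HBrcd_bar_simps\<close>)
  show "snd p = snd q"
    by (rule hopf_hom_ghopf_eq[OF XD(2), of _ "grpN S"]) (use assms in \<open>simp_all add: HBrcd_bar_simps\<close>)
qed

lemma P_map_closed: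
  assumes S: "S \<in> Obj gSkBrcd" and T: "T \<in> Obj gSkBrcd" and p: "p \<in> Hom gSkBrcd S T"
  shows "FMap PF S T p \<in> Hom HB (PO S) (PO T)"
proof -
  note SD = gSkBrcdD[OF S] and TD = gSkBrcdD[OF T]
  have p': "fst p \<in> hom (grpG S) (grpG T)" "snd p \<in> hom (grpN S) (grpN T)"
    "\<And>x n. x \<in> carrier (grpG S) \<Longrightarrow> n \<in> carrier (grpN S) \<Longrightarrow> snd p (actn S x n) = actn T (fst p x) (snd p n)"
    using p by (simp_all add: gSkBrcd_simps)
  have h: "(\<lambda>x. gi (fst p x)) \<in> hom (grpG S) (grouplikes K (gh (grpG T)))"
    "(\<lambda>x. gi (snd p x)) \<in> hom (grpN S) (grouplikes K (gh (grpN T)))"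
    using p' gincl_hom[OF TD(1)] gincl_hom[OF TD(2)] by (auto simp: hom_def Pi_iff)
  have "(restrict (ge (gh (grpG T)) (\<lambda>x. gi (fst p x))) (carrier (gh (grpG S))),
      restrict (ge (gh (grpN T)) (\<lambda>x. gi (snd p x))) (carrier (gh (grpN S))))
    \<in> Hom HB (PO S) (PO T)"
    by (rule gext_Hom[OF S P_obj_closed[OF T], unfolded P_obj_simps, OF h])
      (simp add: p'(3) P_phi(2)[OF T] hom_in_carrier[OF p'(1)] hom_in_carrier[OF p'(2)])
  then show ?thesis by (simp add: P_functor_def ghopf_map_eq)
qed

lemma gSkBrcd_Hom_closed:
  assumes "p \<in> Hom gSkBrcd S T"
  shows "x \<in> carrier (grpG S) \<Longrightarrow> fst p x \<in> carrier (grpG T)"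
    and "n \<in> carrier (grpN S) \<Longrightarrow> snd p n \<in> carrier (grpN T)"
  using assms by (auto simp: gSkBrcd_simps hom_def)

lemma P_functor_gincl:
  assumes "p \<in> Hom gSkBrcd S T"
  shows "x \<in> carrier (grpG S) \<Longrightarrow> fst (FMap PF S T p) (gi x) = gi (fst p x)"
    and "n \<in> carrier (grpN S) \<Longrightarrow> snd (FMap PF S T p) (gi n) = gi (snd p n)"
  using gSkBrcd_Hom_closed[OF assms] by (simp_all add: P_functor_def ghopf_map_gincl)

lemma is_functor_P: "is_functor gSkBrcd HB PF"
proof -
  have o: "FObj PF S = PO S" for S by (simp add: P_functor_def)
  note C = categoryD[OF category_gSkBrcd] and D = categoryD[OF category_HBrcd_bar]
  show ?thesis
    unfolding is_functor_def o
  proof (intro conjI ballI)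
    fix S :: "'u skbrcd" assume S: "S \<in> Obj gSkBrcd"
    note PS = P_obj_closed[OF S]
    show "PO S \<in> Obj HB" by (rule PS)
    show "FMap PF S S (Idn gSkBrcd S) = Idn HB (PO S)"
      by (rule Hom_P_eqI[OF PS P_map_closed[OF S S C(1)[OF S]] D(1)[OF PS]])
        (simp_all add: P_functor_gincl[OF C(1)[OF S]] HBrcd_bar_simps(3) gincl_closed,
          simp_all add: gSkBrcd_simps(3))
    fix T p assume T: "T \<in> Obj gSkBrcd" and p: "p \<in> Hom gSkBrcd S T"
    show "FMap PF S T p \<in> Hom HB (PO S) (PO T)"
      by (rule P_map_closed[OF S T p])
    fix U q assume U: "U \<in> Obj gSkBrcd" and q: "q \<in> Hom gSkBrcd T U"
    show "FMap PF S U (Comp gSkBrcd S T U q p) =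
        Comp HB (PO S) (PO T) (PO U)
          (FMap PF T U q) (FMap PF S T p)"
      by (rule Hom_P_eqI[OF P_obj_closed[OF U] P_map_closed[OF S U C(2)[OF S T U p q]]
            D(2)[OF PS P_obj_closed[OF T] P_obj_closed[OF U] P_map_closed[OF S T p] P_map_closed[OF T U q]]])
        (simp_all add: P_functor_gincl[OF C(2)[OF S T U p q]] HBrcd_bar_simps(4) compose_eq
          gincl_closed P_functor_gincl[OF p] P_functor_gincl[OF q] gSkBrcd_Hom_closed[OF p],
          simp_all add: gSkBrcd_simps(4) compose_eq)
  qed (rule category_HBrcd_bar category_gSkBrcd)+
qed

section \<open>The adjunction bijection\<close>

lemma PR_bij_simps:
  "x \<in> carrier (grpG S) \<Longrightarrow> fst (PR S X p) x = fst p (gi x)"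
  "n \<in> carrier (grpN S) \<Longrightarrow> snd (PR S X p) n = snd p (gi n)"
  "fst (PR S X p) \<in> extensional (carrier (grpG S))"
  "snd (PR S X p) \<in> extensional (carrier (grpN S))"
  by (simp_all add: PR_bij_def)

text \<open>Hopf morphisms send the group-like elements \<open>gi x\<close> to group-like elements,
  so the restrictions land in the groups of \<open>R\<close>; equivariance is compatibility with the
  actions at \<open>gi x \<otimes> gi n\<close>.\<close>

lemma PR_bij_closed:
  assumes S: "S \<in> Obj gSkBrcd" and X: "X \<in> Obj HB" and p: "p \<in> Hom HB (PO S) X"
  shows "PR S X p \<in> Hom gSkBrcd S (R_obj K X)"
proof -
  note SD = gSkBrcdD[OF S] and XD = HBrcd_barD[OF X] and PD = HBrcd_barD[OF P_obj_closed[OF S]]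
  interpret G: group "grpG S" by (rule SD)
  interpret N: group "grpN S" by (rule SD)
  note p' = HBrcd_HomD[OF p, unfolded P_obj_simps]
  note gl = HBrcd_Hom_grouplike[OF P_obj_closed[OF S] X p, unfolded P_obj_simps, OF gincl_grouplike]
  note m1 = ring_hom_mult[OF hopf_homD(2)[OF p'(1)] gincl_closed gincl_closed]
    and m2 = ring_hom_mult[OF hopf_homD(2)[OF p'(2)] gincl_closed gincl_closed]
  have "fst (PR S X p) \<in> hom (grpG S) (grouplikes K (hopH X))"
    by (rule homI) (simp_all add: PR_bij_simps gl ghopf_mult_gincl[OF G.monoid_axioms, symmetric] m1)
  moreover have "snd (PR S X p) \<in> hom (grpN S) (grouplikes K (hopB X))"
    by (rule homI) (simp_all add: PR_bij_simps gl ghopf_mult_gincl[OF N.monoid_axioms, symmetric] m2)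
  moreover have "snd p (gi (actn S x n)) = phiB X (tens K (hopH X) (hopB X) (fst p (gi x)) (snd p (gi n)))"
    if "x \<in> carrier (grpG S)" "n \<in> carrier (grpN S)" for x n
    using that p'(3)[OF tens_closed[OF gincl_closed gincl_closed], OF that]
    by (simp add: P_phi(2)[OF S] gincl_closed
        tmap_tens[OF module_ghopf module_ghopf XD(4,5) hopf_homD(4)[OF p'(1)] hopf_homD(4)[OF p'(2)]])
  ultimately show ?thesis
    by (simp add: gSkBrcd_simps PR_bij_simps SD gl)
qed

text \<open>Injectivity holds because group elements generate; surjectivity because a morphism into
  \<open>R X\<close> extends linearly by \<open>gext_Hom\<close>.\<close>

lemma PR_bij_bij:
  assumes S: "S \<in> Obj gSkBrcd" and X: "X \<in> Obj HB"
  shows "bij_betw (PR S X) (Hom HB (PO S) X) (Hom gSkBrcd S (R_obj K X))"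
proof (rule bij_betw_imageI)
  show "inj_on (PR S X) (Hom HB (PO S) X)"
  proof (rule inj_onI)
    fix p q assume pq: "p \<in> Hom HB (PO S) X" "q \<in> Hom HB (PO S) X"
      and eq: "PR S X p = PR S X q"
    show "p = q"
      by (rule Hom_P_eqI[OF X pq]) (use eq PR_bij_simps(1,2) in metis)+
  qed
  show "PR S X ` Hom HB (PO S) X = Hom gSkBrcd S (R_obj K X)"
  proof
    show "PR S X ` Hom HB (PO S) X \<subseteq> Hom gSkBrcd S (R_obj K X)"
      using PR_bij_closed[OF S X] by auto
    show "Hom gSkBrcd S (R_obj K X) \<subseteq> PR S X ` Hom HB (PO S) X"
    proof
      fix r assume r: "r \<in> Hom gSkBrcd S (R_obj K X)"
      note XD = HBrcd_barD[OF X]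
      have r': "fst r \<in> hom (grpG S) (grouplikes K (hopH X))" "snd r \<in> hom (grpN S) (grouplikes K (hopB X))"
        "fst r \<in> extensional (carrier (grpG S))" "snd r \<in> extensional (carrier (grpN S))"
        using r by (simp_all add: gSkBrcd_simps)
      note c = hom_in_carrier[OF r'(1)] hom_in_carrier[OF r'(2)]
      have act: "snd r (actn S g n) = phiB X (tens K (hopH X) (hopB X) (fst r g) (snd r n))"
        if "g \<in> carrier (grpG S)" "n \<in> carrier (grpN S)" for g n
        using r that c by (simp add: gSkBrcd_simps)
      let ?p = "(restrict (ge (hopH X) (fst r)) (carrier (gh (grpG S))),
        restrict (ge (hopB X) (snd r)) (carrier (gh (grpN S))))"
      have p: "?p \<in> Hom HB (PO S) X" by (rule gext_Hom[OF S X r'(1,2) act])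
      have "PR S X ?p = r"
      proof (rule prod_eqI)
        show "fst (PR S X ?p) = fst r"
          by (rule extensionalityI[OF PR_bij_simps(3) r'(3)])
            (use c in \<open>simp add: PR_bij_simps gincl_closed gext_gincl XD grouplikes_carrier\<close>)
        show "snd (PR S X ?p) = snd r"
          by (rule extensionalityI[OF PR_bij_simps(4) r'(4)])
            (use c in \<open>simp add: PR_bij_simps gincl_closed gext_gincl XD grouplikes_carrier\<close>)
      qed
      then show "r \<in> PR S X ` Hom HB (PO S) X" using p by (metis imageI)
    qed
  qed
qed

text \<open>Restriction along \<open>gi\<close> commutes with composition, and \<open>P\<close>
  sends \<open>gi x\<close> to \<open>gi\<close> of the image of \<open>x\<close>, so both
  naturality laws are computations on group elements. The second also needs the images to be
  group-like, since \<open>R\<close> restricts morphisms to those.\<close>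

lemma adjunction_P_R: "adjunction gSkBrcd HB PF RF (PR)"
proof -
  have o: "FObj PF S = PO S" "FObj RF X = R_obj K X" for S X
    by (simp_all add: P_functor_def R_functor_def)
  show ?thesis
    unfolding adjunction_def o
  proof (intro conjI ballI is_functor_P is_functor_R PR_bij_bij)
    fix A A' :: "'u skbrcd" and X a h
    assume a: "a \<in> Hom gSkBrcd A' A"
    show "PR A' X (Comp HB (PO A') (PO A) X h (FMap PF A' A a)) =
        Comp gSkBrcd A' A (R_obj K X) (PR A X h) a"
      using P_functor_gincl[OF a] gSkBrcd_Hom_closed[OF a]
      by (simp add: PR_bij_def HBrcd_bar_simps(4) gSkBrcd_simps(4) compose_def gincl_closed cong: restrict_cong)
  next
    fix A X X' h k
    assume A: "A \<in> Obj gSkBrcd" and X: "X \<in> Obj HB" and h: "h \<in> Hom HB (PO A) X"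
    note gl = HBrcd_Hom_grouplike[OF P_obj_closed[OF A] X h, unfolded P_obj_simps, OF gincl_grouplike]
    show "PR A X' (Comp HB (PO A) X X' k h) =
        Comp gSkBrcd A (R_obj K X) (R_obj K X') (FMap RF X X' k) (PR A X h)"
      by (simp add: PR_bij_def R_functor_def HBrcd_bar_simps(4) gSkBrcd_simps(4) compose_def gincl_closed gl
          cong: restrict_cong)
  qed
qed

section \<open>Invertibility of unit and counit\<close>

lemma gincl_bij: "bij_betw gi (carrier G) (gls (gh G))"
  unfolding bij_betw_def using gincl_inj by (auto simp: inj_on_def carrier_grouplikes_ghopf)

text \<open>The unit is the restriction of an identity along \<open>gi\<close>, so both of its
  components are \<open>gi\<close>, which is bijective onto the group-like elements.\<close>

lemma unit_iso:
  assumes A: "A \<in> Obj gSkBrcd"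
  shows "is_iso gSkBrcd A (R_obj K (PO A)) (adj_unit HB PF (PR) A)"
proof -
  let ?u = "adj_unit HB PF (PR) A"
  have u: "?u = PR A (PO A) (Idn HB (PO A))"
    by (simp add: adj_unit_def P_functor_def)
  have 1: "fst ?u x = gi x" if "x \<in> carrier (grpG A)" for x
    using that unfolding u by (simp add: PR_bij_simps HBrcd_bar_simps gincl_closed)
  have 2: "snd ?u x = gi x" if "x \<in> carrier (grpN A)" for x
    using that unfolding u by (simp add: PR_bij_simps HBrcd_bar_simps gincl_closed)
  have "?u \<in> Hom gSkBrcd A (R_obj K (PO A))"
    unfolding u using P_obj_closed[OF A]
    by (intro PR_bij_closed A categoryD(1)[OF category_HBrcd_bar])
  then show ?thesis
    using gincl_bij[of "grpG A"] gincl_bij[of "grpN A"]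
    by (intro gSkBrcd_isoI A) (simp_all add: bij_betw_cong[OF 1] bij_betw_cong[OF 2])
qed

lemma counit_iso:
  assumes X: "X \<in> Obj HB" and pc: "pointed_cosemisimple K X"
  shows "is_iso HB (PO (R_obj K X)) X
    (adj_counit gSkBrcd HB PF RF (PR) X)"
proof -
  note XD = HBrcd_barD[OF X] and RX = R_obj_closed[OF X]
  let ?G = "grouplikes K (hopH X)" and ?N = "grouplikes K (hopB X)"
  \<comment> \<open>The candidate for the counit: the linear extension of the inclusion of the
    group-like elements. Its restriction along \<open>gi\<close> is the identity, which
    characterises the counit.\<close>
  let ?e = "(restrict (ge (hopH X) (\<lambda>x. x)) (carrier (gh ?G)), restrict (ge (hopB X) (\<lambda>x. x)) (carrier (gh ?N)))"
  have o: "FObj PF S = PO S" "FObj RF X = R_obj K X" for S X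
    by (simp_all add: P_functor_def R_functor_def)
  have e: "?e \<in> Hom HB (PO (R_obj K X)) X"
    by (rule gext_Hom[OF RX X, unfolded R_obj_simps]) (auto simp: hom_def)
  have "x \<in> carrier ?G \<Longrightarrow> x \<in> carrier (hopH X)" "n \<in> carrier ?N \<Longrightarrow> n \<in> carrier (hopB X)" for x n
    by (simp_all add: grouplikes_carrier)
  then have "PR (R_obj K X) X ?e = Idn gSkBrcd (R_obj K X)"
    by (auto simp: PR_bij_def gSkBrcd_simps gincl_closed gext_gincl XD)
  then have eq: "adj_counit gSkBrcd HB PF RF (PR) X = ?e"
    using adj_counit_eqI[OF adjunction_P_R X, unfolded o, OF e] by simp
  have "bij_betw (ge (hopH X) (\<lambda>x. x)) (carrier (gh ?G)) (carrier (hopH X))"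
    "bij_betw (ge (hopB X) (\<lambda>x. x)) (carrier (gh ?N)) (carrier (hopB X))"
    using pc by (simp_all add: pointed_cosemisimple_def gext_grouplikes_bij XD)
  then have "bij_betw (fst ?e) (carrier (gh ?G)) (carrier (hopH X))"
    "bij_betw (snd ?e) (carrier (gh ?N)) (carrier (hopB X))"
    by (simp_all cong: bij_betw_cong)
  then show ?thesis
    unfolding eq by (intro HBrcd_bar_isoI P_obj_closed RX X e) simp_all
qed

lemma P_obj_pointed_cosemisimple: "pointed_cosemisimple K (PO S)"
  by (simp add: pointed_cosemisimple_def pointed_cosemisimple_ghopf)

end

theorem corollary2p12:
  fixes K :: "('k, 'm) ring_scheme"
    and enc :: "('u \<Rightarrow> 'k) \<Rightarrow> 'u"
  assumes "field K"
    and "inj_on enc (fin_supp K)"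
  shows "adjunction gSkBrcd (HBrcd_bar K) (P_functor K enc) (R_functor K) (PR_bij K enc) \<and>
    cat_equivalence gSkBrcd (full_subcat (HBrcd_bar K) (pointed_cosemisimple K))
      (P_functor K enc) (R_functor K)
      (adj_unit (HBrcd_bar K) (P_functor K enc) (PR_bij K enc))
      (adj_counit gSkBrcd (HBrcd_bar K) (P_functor K enc) (R_functor K) (PR_bij K enc))"
proof -
  interpret coded_field K enc
    by (intro coded_field.intro base_field.intro coded_field_axioms.intro assms)
  have o: "FObj (P_functor K enc) S = P_obj K enc S" "FObj (R_functor K) X = R_obj K X" for S X
    by (simp_all add: P_functor_def R_functor_def)
  show ?thesis
    using adjunction_P_R
    by (intro conjI adjunction_cat_equivalence)
      (simp_all add: o P_obj_pointed_cosemisimple unit_iso counit_iso)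
qed

end
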